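(* Let $(\mathcal{D})$ be any combination (i.e. conjunction of any subcollection) of the following seven group properties: being torsion-free; being locally indicable; being amenable; being elementary amenable; being subexponentially amenable; being right orderable; being orderable. Then every countable group with Property $(\mathcal{D})$ embeds in an infinite countable simple group with Property $(\mathcal{D})$.
   Context: Groups are discrete. A group is indicable if it has an infinite cyclic quotient, and locally indicable if all its non-trivial finitely generated subgroups are indicable. A group $G$ is amenable if it has a left-invariant finitely additive probability measure defined on all subsets of $G$. The class $EG$ of elementary amenable groups is the smallest class of groups containing all finite groups and all abelian groups and closed under (i) taking subgroups, (ii) taking quotients, (iii) extensions, (iv) direct limits. The class $SG$ of subexponentially amenable groups is the smallest class of groups containing all finitely generated groups of subexponential growth and closed under (i)-(iv). A group is orderable if it has a linear (total) order invariant under both left and right multiplication, and right orderable if it has a linear order invariant under right multiplication. *)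

theory Defs
  imports "HOL-Analysis.Analysis" "HOL-Algebra.Algebra"
begin

definition torsion_free :: "'a monoid \<Rightarrow> bool" where
  "torsion_free G \<longleftrightarrow>
     (\<forall>x\<in>carrier G. \<forall>n::nat. n > 0 \<longrightarrow> x [^]\<^bsub>G\<^esub> n = \<one>\<^bsub>G\<^esub> \<longrightarrow> x = \<one>\<^bsub>G\<^esub>)"

definition indicable :: "'a monoid \<Rightarrow> bool" where
  "indicable G \<longleftrightarrow> (\<exists>N. N \<lhd> G \<and> (G Mod N) \<cong> integer_group)"

definition finitely_generated_group :: "'a monoid \<Rightarrow> bool" where
  "finitely_generated_group G \<longleftrightarrow>
     (\<exists>S. finite S \<and> S \<subseteq> carrier G \<and> generate G S = carrier G)"

definition locally_indicable :: "'a monoid \<Rightarrow> bool" where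
  "locally_indicable G \<longleftrightarrow>
     (\<forall>H. subgroup H G \<and> H \<noteq> {\<one>\<^bsub>G\<^esub>} \<and> finitely_generated_group (G\<lparr>carrier := H\<rparr>)
        \<longrightarrow> indicable (G\<lparr>carrier := H\<rparr>))"

definition amenable :: "'a monoid \<Rightarrow> bool" where
  "amenable G \<longleftrightarrow>
     (\<exists>\<mu> :: 'a set \<Rightarrow> real.
        (\<forall>A. A \<subseteq> carrier G \<longrightarrow> 0 \<le> \<mu> A) \<and>
        \<mu> (carrier G) = 1 \<and>
        (\<forall>A B. A \<subseteq> carrier G \<longrightarrow> B \<subseteq> carrier G \<longrightarrow> A \<inter> B = {} \<longrightarrow> \<mu> (A \<union> B) = \<mu> A + \<mu> B) \<and>
        (\<forall>g\<in>carrier G. \<forall>A. A \<subseteq> carrier G \<longrightarrow> \<mu> (g <#\<^bsub>G\<^esub> A) = \<mu> A))"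

definition right_orderable :: "'a monoid \<Rightarrow> bool" where
  "right_orderable G \<longleftrightarrow>
     (\<exists>r. linear_order_on (carrier G) r \<and>
        (\<forall>x\<in>carrier G. \<forall>y\<in>carrier G. \<forall>z\<in>carrier G.
           (x, y) \<in> r \<longrightarrow> (x \<otimes>\<^bsub>G\<^esub> z, y \<otimes>\<^bsub>G\<^esub> z) \<in> r))"

definition orderable :: "'a monoid \<Rightarrow> bool" where
  "orderable G \<longleftrightarrow>
     (\<exists>r. linear_order_on (carrier G) r \<and>
        (\<forall>x\<in>carrier G. \<forall>y\<in>carrier G. \<forall>z\<in>carrier G.
           (x, y) \<in> r \<longrightarrow>
             (x \<otimes>\<^bsub>G\<^esub> z, y \<otimes>\<^bsub>G\<^esub> z) \<in> r \<and> (z \<otimes>\<^bsub>G\<^esub> x, z \<otimes>\<^bsub>G\<^esub> y) \<in> r))"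

subsection \<open>Growth\<close>

definition word_ball :: "'a monoid \<Rightarrow> 'a set \<Rightarrow> nat \<Rightarrow> 'a set" where
  "word_ball G S n =
     {foldr (\<otimes>\<^bsub>G\<^esub>) w \<one>\<^bsub>G\<^esub> | w. set w \<subseteq> S \<union> m_inv G ` S \<and> length w \<le> n}"

text \<open>Whether the growth rate is 1 does not depend on the finite generating set \<open>S\<close>.\<close>

definition fg_subexponential_growth :: "'a monoid \<Rightarrow> bool" where
  "fg_subexponential_growth G \<longleftrightarrow>
     (\<exists>S. finite S \<and> S \<subseteq> carrier G \<and> generate G S = carrier G \<and>
        (\<lambda>n. root n (real (card (word_ball G S n)))) \<longlonglongrightarrow> 1)"

subsection \<open>Direct limits\<close>

text \<open>A directed system is indexed by a non-empty directed preorder \<open>r\<close> on \<open>I\<close>, where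
  \<open>(i, j) \<in> r\<close> reads \<open>i \<le> j\<close>; its limit is the disjoint union of the groups modulo eventual
  equality, with two classes multiplied through representatives at a common index.\<close>

definition direct_system ::
  "'i set \<Rightarrow> 'i rel \<Rightarrow> ('i \<Rightarrow> 'a monoid) \<Rightarrow> ('i \<Rightarrow> 'i \<Rightarrow> 'a \<Rightarrow> 'a) \<Rightarrow> bool" where
  "direct_system I r G f \<longleftrightarrow>
     I \<noteq> {} \<and> preorder_on I r \<and>
     (\<forall>i\<in>I. \<forall>j\<in>I. \<exists>k\<in>I. (i, k) \<in> r \<and> (j, k) \<in> r) \<and>
     (\<forall>i\<in>I. group (G i)) \<and>
     (\<forall>i j. (i, j) \<in> r \<longrightarrow> f i j \<in> hom (G i) (G j)) \<and>
     (\<forall>i\<in>I. \<forall>x\<in>carrier (G i). f i i x = x) \<and>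
     (\<forall>i j k. (i, j) \<in> r \<longrightarrow> (j, k) \<in> r \<longrightarrow> (\<forall>x\<in>carrier (G i). f j k (f i j x) = f i k x))"

definition eventually_equal ::
  "'i set \<Rightarrow> 'i rel \<Rightarrow> ('i \<Rightarrow> 'a monoid) \<Rightarrow> ('i \<Rightarrow> 'i \<Rightarrow> 'a \<Rightarrow> 'a) \<Rightarrow> ('i \<times> 'a) rel" where
  "eventually_equal I r G f =
     {((i, x), (j, y)) | i x j y.
        i \<in> I \<and> x \<in> carrier (G i) \<and> j \<in> I \<and> y \<in> carrier (G j) \<and>
        (\<exists>k\<in>I. (i, k) \<in> r \<and> (j, k) \<in> r \<and> f i k x = f j k y)}"

definition direct_limit ::
  "'i set \<Rightarrow> 'i rel \<Rightarrow> ('i \<Rightarrow> 'a monoid) \<Rightarrow> ('i \<Rightarrow> 'i \<Rightarrow> 'a \<Rightarrow> 'a) \<Rightarrow> ('i \<times> 'a) set monoid" where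
  "direct_limit I r G f =
     \<lparr>carrier = (SIGMA i:I. carrier (G i)) // eventually_equal I r G f,
      monoid.mult = (\<lambda>A B. \<Union>{eventually_equal I r G f `` {(i, x \<otimes>\<^bsub>G i\<^esub> y)} | i x y.
                                (i, x) \<in> A \<and> (i, y) \<in> B}),
      one = (\<Union>i\<in>I. eventually_equal I r G f `` {(i, \<one>\<^bsub>G i\<^esub>)})\<rparr>"

subsection \<open>Elementary and subexponentially amenable groups\<close>

text \<open>The smallest class of groups that contains the groups in \<open>B\<close> and is closed under subgroups,
  quotients, extensions and direct limits. Classes of groups are closed under isomorphism; here
  this is the rule \<open>quot\<close> with a trivial normal subgroup.

  All groups are realised on subsets of the one type \<open>'a\<close>; for the base classes used below this
  loses nothing, and the predicate at \<open>'a\<close> describes the class among all groups that fit into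
  \<open>'a\<close>. For finite \<open>'a\<close> all such groups are in the base class. For infinite \<open>'a\<close>, call a group
  good if all its sections (quotients of subgroups) that fit into \<open>'a\<close> satisfy the predicate at
  \<open>'a\<close>. Groups in the base class, of any size, are good (a section of a finitely generated group
  of subexponential growth is the directed union of its finitely generated subgroups, which have
  subexponential growth). Goodness passes to sections. It also passes to extensions, as a section
  of an extension is an extension of two sections, and to direct limits, as a section of a direct
  limit is the directed union of sections of the groups in the system. These unions are indexed
  by subgroups of the section, which is why index sets are taken in \<open>'a set\<close>.\<close>

inductive amenability_closure :: "('a monoid \<Rightarrow> bool) \<Rightarrow> 'a monoid \<Rightarrow> bool"
  for B :: "'a monoid \<Rightarrow> bool" where
  base: "\<lbrakk>group G; B G\<rbrakk> \<Longrightarrow> amenability_closure B G"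
| sub: "\<lbrakk>amenability_closure B G; subgroup H G\<rbrakk> \<Longrightarrow> amenability_closure B (G\<lparr>carrier := H\<rparr>)"
| quot: "\<lbrakk>amenability_closure B G; N \<lhd> G; group Q; (G Mod N) \<cong> Q\<rbrakk> \<Longrightarrow> amenability_closure B Q"
| ext: "\<lbrakk>group G; N \<lhd> G; amenability_closure B (G\<lparr>carrier := N\<rparr>);
         amenability_closure B Q; (G Mod N) \<cong> Q\<rbrakk> \<Longrightarrow> amenability_closure B G"
| lim: "\<lbrakk>direct_system (I :: 'a set set) r G f; \<And>i. i \<in> I \<Longrightarrow> amenability_closure B (G i);
         group L; direct_limit I r G f \<cong> L\<rbrakk> \<Longrightarrow> amenability_closure B L"

definition elementary_amenable :: "'a monoid \<Rightarrow> bool" where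
  "elementary_amenable = amenability_closure (\<lambda>G. finite (carrier G) \<or> comm_group G)"

definition subexponentially_amenable :: "'a monoid \<Rightarrow> bool" where
  "subexponentially_amenable = amenability_closure fg_subexponential_growth"

subsection \<open>The properties and simplicity\<close>

datatype group_property =
    Torsion_Free
  | Locally_Indicable
  | Amenable
  | Elementary_Amenable
  | Subexponentially_Amenable
  | Right_Orderable
  | Orderable

fun has_property :: "'a monoid \<Rightarrow> group_property \<Rightarrow> bool" where
  "has_property G Torsion_Free = torsion_free G"
| "has_property G Locally_Indicable = locally_indicable G"
| "has_property G Amenable = amenable G"
| "has_property G Elementary_Amenable = elementary_amenable G"
| "has_property G Subexponentially_Amenable = subexponentially_amenable G"
| "has_property G Right_Orderable = right_orderable G"
| "has_property G Orderable = orderable G"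

text \<open>The locale \<^locale>\<open>simple_group\<close> requires \<open>order G > 1\<close> and hence, as infinite groups have
  order 0, covers finite groups only.\<close>

definition is_simple :: "'a monoid \<Rightarrow> bool" where
  "is_simple G \<longleftrightarrow> group G \<and> carrier G \<noteq> {\<one>\<^bsub>G\<^esub>} \<and>
     (\<forall>N. N \<lhd> G \<longrightarrow> N = {\<one>\<^bsub>G\<^esub>} \<or> N = carrier G)"

end

theory Submission
  imports Defs
begin

text \<open>
  A non-trivial group is simple if it is the union of a chain \<open>G\<^sub>0 \<subseteq> G\<^sub>1 \<subseteq> \<dots>\<close> in which every
  non-trivial element
  of \<open>G\<^sub>n\<close> has a normal closure in \<open>G\<^sub>n\<^sub>+\<^sub>1\<close> that contains \<open>G\<^sub>n\<close>. Such an extension of a group \<open>G\<close>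
  is built in two steps, following P. Hall's wreath powers.

  First, the functions from the integers to \<open>G\<close> that are trivial near \<open>-\<infinity>\<close> and constant near
  \<open>\<infinity>\<close> form a group on which the integers act by translation. In the semidirect product \<open>L\<close>, the
  function with value \<open>g\<close> at 0 and \<open>\<one>\<close> elsewhere is the commutator of the step function of
  height \<open>g\<close> with the translation. So \<open>G\<close> embeds in \<open>L\<close> with image in the set of commutators.

  Second, let \<open>W\<close> be the wreath product of copies \<open>L\<^sub>i\<close> of \<open>L\<close> indexed by the integers, where \<open>L\<^sub>i\<close>
  permutes the conjugates of \<open>L\<^sub>j\<close> for \<open>j > i\<close>; the integers act on \<open>W\<close> by shifting the index.
  A non-trivial \<open>g\<close> in \<open>L\<^sub>0\<close> moves \<open>L\<^sub>1\<close> to a commuting conjugate, so the normal closure of \<open>g\<close>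
  contains the commutators of \<open>L\<^sub>1\<close> and, after a shift, those of \<open>L\<^sub>0\<close>.

  All properties but orderability are inherited by subgroups, extensions and increasing unions,
  and both steps use only these operations. Bi-invariant orders are written down explicitly.
\<close>

text \<open>The wreath product catches only commutators of \<open>L\<close> in a normal closure, so
  the elements of \<open>G\<close> first have to become commutators. All integers occur as levels
  because the shift must be an automorphism that carries level 1 back to level 0.

  The obstacle is types. Every construction lives on a larger type than its input, while the
  inductive classes speak about groups on one type and the chain must be a family of groups on a
  fixed type. Therefore every stage is copied to \<open>nat\<close>, and within a step a property is
  tested on countable subgroups copied to \<open>nat\<close>. Moving an inductive class to another
  type takes more than closure under subgroups: a subgroup of a quotient is in general only a
  section, so that induction runs over all sections.

  Orders and invariant means chosen on the members of an increasing union need not fit together; a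
  cluster point in a compact cube replaces a compatible choice. For two-sided orders, cones are
  constructed that are invariant under conjugation and under the acting integers.\<close>

definition transport :: "('a \<Rightarrow> 'b) \<Rightarrow> 'a monoid \<Rightarrow> 'b monoid" where
  "transport f G = \<lparr>carrier = f ` carrier G,
     monoid.mult = (\<lambda>x y. f (inv_into (carrier G) f x \<otimes>\<^bsub>G\<^esub> inv_into (carrier G) f y)),
     one = f \<one>\<^bsub>G\<^esub>\<rparr>"

lemma transport_iso:
  fixes G (structure)
  assumes "group G" "inj_on f (carrier G)"
  shows "f \<in> iso G (transport f G)" "group (transport f G)"
proof -
  interpret group G by fact
  show i: "f \<in> iso G (transport f G)"
    using assms(2) by (auto simp: iso_def hom_def transport_def bij_betw_def)
  \<comment> \<open>\<open>iso_imp_img_group\<close> yields the target with its unit overwritten by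
    \<open>f \<one>\<close>, which here is the unit it already has.\<close>
  have "group (transport f G\<lparr>one := f \<one>\<rparr>)"
    by (rule iso_imp_img_group[OF i])
  then show "group (transport f G)"
    by (simp add: transport_def)
qed

text \<open>Images and quotients of groups on \<open>nat\<close> are countable but live on other
  types; a copy on \<open>nat\<close> brings them back into the range of the inductive classes at
  that type.\<close>

lemma nat_copy:
  assumes "group (C :: 'c monoid)" "countable (carrier C)"
  obtains C' :: "nat monoid" and h where "group C'" "h \<in> iso C C'"
  using transport_iso[OF assms(1) inj_on_to_nat_on[OF assms(2)]] by blast

lemma mon_one: "h \<in> mon G H \<Longrightarrow> group G \<Longrightarrow> group H \<Longrightarrow> h \<one>\<^bsub>G\<^esub> = \<one>\<^bsub>H\<^esub>"
  by (auto simp: mon_def hom_one)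

lemma mon_eq_one_iff:
  assumes "h \<in> mon G H" "group G" "group H" "x \<in> carrier G"
  shows "h x = \<one>\<^bsub>H\<^esub> \<longleftrightarrow> x = \<one>\<^bsub>G\<^esub>"
proof -
  interpret group G by fact
  have "inj_on h (carrier G)" using assms(1) by (simp add: mon_def)
  then show ?thesis using assms(4) mon_one[OF assms(1-3)] one_closed by (metis inj_onD)
qed

lemma group_homI: "group G \<Longrightarrow> group H \<Longrightarrow> h \<in> hom G H \<Longrightarrow> group_hom G H h"
  by (simp add: group_hom_def group_hom_axioms_def)

lemma incl_mon: "H \<subseteq> carrier G \<Longrightarrow> (\<lambda>x. x) \<in> mon (G\<lparr>carrier := H\<rparr>) G"
  by (auto simp: mon_def hom_def)

subsection \<open>Torsion-free groups\<close>

lemma torsion_free_mon: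
  assumes "group C" "group G" "h \<in> mon C G" "torsion_free G"
  shows "torsion_free C"
  unfolding torsion_free_def
proof (intro ballI allI impI)
  fix x and n :: nat assume x: "x \<in> carrier C" and n: "n > 0" "x [^]\<^bsub>C\<^esub> n = \<one>\<^bsub>C\<^esub>"
  have h: "h \<in> hom C G" using assms(3) by (simp add: mon_def)
  have "h x [^]\<^bsub>G\<^esub> n = \<one>\<^bsub>G\<^esub>"
    using n(2) group_hom.hom_nat_pow[of C G h x n] mon_one[OF assms(3)] h x assms(1,2)
    by (simp add: group_hom_def group_hom_axioms_def)
  then have "h x = \<one>\<^bsub>G\<^esub>"
    using assms(4) h x n(1) by (auto simp: torsion_free_def hom_def Pi_def)
  then show "x = \<one>\<^bsub>C\<^esub>"
    using mon_eq_one_iff[OF assms(3,1,2) x] by simp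
qed

lemma torsion_free_ext:
  assumes "group C" "group Q" "\<phi> \<in> hom C Q" "torsion_free Q"
    and "torsion_free (C\<lparr>carrier := kernel C Q \<phi>\<rparr>)"
  shows "torsion_free C"
  unfolding torsion_free_def
proof (intro ballI allI impI)
  fix x and n :: nat assume x: "x \<in> carrier C" and n: "n > 0" "x [^]\<^bsub>C\<^esub> n = \<one>\<^bsub>C\<^esub>"
  interpret group_hom C Q \<phi> using assms by (simp add: group_hom_def group_hom_axioms_def)
  have "\<phi> x [^]\<^bsub>Q\<^esub> n = \<one>\<^bsub>Q\<^esub>"
    using n(2) hom_nat_pow[OF x, of n] by simp
  then have "\<phi> x = \<one>\<^bsub>Q\<^esub>"
    using assms(4) x n(1) by (auto simp: torsion_free_def)
  then have "x \<in> kernel C Q \<phi>" using x by (simp add: kernel_def)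
  moreover have "x [^]\<^bsub>C\<lparr>carrier := kernel C Q \<phi>\<rparr>\<^esub> n = \<one>\<^bsub>C\<^esub>"
    using n(2) by (simp add: nat_pow_def)
  ultimately show "x = \<one>\<^bsub>C\<^esub>"
    using assms(5) n(1) by (auto simp: torsion_free_def)
qed

lemma torsion_free_Un:
  assumes "(\<Union>n::nat. K n) = carrier C" "\<And>n. torsion_free (C\<lparr>carrier := K n\<rparr>)"
  shows "torsion_free C"
  unfolding torsion_free_def
proof (intro ballI allI impI)
  fix x and n :: nat assume x: "x \<in> carrier C" and n: "n > 0" "x [^]\<^bsub>C\<^esub> n = \<one>\<^bsub>C\<^esub>"
  obtain m where "x \<in> K m" using assms(1) x by auto
  then show "x = \<one>\<^bsub>C\<^esub>" using assms(2)[of m] n by (auto simp: torsion_free_def nat_pow_def)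
qed

lemma torsion_free_integer: "torsion_free integer_group"
  by (auto simp: torsion_free_def)

subsection \<open>Positive cones\<close>

text \<open>\<open>P\<close> stands for the elements above or equal to \<one>; totality at \<one>
  puts \<one> into it. The associated order has \<open>x\<close> below \<open>y\<close> iff
  \<open>y \<otimes> inv x\<close> is in \<open>P\<close>; it is right invariant by itself, and left
  invariance amounts to \<open>conj_invariant\<close>. Being a single subset, a cone is a point of a
  compact space.\<close>

definition cone :: "('a, 'b) monoid_scheme \<Rightarrow> 'a set \<Rightarrow> bool" where
  "cone G P \<longleftrightarrow> P \<subseteq> carrier G \<and> (\<forall>x\<in>P. \<forall>y\<in>P. x \<otimes>\<^bsub>G\<^esub> y \<in> P) \<and>
     (\<forall>x\<in>carrier G. x \<in> P \<or> inv\<^bsub>G\<^esub> x \<in> P) \<and> (\<forall>x\<in>P. inv\<^bsub>G\<^esub> x \<in> P \<longrightarrow> x = \<one>\<^bsub>G\<^esub>)"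

definition conj_invariant :: "('a, 'b) monoid_scheme \<Rightarrow> 'a set \<Rightarrow> bool" where
  "conj_invariant G P \<longleftrightarrow> (\<forall>g\<in>carrier G. \<forall>x\<in>P. g \<otimes>\<^bsub>G\<^esub> x \<otimes>\<^bsub>G\<^esub> inv\<^bsub>G\<^esub> g \<in> P)"

lemma (in group) linear_order_cone:
  assumes lin: "linear_order_on (carrier G) r"
    and inv: "\<forall>x\<in>carrier G. \<forall>y\<in>carrier G. \<forall>z\<in>carrier G. (x, y) \<in> r \<longrightarrow> (x \<otimes> z, y \<otimes> z) \<in> r"
  shows "cone G {x\<in>carrier G. (\<one>, x) \<in> r}"
proof -
  have tr: "trans r" and as: "antisym r" and re: "refl_on (carrier G) r" and to: "total_on (carrier G) r"
    using lin by (auto simp: linear_order_on_def partial_order_on_def preorder_on_def)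
  show ?thesis unfolding cone_def
  proof (intro conjI ballI impI)
    fix x y assume "x \<in> {x\<in>carrier G. (\<one>, x) \<in> r}" "y \<in> {x\<in>carrier G. (\<one>, x) \<in> r}"
    moreover then have "(\<one> \<otimes> y, x \<otimes> y) \<in> r" using inv by blast
    ultimately show "x \<otimes> y \<in> {x\<in>carrier G. (\<one>, x) \<in> r}"
      using tr by (auto dest: transD)
  next
    fix x assume x: "x \<in> carrier G"
    have "(\<one>, x) \<in> r \<or> (x, \<one>) \<in> r"
      using to re x by (metis one_closed refl_onD total_on_def)
    moreover have "(x \<otimes> inv x, \<one> \<otimes> inv x) \<in> r" if "(x, \<one>) \<in> r" using inv x that by blast
    ultimately show "x \<in> {x\<in>carrier G. (\<one>, x) \<in> r} \<or> inv x \<in> {x\<in>carrier G. (\<one>, x) \<in> r}"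
      using x by auto
  next
    fix x assume x: "x \<in> {x\<in>carrier G. (\<one>, x) \<in> r}" "inv x \<in> {x\<in>carrier G. (\<one>, x) \<in> r}"
    then have "(\<one> \<otimes> x, inv x \<otimes> x) \<in> r" using inv by blast
    then show "x = \<one>" using x as by (auto dest: antisymD)
  qed auto
qed

lemma (in group) cone_linear_order:
  assumes P: "cone G P"
  defines "r \<equiv> {(x, y). x \<in> carrier G \<and> y \<in> carrier G \<and> y \<otimes> inv x \<in> P}"
  shows "linear_order_on (carrier G) r"
    and "\<forall>x\<in>carrier G. \<forall>y\<in>carrier G. \<forall>z\<in>carrier G. (x, y) \<in> r \<longrightarrow> (x \<otimes> z, y \<otimes> z) \<in> r"
    and "conj_invariant G P \<Longrightarrow>
      \<forall>x\<in>carrier G. \<forall>y\<in>carrier G. \<forall>z\<in>carrier G. (x, y) \<in> r \<longrightarrow> (z \<otimes> x, z \<otimes> y) \<in> r"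
proof -
  have one: "\<one> \<in> P" using P inv_one one_closed unfolding cone_def by metis
  have refl: "refl_on (carrier G) r" unfolding refl_on_def r_def using one by auto
  have "antisym r"
  proof (rule antisymI)
    fix x y assume a: "(x, y) \<in> r" "(y, x) \<in> r"
    then have "inv (y \<otimes> inv x) \<in> P" by (auto simp: r_def inv_mult_group)
    then have "y \<otimes> inv x = \<one>" using P a unfolding cone_def r_def by blast
    then show "x = y" using a
      by (metis (mono_tags, lifting) case_prodD inv_equality inv_inv inv_closed mem_Collect_eq r_def)
  qed
  moreover have "trans r"
  proof (rule transI)
    fix x y z assume a: "(x, y) \<in> r" "(y, z) \<in> r"
    then have "(z \<otimes> inv y) \<otimes> (y \<otimes> inv x) \<in> P" using P unfolding cone_def r_def by blast
    moreover have "(z \<otimes> inv y) \<otimes> (y \<otimes> inv x) = z \<otimes> inv x"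
      using a by (simp add: r_def m_assoc) (simp flip: m_assoc)
    ultimately show "(x, z) \<in> r" using a by (simp add: r_def)
  qed
  moreover have "total_on (carrier G) r"
  proof (rule total_onI)
    fix x y assume a: "x \<in> carrier G" "y \<in> carrier G"
    then have "y \<otimes> inv x \<in> P \<or> inv (y \<otimes> inv x) \<in> P" using P unfolding cone_def by blast
    then show "(x, y) \<in> r \<or> (y, x) \<in> r" using a by (auto simp: r_def inv_mult_group)
  qed
  ultimately show "linear_order_on (carrier G) r"
    using refl by (auto simp: linear_order_on_def partial_order_on_def preorder_on_def r_def)
  show "\<forall>x\<in>carrier G. \<forall>y\<in>carrier G. \<forall>z\<in>carrier G. (x, y) \<in> r \<longrightarrow> (x \<otimes> z, y \<otimes> z) \<in> r"
  proof (intro ballI impI)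
    fix x y z assume a: "x \<in> carrier G" "y \<in> carrier G" "z \<in> carrier G" "(x, y) \<in> r"
    have "y \<otimes> z \<otimes> inv (x \<otimes> z) = y \<otimes> inv x"
      using a by (simp add: inv_mult_group m_assoc) (simp flip: m_assoc)
    then show "(x \<otimes> z, y \<otimes> z) \<in> r" using a by (simp add: r_def)
  qed
  assume ci: "conj_invariant G P"
  show "\<forall>x\<in>carrier G. \<forall>y\<in>carrier G. \<forall>z\<in>carrier G. (x, y) \<in> r \<longrightarrow> (z \<otimes> x, z \<otimes> y) \<in> r"
  proof (intro ballI impI)
    fix x y z assume a: "x \<in> carrier G" "y \<in> carrier G" "z \<in> carrier G" "(x, y) \<in> r"
    have "z \<otimes> y \<otimes> inv (z \<otimes> x) = z \<otimes> (y \<otimes> inv x) \<otimes> inv z"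
      using a by (simp add: inv_mult_group m_assoc)
    then show "(z \<otimes> x, z \<otimes> y) \<in> r" using a ci unfolding conj_invariant_def r_def by auto
  qed
qed

lemma right_orderable_iff:
  assumes "group G"
  shows "right_orderable G \<longleftrightarrow> (\<exists>P. cone G P)"
proof
  assume "right_orderable G"
  then show "\<exists>P. cone G P"
    unfolding right_orderable_def using group.linear_order_cone[OF assms] by blast
next
  assume "\<exists>P. cone G P"
  then obtain P where P: "cone G P" ..
  show "right_orderable G"
    unfolding right_orderable_def using group.cone_linear_order(1,2)[OF assms P] by blast
qed

lemma orderable_iff:
  fixes G (structure)
  assumes "group G"
  shows "orderable G \<longleftrightarrow> (\<exists>P. cone G P \<and> conj_invariant G P)"
proof
  interpret group G by fact
  assume "orderable G"
  then obtain r where lin: "linear_order_on (carrier G) r"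
    and i: "\<forall>x\<in>carrier G. \<forall>y\<in>carrier G. \<forall>z\<in>carrier G. (x, y) \<in> r \<longrightarrow> (x \<otimes> z, y \<otimes> z) \<in> r"
    and i2: "\<forall>x\<in>carrier G. \<forall>y\<in>carrier G. \<forall>z\<in>carrier G. (x, y) \<in> r \<longrightarrow> (z \<otimes> x, z \<otimes> y) \<in> r"
    unfolding orderable_def by blast
  have "conj_invariant G {x\<in>carrier G. (\<one>, x) \<in> r}"
    unfolding conj_invariant_def
  proof (intro ballI)
    fix g x assume a: "g \<in> carrier G" "x \<in> {x\<in>carrier G. (\<one>, x) \<in> r}"
    then have "(g \<otimes> \<one> \<otimes> inv g, g \<otimes> x \<otimes> inv g) \<in> r"
      using i i2 by blast
    then show "g \<otimes> x \<otimes> inv g \<in> {x\<in>carrier G. (\<one>, x) \<in> r}" using a by simp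
  qed
  then show "\<exists>P. cone G P \<and> conj_invariant G P" using linear_order_cone[OF lin i] by blast
next
  assume "\<exists>P. cone G P \<and> conj_invariant G P"
  then obtain P where P: "cone G P" "conj_invariant G P" by blast
  show "orderable G" unfolding orderable_def
    using group.cone_linear_order(1,2)[OF assms P(1)] group.cone_linear_order(3)[OF assms P]
    by blast
qed

lemma cone_mon:
  assumes "group C" "group G" "h \<in> mon C G" "cone G P"
  shows "cone C {x\<in>carrier C. h x \<in> P}" 
    and "conj_invariant G P \<Longrightarrow> conj_invariant C {x\<in>carrier C. h x \<in> P}"
proof -
  interpret C: group C by fact
  interpret G: group G by fact
  interpret group_hom C G h using assms by (auto simp: group_hom_def group_hom_axioms_def mon_def)
  show "cone C {x\<in>carrier C. h x \<in> P}"
    using assms(4) mon_eq_one_iff[OF assms(3,1,2)] unfolding cone_def by auto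
  show "conj_invariant C {x\<in>carrier C. h x \<in> P}" if "conj_invariant G P"
    using that unfolding conj_invariant_def by auto
qed

lemma right_orderable_mon:
  assumes "group C" "group G" "h \<in> mon C G" "right_orderable G"
  shows "right_orderable C"
  using cone_mon(1)[OF assms(1-3)] assms(4)
  unfolding right_orderable_iff[OF assms(1)] right_orderable_iff[OF assms(2)] by blast

lemma orderable_mon:
  assumes "group C" "group G" "h \<in> mon C G" "orderable G"
  shows "orderable C"
  using cone_mon[OF assms(1-3)] assms(4)
  unfolding orderable_iff[OF assms(1)] orderable_iff[OF assms(2)] by blast

text \<open>The lexicographic order: the sign is read off in \<open>Q\<close>, and from
  \<open>N\<close> only on the kernel. For two-sided invariance \<open>N\<close> has to be invariant
  under conjugation by all of \<open>C\<close>, not just by the kernel; this is what fails for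
  general extensions of orderable groups.\<close>

lemma cone_ext:
  assumes "group C" "group Q" "\<phi> \<in> hom C Q" "cone Q P"
    and N: "cone (C\<lparr>carrier := kernel C Q \<phi>\<rparr>) N"
  defines "P' \<equiv> {x\<in>carrier C. \<phi> x \<in> P \<and> \<phi> x \<noteq> \<one>\<^bsub>Q\<^esub>} \<union> N"
  shows "cone C P'"
    and "conj_invariant Q P \<Longrightarrow> (\<And>g x. g \<in> carrier C \<Longrightarrow> x \<in> N \<Longrightarrow> g \<otimes>\<^bsub>C\<^esub> x \<otimes>\<^bsub>C\<^esub> inv\<^bsub>C\<^esub> g \<in> N)
           \<Longrightarrow> conj_invariant C P'"
proof -
  interpret C: group C by fact
  interpret Q: group Q by fact
  interpret group_hom C Q \<phi> using assms by (auto simp: group_hom_def group_hom_axioms_def mon_def)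
  have Nk: "\<And>x. x \<in> N \<Longrightarrow> x \<in> carrier C \<and> \<phi> x = \<one>\<^bsub>Q\<^esub>"
    using N unfolding cone_def by (auto simp: kernel_def)
  have Nm: "\<And>x y. x \<in> N \<Longrightarrow> y \<in> N \<Longrightarrow> x \<otimes>\<^bsub>C\<^esub> y \<in> N" using N unfolding cone_def by auto
  have Ni: "inv\<^bsub>C\<lparr>carrier := kernel C Q \<phi>\<rparr>\<^esub> x = inv\<^bsub>C\<^esub> x" if "x \<in> kernel C Q \<phi>" for x
    using C.m_inv_consistent[OF subgroup_kernel that] .
  have Nt: "x \<in> N \<or> inv\<^bsub>C\<^esub> x \<in> N" if "x \<in> carrier C" "\<phi> x = \<one>\<^bsub>Q\<^esub>" for x
    using N that Ni[of x] unfolding cone_def by (auto simp: kernel_def)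
  have Na: "x = \<one>\<^bsub>C\<^esub>" if "x \<in> N" "inv\<^bsub>C\<^esub> x \<in> N" for x
    using N that Ni[of x] Nk[of x] unfolding cone_def by (auto simp: kernel_def)
  have Pm: "\<And>x y. x \<in> P \<Longrightarrow> y \<in> P \<Longrightarrow> x \<otimes>\<^bsub>Q\<^esub> y \<in> P" and Pc: "\<And>x. x \<in> P \<Longrightarrow> x \<in> carrier Q"
    and Pt: "\<And>x. x \<in> carrier Q \<Longrightarrow> x \<in> P \<or> inv\<^bsub>Q\<^esub> x \<in> P" and Pa: "\<And>x. x \<in> P \<Longrightarrow> inv\<^bsub>Q\<^esub> x \<in> P \<Longrightarrow> x = \<one>\<^bsub>Q\<^esub>"
    using assms(4) unfolding cone_def by auto
  \<comment> \<open>A product of two elements with strictly positive image must have non-trivial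
    image; otherwise it would fall into the kernel, where nothing puts it into
    \<open>N\<close>.\<close>
  have Pnt: "x \<otimes>\<^bsub>Q\<^esub> y \<noteq> \<one>\<^bsub>Q\<^esub>" if "x \<in> P" "y \<in> P" "x \<noteq> \<one>\<^bsub>Q\<^esub>" for x y
  proof
    assume "x \<otimes>\<^bsub>Q\<^esub> y = \<one>\<^bsub>Q\<^esub>"
    then have "inv\<^bsub>Q\<^esub> x = y" using Pc that by (metis Q.inv_equality Q.inv_inv Q.inv_closed)
    then show False using that Pa by blast
  qed
  show "cone C P'" unfolding cone_def
  proof (intro conjI ballI impI)
    show "P' \<subseteq> carrier C" unfolding P'_def using Nk by auto
    fix x assume x: "x \<in> carrier C"
    show "x \<in> P' \<or> inv\<^bsub>C\<^esub> x \<in> P'"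
      using x Nt[OF x] Pt[of "\<phi> x"] unfolding P'_def by auto
  next
    fix x assume "x \<in> P'" "inv\<^bsub>C\<^esub> x \<in> P'"
    then show "x = \<one>\<^bsub>C\<^esub>"
      using Na[of x] Pa[of "\<phi> x"] Nk[of x] Nk[of "inv\<^bsub>C\<^esub> x"] unfolding P'_def by auto
  next
    fix x y assume "x \<in> P'" "y \<in> P'"
    then show "x \<otimes>\<^bsub>C\<^esub> y \<in> P'"
      using Nk[of x] Nk[of y] Nm[of x y] Pm[of "\<phi> x" "\<phi> y"] Pnt[of "\<phi> x" "\<phi> y"] unfolding P'_def by auto
  qed
  assume ci: "conj_invariant Q P" and cn: "\<And>g x. g \<in> carrier C \<Longrightarrow> x \<in> N \<Longrightarrow> g \<otimes>\<^bsub>C\<^esub> x \<otimes>\<^bsub>C\<^esub> inv\<^bsub>C\<^esub> g \<in> N"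
  show "conj_invariant C P'"
    unfolding conj_invariant_def
  proof (intro ballI)
    fix g x assume g: "g \<in> carrier C" "x \<in> P'"
    have "\<phi> x = \<one>\<^bsub>Q\<^esub>" if "x \<in> carrier C" "\<phi> g \<otimes>\<^bsub>Q\<^esub> \<phi> x \<otimes>\<^bsub>Q\<^esub> inv\<^bsub>Q\<^esub> \<phi> g = \<one>\<^bsub>Q\<^esub>"
    proof -
      have "\<phi> g \<otimes>\<^bsub>Q\<^esub> \<phi> x = \<phi> g" using that g Q.inv_solve_right'[of "\<one>\<^bsub>Q\<^esub>" "\<phi> g \<otimes>\<^bsub>Q\<^esub> \<phi> x" "\<phi> g"] by simp
      then show ?thesis using that(1) g by simp
    qed
    then show "g \<otimes>\<^bsub>C\<^esub> x \<otimes>\<^bsub>C\<^esub> inv\<^bsub>C\<^esub> g \<in> P'"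
      using g cn[of g x] ci unfolding P'_def conj_invariant_def by auto
  qed
qed

lemma right_orderable_ext:
  assumes "group C" "group Q" "\<phi> \<in> hom C Q" "right_orderable Q"
    and "right_orderable (C\<lparr>carrier := kernel C Q \<phi>\<rparr>)"
  shows "right_orderable C"
proof -
  have "subgroup (kernel C Q \<phi>) C"
    using assms by (intro group_hom.subgroup_kernel) (simp add: group_hom_def group_hom_axioms_def)
  then have k: "group (C\<lparr>carrier := kernel C Q \<phi>\<rparr>)" using group.subgroup_imp_group[OF assms(1)] by simp
  show ?thesis using cone_ext(1)[OF assms(1-3)] assms(4,5)
    unfolding right_orderable_iff[OF assms(1)] right_orderable_iff[OF assms(2)] right_orderable_iff[OF k]
    by blast
qed

lemma cone_integer: "cone integer_group {0..}" "conj_invariant integer_group {0..}"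
proof -
  show "cone integer_group {0..}"
    unfolding cone_def inv_integer_group mult_integer_group one_integer_group carrier_integer_group
    by (intro conjI ballI impI) (simp_all only: atLeast_iff UNIV_I subset_UNIV, linarith+)
  show "conj_invariant integer_group {0..}"
    unfolding conj_invariant_def inv_integer_group mult_integer_group carrier_integer_group
    by (intro ballI) simp
qed

subsection \<open>Compactness\<close>

text \<open>By Tychonoff the cube of functions into \<open>{0..1}\<close> is compact, so the
  sequence has a cluster point, and a closed set that eventually contains the sequence contains its
  cluster points. This takes the place of a limit along an ultrafilter: every closed condition that
  holds for all large \<open>n\<close> passes to \<open>x\<close>.\<close>

lemma cluster_function:
  fixes u :: "nat \<Rightarrow> 'i \<Rightarrow> real"
  assumes "\<And>n i. 0 \<le> u n i \<and> u n i \<le> 1"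
  obtains x where "\<And>S. closed S \<Longrightarrow> eventually (\<lambda>n. u n \<in> S) sequentially \<Longrightarrow> x \<in> S"
proof -
  let ?K = "PiE UNIV (\<lambda>i::'i. {0..1::real})"
  have "compactin (product_topology (\<lambda>i. euclidean) UNIV) ?K"
    unfolding compactin_PiE by (simp only: compactin_euclidean_iff compact_Icc simp_thms ball_simps)
  then have K: "compact ?K"
    by (simp add: euclidean_product_topology)
  let ?F = "filtermap u sequentially"
  have "\<forall>F. F \<noteq> bot \<longrightarrow> eventually (\<lambda>x. x \<in> ?K) F \<longrightarrow> (\<exists>x\<in>?K. inf (nhds x) F \<noteq> bot)"
    using compact_filter[THEN iffD1, OF K] .
  moreover have "?F \<noteq> bot" by (simp add: filtermap_bot_iff)
  moreover have "eventually (\<lambda>x. x \<in> ?K) ?F" using assms by (simp add: eventually_filtermap PiE_UNIV_domain)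
  ultimately obtain x where x: "inf (nhds x) ?F \<noteq> bot" by blast
  show ?thesis
  proof (rule that[of x], rule ccontr)
    fix S assume S: "closed S" "eventually (\<lambda>n. u n \<in> S) sequentially" "x \<notin> S"
    have "eventually (\<lambda>y. y \<in> - S) (nhds x)" using S by (intro eventually_nhds_in_open) auto
    moreover have "eventually (\<lambda>y. y \<in> S) ?F" using S by (simp add: eventually_filtermap)
    ultimately have "eventually (\<lambda>_. False) (inf (nhds x) ?F)"
      unfolding eventually_inf by blast
    then show False using x by (simp add: trivial_limit_def)
  qed
qed

text \<open>The indicator functions of the cones \<open>P n\<close>, which may be unrelated to one
  another, have a cluster point. For fixed elements each axiom of a cone restricts finitely many
  coordinates by a closed condition, valid as soon as the elements lie in
  \<open>K n\<close>.\<close>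

lemma cone_Un:
  assumes "group C" "\<And>n::nat. subgroup (K n) C" "\<And>n. K n \<subseteq> K (Suc n)" "(\<Union>n. K n) = carrier C"
    and P: "\<And>n. cone (C\<lparr>carrier := K n\<rparr>) (P n)"
  obtains P' where "cone C P'" "(\<And>n. conj_invariant (C\<lparr>carrier := K n\<rparr>) (P n)) \<Longrightarrow> conj_invariant C P'"
proof -
  interpret C: group C by fact
  have inv: "inv\<^bsub>C\<lparr>carrier := K n\<rparr>\<^esub> x = inv\<^bsub>C\<^esub> x" if "x \<in> K n" for n x
    using C.m_inv_consistent[OF assms(2) that] .
  have mono: "K n \<subseteq> K m" if "n \<le> m" for n m using lift_Suc_mono_le[of K] assms(3) that by blast
  have ev: "eventually (\<lambda>n. x \<in> K n) sequentially" if x: "x \<in> carrier C" for x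
  proof -
    obtain n where "x \<in> K n" using assms(4) x by blast
    then show ?thesis using mono by (auto simp: eventually_sequentially)
  qed
  define u where "u n x = (if x \<in> P n then 1 else 0::real)" for n x
  obtain l where l: "\<And>S. closed S \<Longrightarrow> eventually (\<lambda>n. u n \<in> S) sequentially \<Longrightarrow> l \<in> S"
    by (rule cluster_function[of u]) (auto simp: u_def)
  have cl: "closed {y. y (x::'a) \<in> S}" if "closed S" for x and S :: "real set"
    using closed_vimage[OF that, of "\<lambda>y. y x"] by (simp add: vimage_def)
  have cl1: "closed {y. y (x::'a) = (c::real)}" for x c using cl[of "{c}"] by simp
  have fin: "l x = 0 \<or> l x = 1" for x
  proof -
    have "closed {y::'a\<Rightarrow>real. y x = 0 \<or> y x = 1}"
      using cl[of "{0,1}" x] by simp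
    then have "l \<in> {y. y x = 0 \<or> y x = 1}" by (rule l) (auto simp: u_def)
    then show ?thesis by simp
  qed
  define P' where "P' = {x\<in>carrier C. l x = 1}"
  have "cone C P'" unfolding cone_def
  proof (intro conjI ballI impI)
    show "P' \<subseteq> carrier C" by (auto simp: P'_def)
  next
    fix x y assume x: "x \<in> P'" "y \<in> P'"
    \<comment> \<open>The implication is written as a disjunction of conditions on single
      coordinates; its negated premises read \<open>z x = 0\<close> because this, unlike
      \<open>z x \<noteq> 1\<close>, is closed.\<close>
    have "closed {z. z x = (0::real) \<or> z y = 0 \<or> z (x \<otimes>\<^bsub>C\<^esub> y) = 1}"
      using cl1 by (intro closed_Collect_disj)
    then have "l \<in> {z. z x = (0::real) \<or> z y = 0 \<or> z (x \<otimes>\<^bsub>C\<^esub> y) = 1}"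
      by (rule l, intro always_eventually) (use P in \<open>auto simp: u_def cone_def\<close>)
    then show "x \<otimes>\<^bsub>C\<^esub> y \<in> P'" using x by (auto simp: P'_def)
  next
    fix x assume x: "x \<in> carrier C"
    have "closed {z. z x = (1::real) \<or> z (inv\<^bsub>C\<^esub> x) = 1}"
      using cl1 by (intro closed_Collect_disj)
    then have "l \<in> {z. z x = (1::real) \<or> z (inv\<^bsub>C\<^esub> x) = 1}"
      by (rule l, use ev[OF x] in eventually_elim) (use P inv in \<open>auto simp: u_def cone_def\<close>)
    then show "x \<in> P' \<or> inv\<^bsub>C\<^esub> x \<in> P'" using x by (auto simp: P'_def)
  next
    fix x assume x: "x \<in> P'" "inv\<^bsub>C\<^esub> x \<in> P'"
    show "x = \<one>\<^bsub>C\<^esub>"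
    proof (rule ccontr)
      assume n1: "x \<noteq> \<one>\<^bsub>C\<^esub>"
      have xc: "x \<in> carrier C" using x by (simp add: P'_def)
      have "closed {z. z x = (0::real) \<or> z (inv\<^bsub>C\<^esub> x) = 0}"
        using cl1 by (intro closed_Collect_disj)
      then have "l \<in> {z. z x = (0::real) \<or> z (inv\<^bsub>C\<^esub> x) = 0}"
        by (rule l, use ev[OF xc] in eventually_elim) (use P inv n1 in \<open>auto simp: u_def cone_def\<close>)
      then show False using x by (auto simp: P'_def)
    qed
  qed
  moreover have "conj_invariant C P'" if ci: "\<And>n. conj_invariant (C\<lparr>carrier := K n\<rparr>) (P n)"
    unfolding conj_invariant_def
  proof (intro ballI)
    fix g x assume x: "g \<in> carrier C" "x \<in> P'"
    have "closed {z. z x = (0::real) \<or> z (g \<otimes>\<^bsub>C\<^esub> x \<otimes>\<^bsub>C\<^esub> inv\<^bsub>C\<^esub> g) = 1}"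
      using cl1 by (intro closed_Collect_disj)
    then have "l \<in> {z. z x = (0::real) \<or> z (g \<otimes>\<^bsub>C\<^esub> x \<otimes>\<^bsub>C\<^esub> inv\<^bsub>C\<^esub> g) = 1}"
      by (rule l, use ev[OF x(1)] in eventually_elim) (use ci inv in \<open>auto simp: u_def conj_invariant_def\<close>)
    then show "g \<otimes>\<^bsub>C\<^esub> x \<otimes>\<^bsub>C\<^esub> inv\<^bsub>C\<^esub> g \<in> P'" using x by (auto simp: P'_def)
  qed
  ultimately show ?thesis using that by blast
qed

lemma right_orderable_Un:
  assumes "group C" "\<And>n::nat. subgroup (K n) C" "\<And>n. K n \<subseteq> K (Suc n)" "(\<Union>n. K n) = carrier C"
    and "\<And>n. right_orderable (C\<lparr>carrier := K n\<rparr>)"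
  shows "right_orderable C"
proof -
  have "\<forall>n. \<exists>P. cone (C\<lparr>carrier := K n\<rparr>) P"
    using assms(1,2,5) right_orderable_iff group.subgroup_imp_group by blast
  then obtain P where "\<And>n. cone (C\<lparr>carrier := K n\<rparr>) (P n)" by metis
  then show ?thesis using cone_Un[OF assms(1-4)] right_orderable_iff[OF assms(1)] by metis
qed

lemma orderable_Un:
  assumes "group C" "\<And>n::nat. subgroup (K n) C" "\<And>n. K n \<subseteq> K (Suc n)" "(\<Union>n. K n) = carrier C"
    and "\<And>n. orderable (C\<lparr>carrier := K n\<rparr>)"
  shows "orderable C"
proof -
  have "\<forall>n. \<exists>P. cone (C\<lparr>carrier := K n\<rparr>) P \<and> conj_invariant (C\<lparr>carrier := K n\<rparr>) P"
    using assms(1,2,5) orderable_iff group.subgroup_imp_group by blast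
  then obtain P where "\<And>n. cone (C\<lparr>carrier := K n\<rparr>) (P n)"
    "\<And>n. conj_invariant (C\<lparr>carrier := K n\<rparr>) (P n)" by metis
  then show ?thesis using cone_Un[OF assms(1-4)] orderable_iff[OF assms(1)] by metis
qed

subsection \<open>Locally indicable groups\<close>

lemma indicable_iff:
  assumes "group G"
  shows "indicable G \<longleftrightarrow> (\<exists>\<phi>\<in>hom G integer_group. \<phi> ` carrier G = UNIV)"
proof
  assume "indicable G"
  then obtain N f where N: "N \<lhd> G" and f: "f \<in> iso (G Mod N) integer_group"
    by (auto simp: indicable_def is_iso_def)
  have q: "(\<lambda>a. N #>\<^bsub>G\<^esub> a) \<in> hom G (G Mod N)" using normal.r_coset_hom_Mod[OF N] .
  have "f \<circ> (\<lambda>a. N #>\<^bsub>G\<^esub> a) \<in> hom G integer_group"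
    using q f by (intro hom_compose) (auto simp: iso_def)
  moreover have "(f \<circ> (\<lambda>a. N #>\<^bsub>G\<^esub> a)) ` carrier G = UNIV"
    using f by (auto simp: iso_def bij_betw_def carrier_FactGroup image_image)
  ultimately show "\<exists>\<phi>\<in>hom G integer_group. \<phi> ` carrier G = UNIV" by blast
next
  assume "\<exists>\<phi>\<in>hom G integer_group. \<phi> ` carrier G = UNIV"
  then obtain \<phi> where p: "\<phi> \<in> hom G integer_group" "\<phi> ` carrier G = UNIV" by blast
  interpret group_hom G integer_group \<phi> using assms p by (intro group_homI) auto
  show "indicable G" unfolding indicable_def
    using FactGroup_iso[unfolded carrier_integer_group, OF p(2)] normal_kernel by blast
qed

lemma indicable_pullback:
  assumes "group H" "group K" "f \<in> hom H K" "f ` carrier H = carrier K" "indicable K"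
  shows "indicable H"
proof -
  obtain \<phi> where p: "\<phi> \<in> hom K integer_group" "\<phi> ` carrier K = UNIV"
    using assms(5) indicable_iff[OF assms(2)] by blast
  have "\<phi> \<circ> f \<in> hom H integer_group" using hom_compose[OF assms(3) p(1)] .
  moreover have "(\<phi> \<circ> f) ` carrier H = UNIV" using assms(4) p(2) by (metis image_comp)
  ultimately show ?thesis unfolding indicable_iff[OF assms(1)] by blast
qed

text \<open>Finite generating sets can be pushed along homomorphisms and captured in one member of a
  chain; the three closure properties below rely on this form.\<close>

lemma locally_indicable_iff:
  assumes "group G"
  shows "locally_indicable G \<longleftrightarrow>
    (\<forall>S. finite S \<longrightarrow> S \<subseteq> carrier G \<longrightarrow> generate G S \<noteq> {\<one>\<^bsub>G\<^esub>} \<longrightarrow>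
       indicable (G\<lparr>carrier := generate G S\<rparr>))"
proof -
  interpret group G by fact
  have gs: "generate (G\<lparr>carrier := generate G S\<rparr>) S = generate G S" if "S \<subseteq> carrier G" for S
    using generate_consistent[OF _ generate_is_subgroup[OF that], of S] generate.incl[of _ S G] by blast
  show ?thesis
  proof (intro iffI allI impI)
    fix S assume L: "locally_indicable G" and S: "finite S" "S \<subseteq> carrier G" "generate G S \<noteq> {\<one>\<^bsub>G\<^esub>}"
    have "finitely_generated_group (G\<lparr>carrier := generate G S\<rparr>)"
      unfolding finitely_generated_group_def
      by (intro exI[of _ S]) (use S gs[OF S(2)] in \<open>auto intro: generate.incl\<close>)
    then show "indicable (G\<lparr>carrier := generate G S\<rparr>)"
      using L S generate_is_subgroup[OF S(2)] unfolding locally_indicable_def by blast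
  next
    assume r: "\<forall>S. finite S \<longrightarrow> S \<subseteq> carrier G \<longrightarrow> generate G S \<noteq> {\<one>\<^bsub>G\<^esub>} \<longrightarrow>
       indicable (G\<lparr>carrier := generate G S\<rparr>)"
    show "locally_indicable G" unfolding locally_indicable_def
    proof (intro allI impI, elim conjE)
      fix H assume H: "subgroup H G" "H \<noteq> {\<one>\<^bsub>G\<^esub>}" "finitely_generated_group (G\<lparr>carrier := H\<rparr>)"
      then obtain S where S: "finite S" "S \<subseteq> H" "generate (G\<lparr>carrier := H\<rparr>) S = H"
        by (auto simp: finitely_generated_group_def)
      then have g: "generate G S = H" using generate_consistent[OF S(2) H(1)] by simp
      have "S \<subseteq> carrier G" using S(2) subgroup.subset[OF H(1)] by blast
      then show "indicable (G\<lparr>carrier := H\<rparr>)" using r S(1) H(2) g by blast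
    qed
  qed
qed

lemma generate_hom_restrict:
  assumes "group G" "group H" "h \<in> hom G H" "S \<subseteq> carrier G"
  shows "h \<in> hom (G\<lparr>carrier := generate G S\<rparr>) (H\<lparr>carrier := generate H (h ` S)\<rparr>)"
    and "h ` carrier (G\<lparr>carrier := generate G S\<rparr>) = carrier (H\<lparr>carrier := generate H (h ` S)\<rparr>)"
proof -
  interpret group_hom G H h using assms by (intro group_homI)
  show i: "h ` carrier (G\<lparr>carrier := generate G S\<rparr>) = carrier (H\<lparr>carrier := generate H (h ` S)\<rparr>)"
    using generate_img[OF assms(4)] by simp
  show "h \<in> hom (G\<lparr>carrier := generate G S\<rparr>) (H\<lparr>carrier := generate H (h ` S)\<rparr>)"
    using i G.generate_incl[OF assms(4)] assms(3)
    by (auto simp: hom_def subset_iff)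
qed

lemma generate_group:
  assumes "group G" "S \<subseteq> carrier G"
  shows "group (G\<lparr>carrier := generate G S\<rparr>)"
  using assms by (intro group.subgroup_imp_group group.generate_is_subgroup)

lemma locally_indicable_mon:
  assumes "group C" "group G" "h \<in> mon C G" "locally_indicable G"
  shows "locally_indicable C"
  unfolding locally_indicable_iff[OF assms(1)]
proof (intro allI impI)
  fix S assume S: "finite S" "S \<subseteq> carrier C" "generate C S \<noteq> {\<one>\<^bsub>C\<^esub>}"
  have h: "h \<in> hom C G" using assms(3) by (simp add: mon_def)
  interpret group_hom C G h by (intro group_homI assms h)
  note r = generate_hom_restrict[OF assms(1,2) h S(2)]
  have hS: "h ` S \<subseteq> carrier G" using S(2) by auto
  have "generate G (h ` S) \<noteq> {\<one>\<^bsub>G\<^esub>}"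
  proof
    assume e: "generate G (h ` S) = {\<one>\<^bsub>G\<^esub>}"
    have "x = \<one>\<^bsub>C\<^esub>" if x: "x \<in> generate C S" for x
    proof -
      have "h x = \<one>\<^bsub>G\<^esub>" using r(2) x e by auto
      then show ?thesis using mon_eq_one_iff[OF assms(3,1,2)] G.generate_in_carrier[OF S(2) x] by simp
    qed
    then show False using S(3) generate.one[of C S] by blast
  qed
  then have "indicable (G\<lparr>carrier := generate G (h ` S)\<rparr>)"
    using assms(4) S(1) hS unfolding locally_indicable_iff[OF assms(2)] by blast
  then show "indicable (C\<lparr>carrier := generate C S\<rparr>)"
    using indicable_pullback[OF generate_group[OF assms(1) S(2)] generate_group[OF assms(2) hS] r]
    by simp
qed

text \<open>A finitely generated subgroup either has a non-trivial image in \<open>Q\<close>, whose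
  map onto the integers is pulled back, or lies in the kernel.\<close>

lemma locally_indicable_ext:
  assumes "group C" "group Q" "\<phi> \<in> hom C Q" "locally_indicable Q"
    and k: "locally_indicable (C\<lparr>carrier := kernel C Q \<phi>\<rparr>)"
  shows "locally_indicable C"
  unfolding locally_indicable_iff[OF assms(1)]
proof (intro allI impI)
  fix S assume S: "finite S" "S \<subseteq> carrier C" "generate C S \<noteq> {\<one>\<^bsub>C\<^esub>}"
  interpret group_hom C Q \<phi> by (intro group_homI assms)
  note r = generate_hom_restrict[OF assms(1-3) S(2)]
  have pS: "\<phi> ` S \<subseteq> carrier Q" using S(2) by auto
  show "indicable (C\<lparr>carrier := generate C S\<rparr>)"
  proof (cases "generate Q (\<phi> ` S) = {\<one>\<^bsub>Q\<^esub>}")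
    case False
    then have "indicable (Q\<lparr>carrier := generate Q (\<phi> ` S)\<rparr>)"
      using assms(4) S(1) pS unfolding locally_indicable_iff[OF assms(2)] by blast
    then show ?thesis
      using indicable_pullback[OF generate_group[OF assms(1) S(2)] generate_group[OF assms(2) pS] r]
      by simp
  next
    case True
    have "\<phi> x = \<one>\<^bsub>Q\<^esub>" if "x \<in> S" for x
      using True generate.incl[of "\<phi> x" "\<phi> ` S" Q] that by blast
    then have Sk: "S \<subseteq> kernel C Q \<phi>" using S(2) by (auto simp: kernel_def)
    have g: "generate (C\<lparr>carrier := kernel C Q \<phi>\<rparr>) S = generate C S"
      by (rule G.generate_consistent[OF Sk subgroup_kernel])
    have "group (C\<lparr>carrier := kernel C Q \<phi>\<rparr>)" by (rule G.subgroup_imp_group[OF subgroup_kernel])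
    from k[unfolded locally_indicable_iff[OF this], rule_format, of S] show ?thesis using S Sk g by simp
  qed
qed

lemma finite_subset_chain:
  assumes "\<And>n::nat. K n \<subseteq> K (Suc n)" "finite S" "S \<subseteq> (\<Union>n. K n)"
  obtains n where "S \<subseteq> K n"
proof -
  have mono: "K n \<subseteq> K m" if "n \<le> m" for n m
    by (rule lift_Suc_mono_le[of K, OF assms(1) that])
  have "\<exists>n. S \<subseteq> K n" using assms(2,3)
  proof (induction S)
    case (insert x S)
    then obtain n m where "S \<subseteq> K n" "x \<in> K m" by auto
    then have "insert x S \<subseteq> K (max n m)" using mono[of n "max n m"] mono[of m "max n m"] by auto
    then show ?case ..
  qed auto
  then show ?thesis using that by blast
qed

lemma locally_indicable_Un:
  assumes "group C" "\<And>n::nat. subgroup (K n) C" "\<And>n. K n \<subseteq> K (Suc n)" "(\<Union>n. K n) = carrier C"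
    and k: "\<And>n. locally_indicable (C\<lparr>carrier := K n\<rparr>)"
  shows "locally_indicable C"
  unfolding locally_indicable_iff[OF assms(1)]
proof (intro allI impI)
  fix S assume S: "finite S" "S \<subseteq> carrier C" "generate C S \<noteq> {\<one>\<^bsub>C\<^esub>}"
  interpret C: group C by fact
  obtain n where n: "S \<subseteq> K n" using finite_subset_chain[of K S, OF assms(3) S(1)] S(2) assms(4) by blast
  have g: "generate (C\<lparr>carrier := K n\<rparr>) S = generate C S"
    by (rule C.generate_consistent[OF n assms(2)])
  from k[of n, unfolded locally_indicable_iff[OF C.subgroup_imp_group[OF assms(2)]], rule_format, of S]
  show "indicable (C\<lparr>carrier := generate C S\<rparr>)" using S n g by simp
qed

text \<open>A non-trivial subgroup consists of the multiples of its least positive element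
  \<open>d\<close>, so division by \<open>d\<close> maps it onto the integers.\<close>

lemma locally_indicable_integer: "locally_indicable integer_group"
  unfolding locally_indicable_def
proof (intro allI impI, elim conjE)
  fix H assume H: "subgroup H integer_group" "H \<noteq> {\<one>\<^bsub>integer_group\<^esub>}"
  interpret subgroup H integer_group by fact
  have z: "0 \<in> H" using one_closed by simp
  have add: "a + b \<in> H" if "a \<in> H" "b \<in> H" for a b using m_closed[OF that] by simp
  have neg: "- a \<in> H" if "a \<in> H" for a using m_inv_closed[OF that] by simp
  have muln: "int n * a \<in> H" if "a \<in> H" for n a
    by (induction n) (auto simp: z algebra_simps add that)
  have mul: "k * a \<in> H" if "a \<in> H" for k a
    using muln[OF that, of "nat \<bar>k\<bar>"] neg by (cases "k \<ge> 0") fastforce+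
  obtain a where "a \<in> H" "a \<noteq> 0" using H(2) z by auto
  then have "\<bar>a\<bar> \<in> H" "\<bar>a\<bar> > 0" using neg by (auto simp: abs_if)
  then have ex: "\<exists>n::nat. n > 0 \<and> int n \<in> H" by (intro exI[of _ "nat \<bar>a\<bar>"]) auto
  define d where "d = (LEAST n::nat. n > 0 \<and> int n \<in> H)"
  have d: "d > 0" "int d \<in> H" using LeastI_ex[OF ex] by (auto simp: d_def)
  have min: "d \<le> n" if "n > 0" "int n \<in> H" for n
    unfolding d_def by (rule Least_le) (use that in auto)
  have dv: "int d dvd x" if x: "x \<in> H" for x
  proof -
    have "x + (- (x div int d)) * int d \<in> H" using add[OF x mul[OF d(2)]] .
    then have "x mod int d \<in> H" by (simp add: minus_div_mult_eq_mod[symmetric])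
    moreover have "0 \<le> x mod int d" "x mod int d < int d" using d(1) by auto
    ultimately have "x mod int d = 0" using min[of "nat (x mod int d)"] by (cases "x mod int d = 0") auto
    then show ?thesis by auto
  qed
  show "indicable (integer_group\<lparr>carrier := H\<rparr>)"
    unfolding indicable_iff[OF group.subgroup_imp_group[OF group_integer_group H(1)]]
  proof
    show "(\<lambda>x. x div int d) \<in> hom (integer_group\<lparr>carrier := H\<rparr>) integer_group"
      using dv by (auto simp: hom_def div_plus_div_distrib_dvd_left)
    have "k \<in> (\<lambda>x. x div int d) ` H" for k
      using mul[OF d(2), of k] d(1) by (intro image_eqI[of _ _ "k * int d"]) auto
    then show "(\<lambda>x. x div int d) ` carrier (integer_group\<lparr>carrier := H\<rparr>) = UNIV" by auto
  qed
qed

subsection \<open>Direct limits\<close>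

text \<open>Makes the rule \<open>lim\<close> applicable to directed families of subgroups. With the
  subgroups themselves as indices, the index set has the type \<open>'a set set\<close> that the
  rule prescribes.\<close>

lemma directed_union_direct_limit:
  assumes "group L" and sub: "\<And>H. H \<in> \<H> \<Longrightarrow> subgroup H L" and ne: "\<H> \<noteq> {}"
    and dir: "\<And>A B. A \<in> \<H> \<Longrightarrow> B \<in> \<H> \<Longrightarrow> \<exists>D\<in>\<H>. A \<subseteq> D \<and> B \<subseteq> D"
    and un: "\<Union>\<H> = carrier L"
  defines "r \<equiv> {(A, B). A \<in> \<H> \<and> B \<in> \<H> \<and> A \<subseteq> B}"
  shows "direct_system \<H> r (\<lambda>H. L\<lparr>carrier := H\<rparr>) (\<lambda>_ _ x. x)"
    and "direct_limit \<H> r (\<lambda>H. L\<lparr>carrier := H\<rparr>) (\<lambda>_ _ x. x) \<cong> L"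
proof -
  interpret L: group L by fact
  show "direct_system \<H> r (\<lambda>H. L\<lparr>carrier := H\<rparr>) (\<lambda>_ _ x. x)"
    unfolding direct_system_def
  proof (intro conjI ballI allI impI)
    show "preorder_on \<H> r" by (auto simp: preorder_on_def r_def refl_on_def trans_def)
    show "\<exists>k\<in>\<H>. (i, k) \<in> r \<and> (j, k) \<in> r" if "i \<in> \<H>" "j \<in> \<H>" for i j
      using dir[OF that] that by (auto simp: r_def)
    show "group (L\<lparr>carrier := i\<rparr>)" if "i \<in> \<H>" for i using L.subgroup_imp_group[OF sub[OF that]] .
  qed (use ne in \<open>auto simp: r_def hom_def\<close>)
  let ?e = "eventually_equal \<H> r (\<lambda>H. L\<lparr>carrier := H\<rparr>) (\<lambda>_ _ x. x)"
  let ?D = "direct_limit \<H> r (\<lambda>H. L\<lparr>carrier := H\<rparr>) (\<lambda>_ _ x. x)"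
  \<comment> \<open>The class of \<open>x\<close> in the limit: all transition maps are inclusions,
    so two pairs are eventually equal iff they carry the same element.\<close>
  define c where "c x = {(H, x) |H. H \<in> \<H> \<and> x \<in> H}" for x :: 'a
  have e: "?e `` {(i, x)} = c x" if "i \<in> \<H>" "x \<in> i" for i x
  proof -
    have "\<exists>k\<in>\<H>. (i, k) \<in> r \<and> (j, k) \<in> r" if "j \<in> \<H>" for j
      using dir[OF \<open>i \<in> \<H>\<close> that] \<open>i \<in> \<H>\<close> that by (auto simp: r_def)
    then show ?thesis using that by (auto simp: eventually_equal_def c_def)
  qed
  have ex: "\<exists>i\<in>\<H>. x \<in> i" if "x \<in> carrier L" for x using un that by blast
  have cc: "x \<in> i \<Longrightarrow> i \<in> \<H> \<Longrightarrow> x \<in> carrier L" for x i using un by blast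
  have inj: "inj_on c (carrier L)"
  proof (rule inj_onI)
    fix x y assume a: "x \<in> carrier L" "y \<in> carrier L" "c x = c y"
    obtain i where i: "i \<in> \<H>" "x \<in> i" using ex[OF a(1)] by blast
    then have "(i, x) \<in> c x" by (auto simp: c_def)
    then have "(i, x) \<in> c y" using a(3) by (simp only:)
    then show "x = y" by (simp add: c_def)
  qed
  have carr: "carrier ?D = c ` carrier L"
  proof -
    have "carrier ?D = (\<Union>x\<in>(SIGMA i:\<H>. i). {?e `` {x}})"
      by (simp add: direct_limit_def quotient_def)
    also have "\<dots> = (\<Union>x\<in>(SIGMA i:\<H>. i). {c (snd x)})"
      by (intro SUP_cong refl, clarify) (simp only: e snd_conv subset_refl empty_subsetI simp_thms)
    also have "\<dots> = c ` carrier L"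
    proof (intro equalityI subsetI)
      fix z assume "z \<in> (\<Union>x\<in>(SIGMA i:\<H>. i). {c (snd x)})"
      then obtain i x where "i \<in> \<H>" "x \<in> i" "z = c x" by auto
      then show "z \<in> c ` carrier L" using cc by simp
    next
      fix z assume "z \<in> c ` carrier L"
      then obtain x where x: "x \<in> carrier L" "z = c x" by blast
      obtain i where "i \<in> \<H>" "x \<in> i" using ex[OF x(1)] by blast
      then show "z \<in> (\<Union>x\<in>(SIGMA i:\<H>. i). {c (snd x)})"
        unfolding x(2) by (intro UN_I[of "(i, x)"]) auto
    qed
    finally show ?thesis .
  qed
  have "c \<in> iso L ?D"
    unfolding iso_def mem_Collect_eq hom_def
  proof (intro conjI CollectI ballI)
    show "c \<in> carrier L \<rightarrow> carrier ?D" "bij_betw c (carrier L) (carrier ?D)"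
      using inj by (auto simp: bij_betw_def carr)
    fix x y assume x: "x \<in> carrier L" and y: "y \<in> carrier L"
    obtain i j where i: "i \<in> \<H>" "x \<in> i" and j: "j \<in> \<H>" "y \<in> j" using ex[OF x] ex[OF y] by blast
    obtain k where k: "k \<in> \<H>" "x \<in> k" "y \<in> k" using dir[OF i(1) j(1)] i j by blast
    have "{?e `` {(i, x' \<otimes>\<^bsub>L\<^esub> y')} | i x' y'. (i, x') \<in> c x \<and> (i, y') \<in> c y} = {c (x \<otimes>\<^bsub>L\<^esub> y)}"
    proof (intro equalityI subsetI)
      fix z assume "z \<in> {?e `` {(i, x' \<otimes>\<^bsub>L\<^esub> y')} | i x' y'. (i, x') \<in> c x \<and> (i, y') \<in> c y}"
      then obtain i where "z = ?e `` {(i, x \<otimes>\<^bsub>L\<^esub> y)}" "i \<in> \<H>" "x \<in> i" "y \<in> i" by (auto simp: c_def)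
      then show "z \<in> {c (x \<otimes>\<^bsub>L\<^esub> y)}" using e subgroup.m_closed[OF sub] by simp
    next
      fix z assume "z \<in> {c (x \<otimes>\<^bsub>L\<^esub> y)}"
      moreover have "x \<otimes>\<^bsub>L\<^esub> y \<in> k" using k subgroup.m_closed[OF sub] by simp
      ultimately have "z = ?e `` {(k, x \<otimes>\<^bsub>L\<^esub> y)}" using e k(1) by simp
      then show "z \<in> {?e `` {(i, x' \<otimes>\<^bsub>L\<^esub> y')} | i x' y'. (i, x') \<in> c x \<and> (i, y') \<in> c y}"
        using k by (auto simp: c_def)
    qed
    then show "c (x \<otimes>\<^bsub>L\<^esub> y) = c x \<otimes>\<^bsub>?D\<^esub> c y" by (simp add: direct_limit_def)
  qed
  then show "?D \<cong> L" using L.iso_set_sym is_isoI by blast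
qed

text \<open>Extracts from the concrete quotient what an induction over \<open>lim\<close> uses:
  compatible homomorphisms whose images cover the limit. The work lies in the independence of
  products from representatives, which are moved to a common later index.\<close>

lemma direct_limit_cocone:
  assumes ds: "direct_system I r G f" and L: "group L" and iso: "direct_limit I r G f \<cong> L"
  obtains \<psi> where "\<And>i. i \<in> I \<Longrightarrow> \<psi> i \<in> hom (G i) L"
    and "\<And>i j x. (i, j) \<in> r \<Longrightarrow> x \<in> carrier (G i) \<Longrightarrow> \<psi> j (f i j x) = \<psi> i x"
    and "\<And>z. z \<in> carrier L \<Longrightarrow> \<exists>i\<in>I. \<exists>x\<in>carrier (G i). z = \<psi> i x"
proof -
  let ?D = "direct_limit I r G f"
  let ?e = "eventually_equal I r G f"
  obtain h where h: "h \<in> iso ?D L" using iso by (auto simp: is_iso_def)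
  have rI: "i \<in> I" "j \<in> I" if "(i, j) \<in> r" for i j
    using ds that by (auto simp: direct_system_def preorder_on_def)
  have rr: "(i, i) \<in> r" if "i \<in> I" for i
    using ds that by (auto simp: direct_system_def preorder_on_def refl_on_def)
  have rt: "(i, k) \<in> r" if "(i, j) \<in> r" "(j, k) \<in> r" for i j k
    using ds that by (auto simp: direct_system_def preorder_on_def dest: transD)
  have dir: "\<exists>k\<in>I. (i, k) \<in> r \<and> (j, k) \<in> r" if "i \<in> I" "j \<in> I" for i j
    using ds that by (auto simp: direct_system_def)
  have fh: "f i j \<in> hom (G i) (G j)" if "(i, j) \<in> r" for i j
    using ds that by (auto simp: direct_system_def)
  have fc: "f i j x \<in> carrier (G j)" if "(i, j) \<in> r" "x \<in> carrier (G i)" for i j x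
    using fh that by (auto simp: hom_def)
  have fm: "f i j (x \<otimes>\<^bsub>G i\<^esub> y) = f i j x \<otimes>\<^bsub>G j\<^esub> f i j y"
    if "(i, j) \<in> r" "x \<in> carrier (G i)" "y \<in> carrier (G i)" for i j x y
    using fh that by (auto simp: hom_def)
  have ff: "f j k (f i j x) = f i k x" if "(i, j) \<in> r" "(j, k) \<in> r" "x \<in> carrier (G i)" for i j k x
    using ds that by (auto simp: direct_system_def)
  have Gg: "group (G i)" if "i \<in> I" for i using ds that by (auto simp: direct_system_def)
  have eI: "((i, x), (j, y)) \<in> ?e"
    if "(i, k) \<in> r" "(j, k) \<in> r" "x \<in> carrier (G i)" "y \<in> carrier (G j)" "f i k x = f j k y" for i j k x y
    using that rI by (auto simp: eventually_equal_def)
  have eE: "\<exists>k. (i, k) \<in> r \<and> (j, k) \<in> r \<and> f i k x = f j k y \<and> x \<in> carrier (G i) \<and> y \<in> carrier (G j)"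
    if "((i, x), (j, y)) \<in> ?e" for i j x y
    using that by (auto simp: eventually_equal_def)
  have sym: "sym ?e"
    unfolding sym_def by (clarsimp simp: eventually_equal_def) metis
  have tr: "trans ?e"
  proof (rule transI, clarify)
    fix i x j y l z assume a: "((i, x), (j, y)) \<in> ?e" "((j, y), (l, z)) \<in> ?e"
    obtain k where k: "(i, k) \<in> r" "(j, k) \<in> r" "f i k x = f j k y" "x \<in> carrier (G i)" "y \<in> carrier (G j)"
      using eE[OF a(1)] by blast
    obtain m where m: "(j, m) \<in> r" "(l, m) \<in> r" "f j m y = f l m z" "z \<in> carrier (G l)"
      using eE[OF a(2)] by blast
    obtain n where n: "(k, n) \<in> r" "(m, n) \<in> r" using dir[of k m] rI k(1) m(1) by blast
    have "f i n x = f k n (f i k x)" using ff[OF k(1) n(1) k(4)] by simp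
    also have "\<dots> = f m n (f j m y)" using ff[OF k(2) n(1) k(5)] ff[OF m(1) n(2) k(5)] k(3) by simp
    also have "\<dots> = f l n z" using ff[OF m(2) n(2) m(4)] m(3) by simp
    finally show "((i, x), (l, z)) \<in> ?e" by (intro eI[OF rt[OF k(1) n(1)] rt[OF m(2) n(2)] k(4) m(4)])
  qed
  have cls: "?e `` {p} = ?e `` {q}" if "(p, q) \<in> ?e" for p q
    using that sym tr by (auto dest: symD transD)
  have self: "((i, x), (i, x)) \<in> ?e" if "i \<in> I" "x \<in> carrier (G i)" for i x
    by (rule eI[OF rr rr]) (use that in auto)
  define \<psi> where "\<psi> i x = h (?e `` {(i, x)})" for i x
  have carr: "?e `` {(i, x)} \<in> carrier ?D" if "i \<in> I" "x \<in> carrier (G i)" for i x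
    using that by (auto simp: direct_limit_def quotient_def)
  have mult: "?e `` {(i, x)} \<otimes>\<^bsub>?D\<^esub> ?e `` {(i, y)} = ?e `` {(i, x \<otimes>\<^bsub>G i\<^esub> y)}"
    if i: "i \<in> I" and x: "x \<in> carrier (G i)" and y: "y \<in> carrier (G i)" for i x y
  proof -
    \<comment> \<open>All products through representatives give the same class, so the union in the
      definition of the multiplication is over a singleton.\<close>
    have "{?e `` {(j, x' \<otimes>\<^bsub>G j\<^esub> y')} | j x' y'. (j, x') \<in> ?e `` {(i, x)} \<and> (j, y') \<in> ?e `` {(i, y)}}
       = {?e `` {(i, x \<otimes>\<^bsub>G i\<^esub> y)}}"
    proof (intro equalityI subsetI)
      fix z assume "z \<in> {?e `` {(j, x' \<otimes>\<^bsub>G j\<^esub> y')} | j x' y'. (j, x') \<in> ?e `` {(i, x)} \<and> (j, y') \<in> ?e `` {(i, y)}}"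
      then obtain j x' y' where z: "z = ?e `` {(j, x' \<otimes>\<^bsub>G j\<^esub> y')}"
        and a: "((i, x), (j, x')) \<in> ?e" "((i, y), (j, y')) \<in> ?e" by auto
      obtain k where k: "(i, k) \<in> r" "(j, k) \<in> r" "f i k x = f j k x'" "x' \<in> carrier (G j)"
        using eE[OF a(1)] by blast
      obtain m where m: "(i, m) \<in> r" "(j, m) \<in> r" "f i m y = f j m y'" "y' \<in> carrier (G j)"
        using eE[OF a(2)] by blast
      obtain n where n: "(k, n) \<in> r" "(m, n) \<in> r" using dir[of k m] rI k(1) m(1) by blast
      have rin: "(i, n) \<in> r" and rjn: "(j, n) \<in> r" using rt k n by blast+
      have "f i n x = f j n x'" using ff[OF k(1) n(1) x] ff[OF k(2) n(1) k(4)] k(3) by simp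
      moreover have "f i n y = f j n y'" using ff[OF m(1) n(2) y] ff[OF m(2) n(2) m(4)] m(3) by simp
      ultimately have "f i n (x \<otimes>\<^bsub>G i\<^esub> y) = f j n (x' \<otimes>\<^bsub>G j\<^esub> y')"
        using fm[OF rin x y] fm[OF rjn k(4) m(4)] by simp
      moreover have "x \<otimes>\<^bsub>G i\<^esub> y \<in> carrier (G i)" "x' \<otimes>\<^bsub>G j\<^esub> y' \<in> carrier (G j)"
        using Gg rI[OF rin] rI[OF rjn] x y k(4) m(4) by (auto intro: monoid.m_closed group.is_monoid)
      ultimately have "((i, x \<otimes>\<^bsub>G i\<^esub> y), (j, x' \<otimes>\<^bsub>G j\<^esub> y')) \<in> ?e" using eI[OF rin rjn] by blast
      then show "z \<in> {?e `` {(i, x \<otimes>\<^bsub>G i\<^esub> y)}}" using cls z by blast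
    next
      fix z assume "z \<in> {?e `` {(i, x \<otimes>\<^bsub>G i\<^esub> y)}}"
      then show "z \<in> {?e `` {(j, x' \<otimes>\<^bsub>G j\<^esub> y')} | j x' y'. (j, x') \<in> ?e `` {(i, x)} \<and> (j, y') \<in> ?e `` {(i, y)}}"
        using self[OF i x] self[OF i y] by blast
    qed
    then show ?thesis by (simp add: direct_limit_def)
  qed
  show thesis
  proof (rule that[of \<psi>])
    fix i assume i: "i \<in> I"
    show "\<psi> i \<in> hom (G i) L"
      unfolding hom_def
    proof (intro CollectI conjI ballI funcsetI)
      show "\<psi> i x \<in> carrier L" if "x \<in> carrier (G i)" for x
        using h carr[OF i that] by (auto simp: \<psi>_def iso_def hom_def)
      fix x y assume x: "x \<in> carrier (G i)" and y: "y \<in> carrier (G i)"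
      have "h (?e `` {(i, x)} \<otimes>\<^bsub>?D\<^esub> ?e `` {(i, y)}) = \<psi> i x \<otimes>\<^bsub>L\<^esub> \<psi> i y"
        using h carr[OF i x] carr[OF i y] by (auto simp: \<psi>_def iso_def hom_def)
      then show "\<psi> i (x \<otimes>\<^bsub>G i\<^esub> y) = \<psi> i x \<otimes>\<^bsub>L\<^esub> \<psi> i y" using mult[OF i x y] by (simp add: \<psi>_def)
    qed
  next
    fix i j x assume a: "(i, j) \<in> r" "x \<in> carrier (G i)"
    have "((j, f i j x), (i, x)) \<in> ?e"
      by (rule eI[OF rr[OF rI(2)[OF a(1)]] a(1) fc[OF a] a(2)]) (rule ff[OF a(1) rr[OF rI(2)[OF a(1)]] a(2)])
    then show "\<psi> j (f i j x) = \<psi> i x" unfolding \<psi>_def using cls by metis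
  next
    fix z assume "z \<in> carrier L"
    then obtain d where d: "d \<in> carrier ?D" "z = h d" using h by (auto simp: iso_def bij_betw_def)
    then obtain i x where "i \<in> I" "x \<in> carrier (G i)" "d = ?e `` {(i, x)}"
      by (auto simp: direct_limit_def quotient_def)
    then show "\<exists>i\<in>I. \<exists>x\<in>carrier (G i). z = \<psi> i x" using d by (auto simp: \<psi>_def)
  qed
qed

subsection \<open>Elementary and subexponentially amenable groups\<close>

lemma amenability_closure_group: "amenability_closure B G \<Longrightarrow> group G"
  by (induction rule: amenability_closure.induct) (auto intro: group.subgroup_imp_group)

text \<open>Every group is the directed union of its finitely generated subgroups, so membership in
  the class is a local property.\<close>

lemma amenability_closure_local:
  fixes C :: "'a monoid"
  assumes C: "group C"
    and loc: "\<And>F. finite F \<Longrightarrow> F \<subseteq> carrier C \<Longrightarrow> amenability_closure B (C\<lparr>carrier := generate C F\<rparr>)"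
  shows "amenability_closure B C"
proof -
  interpret group C by fact
  let ?H = "{generate C F |F. finite F \<and> F \<subseteq> carrier C}"
  have a: "subgroup A C" if "A \<in> ?H" for A using that generate_is_subgroup by auto
  have b: "?H \<noteq> {}" by blast
  have c: "\<exists>D\<in>?H. A \<subseteq> D \<and> A' \<subseteq> D" if "A \<in> ?H" "A' \<in> ?H" for A A'
  proof -
    from that obtain F F' where "finite (F \<union> F')" "F \<union> F' \<subseteq> carrier C" "A = generate C F" "A' = generate C F'"
      by auto
    then show ?thesis using mono_generate[of F "F \<union> F'"] mono_generate[of F' "F \<union> F'"] by blast
  qed
  have d: "\<Union>?H = carrier C"
  proof
    show "\<Union>?H \<subseteq> carrier C" using a subgroup.subset by blast
    show "carrier C \<subseteq> \<Union>?H"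
    proof
      fix x assume "x \<in> carrier C"
      then have "x \<in> generate C {x}" "generate C {x} \<in> ?H" by (blast intro: generate.incl)+
      then show "x \<in> \<Union>?H" by blast
    qed
  qed
  show ?thesis
    by (rule amenability_closure.lim[OF directed_union_direct_limit(1)[OF C a b c d] _ C
          directed_union_direct_limit(2)[OF C a b c d]]) (use loc in auto)
qed

text \<open>The quotient appears as a homomorphic image, so \<open>C\<close> may live on another
  type than \<open>G\<close>; this is how membership in an inductive class passes from one type to
  another.\<close>

definition section_of :: "'b monoid \<Rightarrow> 'a monoid \<Rightarrow> bool" where
  "section_of C G \<longleftrightarrow> group C \<and> (\<exists>H \<phi>. subgroup H G \<and> \<phi> \<in> hom (G\<lparr>carrier := H\<rparr>) C \<and> \<phi> ` H = carrier C)"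

lemma section_of_subgroup:
  assumes "group G" "subgroup H G" "section_of C (G\<lparr>carrier := H\<rparr>)"
  shows "section_of C G"
  using assms(3) group.incl_subgroup[OF assms(1,2)] unfolding section_of_def by auto

lemma section_of_image:
  assumes G: "group G" and Q: "group Q" and p: "p \<in> hom G Q" "p ` carrier G = carrier Q" and "section_of C Q"
  shows "section_of C G"
proof -
  interpret group_hom G Q p by (intro group_homI assms)
  obtain H \<phi> where H: "subgroup H Q" "\<phi> \<in> hom (Q\<lparr>carrier := H\<rparr>) C" "\<phi> ` H = carrier C" and C: "group C"
    using assms(5) by (auto simp: section_of_def)
  let ?H = "{x \<in> carrier G. p x \<in> H}"
  have s: "subgroup ?H G"
  proof (rule G.subgroupI)
    have "\<one>\<^bsub>G\<^esub> \<in> ?H" using subgroup.one_closed[OF H(1)] by simp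
    then show "?H \<noteq> {}" by blast
  qed (use H(1) in \<open>auto intro: subgroup.m_closed subgroup.m_inv_closed\<close>)
  have im: "p ` ?H = H" using p(2) subgroup.subset[OF H(1)] by auto
  have "\<phi> \<circ> p \<in> hom (G\<lparr>carrier := ?H\<rparr>) C" using H(2) by (auto simp: hom_def)
  moreover have "(\<phi> \<circ> p) ` ?H = carrier C" using im H(3) by (metis image_comp)
  ultimately show ?thesis using s C unfolding section_of_def by blast
qed

lemma section_of_generate:
  assumes G: "group G" and "section_of C G" and F: "finite F" "F \<subseteq> carrier C"
  obtains H \<phi> T where "subgroup H G" "\<phi> \<in> hom (G\<lparr>carrier := H\<rparr>) C" "\<phi> ` H = carrier C"
    "finite T" "T \<subseteq> H" "F = \<phi> ` T"
proof -
  obtain H \<phi> where H: "subgroup H G" "\<phi> \<in> hom (G\<lparr>carrier := H\<rparr>) C" "\<phi> ` H = carrier C"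
    using assms(2) by (auto simp: section_of_def)
  obtain T where "T \<subseteq> H" "finite T" "F = \<phi> ` T"
    using finite_subset_image[OF F(1), of \<phi> H] F(2) H(3) by blast
  then show ?thesis using that H by blast
qed

lemma quotient_projection:
  assumes "group G" "group Q" "N \<lhd> G" "(G Mod N) \<cong> Q"
  obtains p where "p \<in> hom G Q" "p ` carrier G = carrier Q" "kernel G Q p = N"
proof -
  obtain k where k: "k \<in> iso (G Mod N) Q" using assms(4) by (auto simp: is_iso_def)
  interpret N: normal N G by fact
  have q: "(\<lambda>a. N #>\<^bsub>G\<^esub> a) \<in> hom G (G Mod N)" by (rule N.r_coset_hom_Mod)
  have kinj: "inj_on k (carrier (G Mod N))" using k by (simp add: iso_def bij_betw_def)
  have M: "group (G Mod N)" by (rule N.factorgroup_is_group)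
  show ?thesis
  proof (rule that[of "k \<circ> (\<lambda>a. N #>\<^bsub>G\<^esub> a)"])
    show h: "k \<circ> (\<lambda>a. N #>\<^bsub>G\<^esub> a) \<in> hom G Q" using q k by (intro hom_compose) (auto simp: iso_def)
    show "(k \<circ> (\<lambda>a. N #>\<^bsub>G\<^esub> a)) ` carrier G = carrier Q"
      using k by (auto simp: iso_def bij_betw_def carrier_FactGroup image_image)
    have "k N = \<one>\<^bsub>Q\<^esub>"
      using hom_one[of k "G Mod N" Q] k M assms(2) by (simp add: iso_def)
    then have "k (N #>\<^bsub>G\<^esub> x) = \<one>\<^bsub>Q\<^esub> \<longleftrightarrow> x \<in> N" if x: "x \<in> carrier G" for x
    proof -
      have "N #>\<^bsub>G\<^esub> x \<in> carrier (G Mod N)" "N \<in> carrier (G Mod N)"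
        using x M monoid.one_closed[OF group.is_monoid[OF M]] by (auto simp: carrier_FactGroup)
      then have "k (N #>\<^bsub>G\<^esub> x) = k N \<longleftrightarrow> N #>\<^bsub>G\<^esub> x = N" using kinj by (auto simp: inj_on_def)
      also have "\<dots> \<longleftrightarrow> x \<in> N"
        using N.coset_join1[OF _ x N.is_subgroup] N.coset_join2[OF x N.is_subgroup] by blast
      finally show ?thesis using \<open>k N = \<one>\<^bsub>Q\<^esub>\<close> by simp
    qed
    then show "kernel G Q (k \<circ> (\<lambda>a. N #>\<^bsub>G\<^esub> a)) = N"
      using N.subset by (auto simp: kernel_def)
  qed
qed

text \<open>A claim about subgroups alone would not survive the rule \<open>quot\<close>; for
  sections every rule goes through. A section of an extension is an extension of sections. For a
  limit it suffices to treat the finitely generated subgroups of the section, and these are sections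
  of single groups of the system.\<close>

lemma section_closure:
  fixes G :: "'a monoid" and C :: "nat monoid"
  assumes base: "\<And>(G::'a monoid) (C::nat monoid). group G \<Longrightarrow> B G \<Longrightarrow> section_of C G \<Longrightarrow> amenability_closure B' C"
    and G: "amenability_closure B G" and "section_of C G"
  shows "amenability_closure B' C"
  using G assms(3)
proof (induction arbitrary: C rule: amenability_closure.induct)
  case (base G)
  then show ?case using assms(1) by blast
next
  case (sub G H)
  then show ?case using section_of_subgroup amenability_closure_group by blast
next
  case (quot G N Q)
  have G: "group G" using quot.hyps amenability_closure_group by blast
  obtain p where "p \<in> hom G Q" "p ` carrier G = carrier Q"
    by (rule quotient_projection[OF G quot.hyps(3,2,4)])
  then show ?case using section_of_image[OF G quot.hyps(3)] quot by blast
next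
  case (ext G N Q)
  have Q: "group Q" using ext.hyps amenability_closure_group by blast
  have G: "group G" by fact
  obtain p where p: "p \<in> hom G Q" "p ` carrier G = carrier Q" "kernel G Q p = N"
    by (rule quotient_projection[OF G Q ext.hyps(2,5)])
  interpret p: group_hom G Q p by (intro group_homI G Q p)
  obtain H \<phi> where H: "subgroup H G" "\<phi> \<in> hom (G\<lparr>carrier := H\<rparr>) C" "\<phi> ` H = carrier C" and C: "group C"
    using ext.prems by (auto simp: section_of_def)
  have HG: "group (G\<lparr>carrier := H\<rparr>)" by (rule p.G.subgroup_imp_group[OF H(1)])
  interpret \<phi>: group_hom "G\<lparr>carrier := H\<rparr>" C \<phi> by (intro group_homI HG C H)
  have \<phi>m: "\<phi> (x \<otimes>\<^bsub>G\<^esub> y) = \<phi> x \<otimes>\<^bsub>C\<^esub> \<phi> y" if "x \<in> H" "y \<in> H" for x y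
    using \<phi>.hom_mult[of x y] that by simp
  have \<phi>c: "\<phi> x \<in> carrier C" if "x \<in> H" for x using \<phi>.hom_closed[of x] that by simp
  have \<phi>i: "\<phi> (inv\<^bsub>G\<^esub> x) = inv\<^bsub>C\<^esub> \<phi> x" if "x \<in> H" for x
    using \<phi>.hom_inv[of x] that p.G.m_inv_consistent[OF H(1) that] by simp
  have Hc: "x \<in> carrier G" if "x \<in> H" for x using subgroup.mem_carrier[OF H(1) that] .
  note Hm = subgroup.m_closed[OF H(1)] and Hi = subgroup.m_inv_closed[OF H(1)]
  have N: "subgroup N G" using ext.hyps(2) by (rule normal_imp_subgroup)
  have Np: "x \<in> N \<longleftrightarrow> x \<in> carrier G \<and> p x = \<one>\<^bsub>Q\<^esub>" for x using p(3) by (auto simp: kernel_def)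
  \<comment> \<open>The part of the section that comes from \<open>N\<close>. It is a section of
    \<open>N\<close>, and the quotient of \<open>C\<close> by it will be one of
    \<open>Q\<close>.\<close>
  define M where "M = \<phi> ` (H \<inter> N)"
  have HN: "subgroup (H \<inter> N) (G\<lparr>carrier := H\<rparr>)"
    by (rule p.G.subgroup_incl[OF p.G.subgroups_Inter_pair[OF H(1) N] H(1)]) simp
  have HN': "subgroup (H \<inter> N) (G\<lparr>carrier := N\<rparr>)"
    by (rule p.G.subgroup_incl[OF p.G.subgroups_Inter_pair[OF H(1) N] N]) simp
  have Ms: "subgroup M C" unfolding M_def by (rule \<phi>.subgroup_img_is_subgroup[OF HN])
  have M: "M \<lhd> C"
    unfolding \<phi>.H.normal_inv_iff
  proof (intro conjI ballI)
    fix x h assume x: "x \<in> carrier C" and h: "h \<in> M"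
    obtain a where a: "a \<in> H" "x = \<phi> a" using x H(3) by blast
    obtain b where b: "b \<in> H" "b \<in> N" "h = \<phi> b" using h by (auto simp: M_def)
    have "x \<otimes>\<^bsub>C\<^esub> h \<otimes>\<^bsub>C\<^esub> inv\<^bsub>C\<^esub> x = \<phi> (a \<otimes>\<^bsub>G\<^esub> b \<otimes>\<^bsub>G\<^esub> inv\<^bsub>G\<^esub> a)"
      using a b \<phi>m \<phi>i Hm Hi by simp
    moreover have "a \<otimes>\<^bsub>G\<^esub> b \<otimes>\<^bsub>G\<^esub> inv\<^bsub>G\<^esub> a \<in> H \<inter> N"
      using Hm Hi a b Hc normal.inv_op_closed2[OF ext.hyps(2)] by simp
    ultimately show "x \<otimes>\<^bsub>C\<^esub> h \<otimes>\<^bsub>C\<^esub> inv\<^bsub>C\<^esub> x \<in> M" by (simp add: M_def)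
  qed (rule Ms)
  have "section_of (C\<lparr>carrier := M\<rparr>) (G\<lparr>carrier := N\<rparr>)"
    unfolding section_of_def
  proof (intro conjI exI)
    show "group (C\<lparr>carrier := M\<rparr>)" by (rule \<phi>.H.subgroup_imp_group[OF Ms])
    show "subgroup (H \<inter> N) (G\<lparr>carrier := N\<rparr>)" by fact
    show "\<phi> \<in> hom (G\<lparr>carrier := N\<rparr>\<lparr>carrier := H \<inter> N\<rparr>) (C\<lparr>carrier := M\<rparr>)"
      using \<phi>m by (auto simp: hom_def M_def)
    show "\<phi> ` (H \<inter> N) = carrier (C\<lparr>carrier := M\<rparr>)" by (simp add: M_def)
  qed
  then have cM: "amenability_closure B' (C\<lparr>carrier := M\<rparr>)" by (rule ext.IH(1))
  interpret M: normal M C by fact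
  have CM: "group (C Mod M)" by (rule M.factorgroup_is_group)
  \<comment> \<open>The induction hypothesis for \<open>Q\<close> speaks about sections on
    \<open>nat\<close>, so the group of cosets is copied there.\<close>
  have "countable (carrier (C Mod M))" by (simp add: carrier_FactGroup)
  then obtain Q' :: "nat monoid" and k where Q': "group Q'" and k: "k \<in> iso (C Mod M) Q'"
    using nat_copy[OF CM] by blast
  obtain \<pi> where \<pi>: "\<pi> \<in> hom C Q'" "\<pi> ` carrier C = carrier Q'" "kernel C Q' \<pi> = M"
    by (rule quotient_projection[OF C Q' M is_isoI[OF k]])
  interpret \<pi>: group_hom C Q' \<pi> by (intro group_homI C Q' \<pi>)
  have pH: "subgroup (p ` H) Q" by (rule p.subgroup_img_is_subgroup[OF H(1)])
  \<comment> \<open>On \<open>H\<close> the element \<open>\<pi> (\<phi> x)\<close> depends only on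
    \<open>p x\<close>, since elements of \<open>H\<close> with equal image differ by an element of
    \<open>H \<inter> N\<close>. Composition with a choice \<open>s\<close> of preimages therefore
    gives a homomorphism from the image of \<open>H\<close> in \<open>Q\<close> onto
    \<open>Q'\<close>.\<close>
  define s where "s q = (SOME x. x \<in> H \<and> p x = q)" for q
  have s: "s q \<in> H \<and> p (s q) = q" if "q \<in> p ` H" for q
    unfolding s_def by (rule someI_ex) (use that in auto)
  have \<pi>\<phi>: "\<pi> (\<phi> x) = \<pi> (\<phi> y)" if "x \<in> H" "y \<in> H" "p x = p y" for x y
  proof -
    have "inv\<^bsub>G\<^esub> y \<otimes>\<^bsub>G\<^esub> x \<in> H \<inter> N" using that Hm Hi Hc by (simp add: Np)
    then have "\<phi> (inv\<^bsub>G\<^esub> y \<otimes>\<^bsub>G\<^esub> x) \<in> kernel C Q' \<pi>" unfolding \<pi>(3) M_def by blast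
    then have "\<pi> (inv\<^bsub>C\<^esub> \<phi> y \<otimes>\<^bsub>C\<^esub> \<phi> x) = \<one>\<^bsub>Q'\<^esub>"
      using that \<phi>m \<phi>i Hi by (simp add: kernel_def)
    then have "inv\<^bsub>Q'\<^esub> \<pi> (\<phi> y) \<otimes>\<^bsub>Q'\<^esub> \<pi> (\<phi> x) = \<one>\<^bsub>Q'\<^esub>" using that \<phi>c by simp
    then show ?thesis using that \<phi>c
      by (metis \<pi>.H.inv_closed \<pi>.H.inv_equality \<pi>.H.inv_inv \<pi>.hom_closed)
  qed
  have "section_of Q' Q"
    unfolding section_of_def
  proof (intro conjI exI)
    show "(\<lambda>q. \<pi> (\<phi> (s q))) \<in> hom (Q\<lparr>carrier := p ` H\<rparr>) Q'"
      unfolding hom_def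
    proof (intro CollectI conjI funcsetI ballI)
      show "\<pi> (\<phi> (s q)) \<in> carrier Q'" if "q \<in> carrier (Q\<lparr>carrier := p ` H\<rparr>)" for q
        using s[of q] that \<phi>c by simp
      fix q q' assume "q \<in> carrier (Q\<lparr>carrier := p ` H\<rparr>)" "q' \<in> carrier (Q\<lparr>carrier := p ` H\<rparr>)"
      then have q: "q \<in> p ` H" "q' \<in> p ` H" by auto
      have qq: "q \<otimes>\<^bsub>Q\<^esub> q' \<in> p ` H" using subgroup.m_closed[OF pH q] .
      have "\<pi> (\<phi> (s (q \<otimes>\<^bsub>Q\<^esub> q'))) = \<pi> (\<phi> (s q \<otimes>\<^bsub>G\<^esub> s q'))"
        by (rule \<pi>\<phi>) (use s[OF q(1)] s[OF q(2)] s[OF qq] Hm Hc in auto)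
      then show "\<pi> (\<phi> (s (q \<otimes>\<^bsub>Q\<lparr>carrier := p ` H\<rparr>\<^esub> q'))) = \<pi> (\<phi> (s q)) \<otimes>\<^bsub>Q'\<^esub> \<pi> (\<phi> (s q'))"
        using s[OF q(1)] s[OF q(2)] \<phi>m \<phi>c by simp
    qed
    show "(\<lambda>q. \<pi> (\<phi> (s q))) ` p ` H = carrier Q'"
    proof -
      have "(\<lambda>q. \<pi> (\<phi> (s q))) ` p ` H = (\<lambda>x. \<pi> (\<phi> x)) ` H"
        unfolding image_image by (intro image_cong refl \<pi>\<phi>) (use s in auto)
      also have "\<dots> = carrier Q'" using H(3) \<pi>(2) by (metis image_image)
      finally show ?thesis .
    qed
  qed (rule Q' pH)+
  then have "amenability_closure B' Q'" by (rule ext.IH(2))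
  then show ?case using amenability_closure.ext[OF C M cM] is_isoI[OF k] by blast
next
  case (lim I r G f L)
  have L: "group L" by fact
  have Gg: "group (G i)" if "i \<in> I" for i using lim.hyps(1) that by (auto simp: direct_system_def)
  obtain \<psi> where \<psi>: "\<And>i. i \<in> I \<Longrightarrow> \<psi> i \<in> hom (G i) L"
    "\<And>i j x. (i, j) \<in> r \<Longrightarrow> x \<in> carrier (G i) \<Longrightarrow> \<psi> j (f i j x) = \<psi> i x"
    "\<And>z. z \<in> carrier L \<Longrightarrow> \<exists>i\<in>I. \<exists>x\<in>carrier (G i). z = \<psi> i x"
    using direct_limit_cocone[OF lim.hyps(1) L lim.hyps(4)] by blast
  have C: "group C" using lim.prems by (simp add: section_of_def)
  \<comment> \<open>By directedness finitely many elements of the limit come from one group of the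
    system.\<close>
  have fin: "\<exists>i\<in>I. T \<subseteq> \<psi> i ` carrier (G i)" if "finite T" "T \<subseteq> carrier L" for T
    using that
  proof (induction T)
    case empty
    have "I \<noteq> {}" using lim.hyps(1) by (simp add: direct_system_def)
    then show ?case by blast
  next
    case (insert z T)
    obtain i where i: "i \<in> I" "T \<subseteq> \<psi> i ` carrier (G i)" using insert by auto
    obtain j x where j: "j \<in> I" "x \<in> carrier (G j)" "z = \<psi> j x" using \<psi>(3)[of z] insert.prems by blast
    obtain k where k: "k \<in> I" "(i, k) \<in> r" "(j, k) \<in> r"
      using lim.hyps(1) i(1) j(1) unfolding direct_system_def by blast
    have "\<psi> i ` carrier (G i) \<subseteq> \<psi> k ` carrier (G k)" if "(i, k) \<in> r" for i
    proof
      fix y assume "y \<in> \<psi> i ` carrier (G i)"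
      then obtain x where x: "x \<in> carrier (G i)" "y = \<psi> i x" by blast
      have "f i k \<in> hom (G i) (G k)" using lim.hyps(1) that by (simp add: direct_system_def)
      then have "f i k x \<in> carrier (G k)" using x by (auto simp: hom_def)
      then show "y \<in> \<psi> k ` carrier (G k)" using \<psi>(2)[OF that x(1)] x(2) by (metis image_eqI)
    qed
    then have "insert z T \<subseteq> \<psi> k ` carrier (G k)" using k i(2) j by blast
    then show ?case using k(1) by blast
  qed
  show ?case
  proof (rule amenability_closure_local[OF C])
    fix F assume F: "finite F" "F \<subseteq> carrier C"
    obtain H \<phi> T where H: "subgroup H L" "\<phi> \<in> hom (L\<lparr>carrier := H\<rparr>) C" "\<phi> ` H = carrier C"
      and T: "finite T" "T \<subseteq> H" "F = \<phi> ` T"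
      by (rule section_of_generate[OF L lim.prems F])
    have HG: "group (L\<lparr>carrier := H\<rparr>)" by (rule group.subgroup_imp_group[OF L H(1)])
    have TL: "T \<subseteq> carrier L" using T(2) subgroup.subset[OF H(1)] by blast
    then obtain i where i: "i \<in> I" "T \<subseteq> \<psi> i ` carrier (G i)" using fin[OF T(1)] by blast
    \<comment> \<open>The generators are lifted twice, from \<open>C\<close> to \<open>T\<close> in
      the limit and from there to \<open>Y\<close> in \<open>G i\<close>; the subgroup generated by
      \<open>F\<close> is then an image of \<open>generate (G i) Y\<close>.\<close>
    then obtain Y where Y: "Y \<subseteq> carrier (G i)" "T = \<psi> i ` Y" by (meson subset_imageE)
    note Gi = Gg[OF i(1)]
    have YG: "subgroup (generate (G i) Y) (G i)" by (rule group.generate_is_subgroup[OF Gi Y(1)])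
    have gT: "generate (L\<lparr>carrier := H\<rparr>) T = generate L T" by (rule group.generate_consistent[OF L T(2) H(1)])
    note r1 = generate_hom_restrict[OF Gi L \<psi>(1)[OF i(1)] Y(1)]
    have r2: "\<phi> \<in> hom (L\<lparr>carrier := generate L T\<rparr>) (C\<lparr>carrier := generate C F\<rparr>)"
      "\<phi> ` generate L T = generate C F"
      using generate_hom_restrict[OF HG C H(2), of T] T gT by auto
    have "section_of (C\<lparr>carrier := generate C F\<rparr>) (G i)"
      unfolding section_of_def
    proof (intro conjI exI)
      show "group (C\<lparr>carrier := generate C F\<rparr>)" by (rule generate_group[OF C F(2)])
      show "subgroup (generate (G i) Y) (G i)" by fact
      show "\<phi> \<circ> \<psi> i \<in> hom (G i\<lparr>carrier := generate (G i) Y\<rparr>) (C\<lparr>carrier := generate C F\<rparr>)"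
        using r1(1) r2(1) unfolding Y(2) by (rule hom_compose)
      have "(\<phi> \<circ> \<psi> i) ` generate (G i) Y = \<phi> ` (\<psi> i ` generate (G i) Y)" by (simp only: image_comp)
      also have "\<dots> = generate C F" using r1(2) r2(2) Y(2) by simp
      finally show "(\<phi> \<circ> \<psi> i) ` generate (G i) Y = carrier (C\<lparr>carrier := generate C F\<rparr>)" by simp
    qed
    then show "amenability_closure B' (C\<lparr>carrier := generate C F\<rparr>)" by (rule lim.IH[OF i(1)])
  qed
qed

lemma mon_section:
  assumes "group C" "group G" "h \<in> mon C G"
  shows "section_of C G"
proof -
  have h: "h \<in> hom C G" and inj: "inj_on h (carrier C)" using assms(3) by (auto simp: mon_def)
  interpret group_hom C G h by (intro group_homI assms h)
  let ?g = "inv_into (carrier C) h"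
  have "?g \<in> hom (G\<lparr>carrier := h ` carrier C\<rparr>) C"
  proof -
    have "?g (h x \<otimes>\<^bsub>G\<^esub> h y) = x \<otimes>\<^bsub>C\<^esub> y" if "x \<in> carrier C" "y \<in> carrier C" for x y
      using inv_into_f_f[OF inj, of "x \<otimes>\<^bsub>C\<^esub> y"] that by simp
    then show ?thesis by (auto simp: hom_def inv_into_f_f[OF inj])
  qed
  moreover have "?g ` h ` carrier C = carrier C" using inj by simp
  ultimately show ?thesis using img_is_subgroup assms(1) unfolding section_of_def by blast
qed

text \<open>The rule \<open>ext\<close> wants a quotient isomorphic to a member of the class; here
  that member is the image of \<open>\<phi>\<close>, a subgroup of \<open>Q\<close>.\<close>

lemma amenability_closure_ext:
  fixes C :: "'a monoid"
  assumes "group C" "group Q" "\<phi> \<in> hom C Q" "amenability_closure B Q"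
    and "amenability_closure B (C\<lparr>carrier := kernel C Q \<phi>\<rparr>)"
  shows "amenability_closure B C"
proof -
  interpret group_hom C Q \<phi> by (intro group_homI assms)
  let ?Q = "Q\<lparr>carrier := \<phi> ` carrier C\<rparr>"
  have s: "subgroup (\<phi> ` carrier C) Q" by (rule img_is_subgroup)
  have "group_hom C ?Q \<phi>"
    by (intro group_homI assms H.subgroup_imp_group[OF s]) (auto simp: hom_def)
  then have "(C Mod kernel C ?Q \<phi>) \<cong> ?Q" by (rule group_hom.FactGroup_iso) simp
  moreover have "kernel C ?Q \<phi> = kernel C Q \<phi>" by (simp add: kernel_def)
  ultimately show ?thesis
    using amenability_closure.ext[OF assms(1) normal_kernel assms(5)
        amenability_closure.sub[OF assms(4) s]] by simp
qed

lemma amenability_closure_Un: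
  assumes "group C" "\<And>n::nat. subgroup (K n) C" "\<And>n. K n \<subseteq> K (Suc n)" "(\<Union>n. K n) = carrier C"
    and k: "\<And>n. amenability_closure B (C\<lparr>carrier := K n\<rparr>)"
  shows "amenability_closure B C"
proof (rule amenability_closure_local[OF assms(1)])
  fix F assume F: "finite F" "F \<subseteq> carrier C"
  interpret C: group C by fact
  obtain n where n: "F \<subseteq> K n" using finite_subset_chain[of K F, OF assms(3) F(1)] F(2) assms(4) by blast
  have g: "generate (C\<lparr>carrier := K n\<rparr>) F = generate C F"
    by (rule C.generate_consistent[OF n assms(2)])
  have "subgroup (generate (C\<lparr>carrier := K n\<rparr>) F) (C\<lparr>carrier := K n\<rparr>)"
    by (rule group.generate_is_subgroup[OF C.subgroup_imp_group[OF assms(2)]]) (use n in simp)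
  from amenability_closure.sub[OF k this] show "amenability_closure B (C\<lparr>carrier := generate C F\<rparr>)"
    by (simp add: g)
qed

lemma elementary_amenable_section:
  fixes G :: "'a monoid" and C :: "nat monoid"
  assumes "elementary_amenable G" "section_of C G"
  shows "elementary_amenable C"
  unfolding elementary_amenable_def
proof (rule section_closure[OF _ assms(1)[unfolded elementary_amenable_def] assms(2)])
  fix G :: "'a monoid" and C :: "nat monoid"
  assume G: "group G" and B: "finite (carrier G) \<or> comm_group G" and "section_of C G"
  then obtain H \<phi> where H: "subgroup H G" "\<phi> \<in> hom (G\<lparr>carrier := H\<rparr>) C" "\<phi> ` H = carrier C" and C: "group C"
    by (auto simp: section_of_def)
  have Hc: "H \<subseteq> carrier G" by (rule subgroup.subset[OF H(1)])
  have "finite (carrier C) \<or> comm_group C"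
    using B
  proof
    assume "finite (carrier G)"
    then show ?thesis using H(3) Hc by (metis finite_imageI finite_subset)
  next
    assume c: "comm_group G"
    have "comm_group C"
    proof (rule group.group_comm_groupI[OF C])
      fix x y assume "x \<in> carrier C" "y \<in> carrier C"
      then obtain a b where ab: "a \<in> H" "b \<in> H" "x = \<phi> a" "y = \<phi> b" using H(3) by blast
      have m: "\<phi> (a \<otimes>\<^bsub>G\<^esub> b) = x \<otimes>\<^bsub>C\<^esub> y" "\<phi> (b \<otimes>\<^bsub>G\<^esub> a) = y \<otimes>\<^bsub>C\<^esub> x"
        using H(2) ab by (auto simp: hom_def)
      have "a \<otimes>\<^bsub>G\<^esub> b = b \<otimes>\<^bsub>G\<^esub> a"
        using comm_monoid.m_comm[OF comm_group.axioms(1)[OF c]] ab Hc by blast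
      then show "x \<otimes>\<^bsub>C\<^esub> y = y \<otimes>\<^bsub>C\<^esub> x" using m by simp
    qed
    then show ?thesis ..
  qed
  then show "amenability_closure (\<lambda>G. finite (carrier G) \<or> comm_group G) C"
    using C by (intro amenability_closure.base) auto
qed

section \<open>Growth of balls under passage to sections\<close>

lemma word_ball_finite: "finite S \<Longrightarrow> finite (word_ball G S n)"
proof -
  assume S: "finite S"
  have "word_ball G S n = (\<lambda>w. foldr (\<otimes>\<^bsub>G\<^esub>) w \<one>\<^bsub>G\<^esub>) ` {w. set w \<subseteq> S \<union> m_inv G ` S \<and> length w \<le> n}"
    by (auto simp: word_ball_def)
  then show ?thesis using finite_lists_length_le[of "S \<union> m_inv G ` S" n] S by simp
qed

lemma one_in_word_ball: "\<one>\<^bsub>G\<^esub> \<in> word_ball G S n"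
  by (auto simp: word_ball_def intro: exI[of _ "[]"])

lemma word_ball_mono: "m \<le> n \<Longrightarrow> word_ball G S m \<subseteq> word_ball G S n"
  by (auto simp: word_ball_def)

lemma (in group) word_closed: "set w \<subseteq> carrier G \<Longrightarrow> foldr (\<otimes>) w \<one> \<in> carrier G"
  by (induction w) auto

lemma word_ball_mult:
  fixes G (structure)
  assumes "group G" and "S \<subseteq> carrier G" "x \<in> word_ball G S m" "y \<in> word_ball G S n"
  shows "x \<otimes> y \<in> word_ball G S (m + n)"
proof -
  interpret group G by fact
  obtain v w where v: "x = foldr (\<otimes>) v \<one>" "set v \<subseteq> S \<union> m_inv G ` S" "length v \<le> m"
    and w: "y = foldr (\<otimes>) w \<one>" "set w \<subseteq> S \<union> m_inv G ` S" "length w \<le> n"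
    using assms by (auto simp: word_ball_def)
  have c: "S \<union> m_inv G ` S \<subseteq> carrier G" using assms(2) by auto
  have yc: "y \<in> carrier G" using word_closed w c by auto
  have "foldr (\<otimes>) v y = foldr (\<otimes>) v \<one> \<otimes> y" using subset_trans[OF v(2) c]
    by (induction v) (auto simp: yc m_assoc word_closed)
  then have "x \<otimes> y = foldr (\<otimes>) (v @ w) \<one>" using v(1) w(1) by simp
  then show ?thesis unfolding word_ball_def mem_Collect_eq
    using v w by (intro exI[of _ "v @ w"]) auto
qed

lemma generate_word_ball:
  fixes G (structure)
  assumes "group G" and "S \<subseteq> carrier G" "x \<in> generate G S"
  shows "\<exists>n. x \<in> word_ball G S n"
  using assms(3)
proof (induction rule: generate.induct)
  interpret group G by fact
  case one
  then show ?case using one_in_word_ball[of G] by blast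
next
  interpret group G by fact
  case (incl h)
  have "h \<in> word_ball G S 1" unfolding word_ball_def mem_Collect_eq
    by (rule exI[of _ "[h]"]) (use incl subsetD[OF assms(2)] in auto)
  then show ?case ..
next
  interpret group G by fact
  case (inv h)
  have "inv h \<in> word_ball G S 1" unfolding word_ball_def mem_Collect_eq
    by (rule exI[of _ "[inv h]"]) (use inv assms(2) in auto)
  then show ?case ..
next
  case (eng h1 h2)
  then show ?case using word_ball_mult[OF assms(1,2)] by blast
qed

text \<open>The constant \<open>c\<close> bounds the length over \<open>S\<close> of all letters
  from \<open>T\<close> and their inverses, so a word of length \<open>n\<close> over the image of
  \<open>T\<close> lifts to one of length at most \<open>c * n\<close> over \<open>S\<close>. The
  lift stays in \<open>H\<close>, where \<open>\<phi>\<close> is multiplicative.\<close>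

lemma word_ball_section:
  assumes G: "group G" and H: "subgroup H G" and C: "group C" and \<phi>: "\<phi> \<in> hom (G\<lparr>carrier := H\<rparr>) C"
    and S: "S \<subseteq> carrier G" and T: "T \<subseteq> H" and c: "T \<union> m_inv G ` T \<subseteq> word_ball G S c"
  shows "word_ball C (\<phi> ` T) n \<subseteq> \<phi> ` (word_ball G S (c * n) \<inter> H)"
proof -
  interpret G: group G by fact
  interpret C: group C by fact
  interpret \<phi>: group_hom "G\<lparr>carrier := H\<rparr>" C \<phi> by (intro group_homI G.subgroup_imp_group H C \<phi>)
  have \<phi>m: "\<phi> (x \<otimes>\<^bsub>G\<^esub> y) = \<phi> x \<otimes>\<^bsub>C\<^esub> \<phi> y" if "x \<in> H" "y \<in> H" for x y
    using \<phi>.hom_mult[of x y] that by simp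
  have \<phi>i: "\<phi> (inv\<^bsub>G\<^esub> x) = inv\<^bsub>C\<^esub> \<phi> x" if "x \<in> H" for x
    using \<phi>.hom_inv[of x] that G.m_inv_consistent[OF H that] by simp
  have \<phi>1: "\<phi> \<one>\<^bsub>G\<^esub> = \<one>\<^bsub>C\<^esub>" using \<phi>.hom_one by simp
  have letters: "\<exists>g\<in>word_ball G S c \<inter> H. a = \<phi> g" if "a \<in> \<phi> ` T \<union> m_inv C ` \<phi> ` T" for a
  proof -
    from that obtain t where t: "t \<in> T" "a = \<phi> t \<or> a = \<phi> (inv\<^bsub>G\<^esub> t)" using \<phi>i T by auto
    have "t \<in> word_ball G S c \<inter> H" "inv\<^bsub>G\<^esub> t \<in> word_ball G S c \<inter> H"
      using t(1) c T subgroup.m_inv_closed[OF H] by auto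
    then show ?thesis using t(2) by blast
  qed
  have *: "foldr (\<otimes>\<^bsub>C\<^esub>) w \<one>\<^bsub>C\<^esub> \<in> \<phi> ` (word_ball G S (c * length w) \<inter> H)"
    if "set w \<subseteq> \<phi> ` T \<union> m_inv C ` \<phi> ` T" for w
    using that
  proof (induction w)
    case Nil
    then show ?case using \<phi>1 one_in_word_ball[of G S] subgroup.one_closed[OF H] by force
  next
    case (Cons a w)
    have "a \<in> \<phi> ` T \<union> m_inv C ` \<phi> ` T" using Cons.prems by simp
    then obtain g where g: "g \<in> word_ball G S c \<inter> H" "a = \<phi> g" using letters by blast
    obtain x where x: "x \<in> word_ball G S (c * length w) \<inter> H" "foldr (\<otimes>\<^bsub>C\<^esub>) w \<one>\<^bsub>C\<^esub> = \<phi> x"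
      using Cons by auto
    have "g \<otimes>\<^bsub>G\<^esub> x \<in> word_ball G S (c * length (a # w)) \<inter> H"
      using word_ball_mult[OF G S, of g c x] g x subgroup.m_closed[OF H, of g x] by auto
    moreover have "foldr (\<otimes>\<^bsub>C\<^esub>) (a # w) \<one>\<^bsub>C\<^esub> = \<phi> (g \<otimes>\<^bsub>G\<^esub> x)" using g x \<phi>m by simp
    ultimately show ?case by blast
  qed
  show ?thesis
  proof
    fix y assume "y \<in> word_ball C (\<phi> ` T) n"
    then obtain w where w: "set w \<subseteq> \<phi> ` T \<union> m_inv C ` \<phi> ` T" "length w \<le> n" "y = foldr (\<otimes>\<^bsub>C\<^esub>) w \<one>\<^bsub>C\<^esub>"
      by (auto simp: word_ball_def)
    have "word_ball G S (c * length w) \<subseteq> word_ball G S (c * n)" using w(2) by (intro word_ball_mono) simp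
    then show "y \<in> \<phi> ` (word_ball G S (c * n) \<inter> H)" using *[OF w(1)] w(3) by blast
  qed
qed

lemma word_ball_subgroup:
  assumes "group G" "subgroup H G" "S \<subseteq> H"
  shows "word_ball (G\<lparr>carrier := H\<rparr>) S n = word_ball G S n"
proof -
  have "m_inv (G\<lparr>carrier := H\<rparr>) ` S = m_inv G ` S"
    using group.m_inv_consistent[OF assms(1,2)] assms(3) by (intro image_cong) auto
  then show ?thesis by (simp add: word_ball_def)
qed

text \<open>The rescaled \<open>root n (b (c * n))\<close> is the \<open>c\<close>-th power of
  \<open>root (c * n) (b (c * n))\<close>, a subsequence of the given one, and so tends to 1;
  \<open>a n \<ge> 1\<close> gives the lower bound.\<close>

lemma subexponential_root:
  fixes a b :: "nat \<Rightarrow> nat"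
  assumes lim: "(\<lambda>n. root n (real (b n))) \<longlonglongrightarrow> 1" and c: "c > 0"
    and le: "\<And>n. a n \<le> b (c * n)" and pos: "\<And>n. a n \<ge> 1"
  shows "(\<lambda>n. root n (real (a n))) \<longlonglongrightarrow> 1"
proof (rule tendsto_sandwich[where f = "\<lambda>_. 1" and h = "\<lambda>n. root n (real (b (c * n)))"])
  have "((\<lambda>n. root n (real (b n))) \<circ> (\<lambda>n. c * n)) \<longlonglongrightarrow> 1"
    using lim by (rule LIMSEQ_subseq_LIMSEQ) (use c in \<open>simp add: strict_mono_def\<close>)
  then have "(\<lambda>n. root (c * n) (real (b (c * n))) ^ c) \<longlonglongrightarrow> 1 ^ c"
    by (intro tendsto_power) (simp add: o_def)
  moreover have "root (c * n) (real (b (c * n))) ^ c = root n (real (b (c * n)))" for n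
    by (simp add: real_root_mult_exp real_root_pow_pos2[OF c] real_root_ge_zero)
  ultimately show "(\<lambda>n. root n (real (b (c * n)))) \<longlonglongrightarrow> 1" by simp
  show "eventually (\<lambda>n. 1 \<le> root n (real (a n))) sequentially"
    using eventually_gt_at_top[of 0] by eventually_elim (use pos in simp)
  show "eventually (\<lambda>n. root n (real (a n)) \<le> root n (real (b (c * n)))) sequentially"
    using eventually_gt_at_top[of 0] by eventually_elim (use le in simp)
qed simp

text \<open>A section of a finitely generated group need not be finitely generated, so it is treated
  through its finitely generated subgroups. Their balls are covered by images of balls of
  \<open>G\<close> whose radius is larger by a constant factor.\<close>

lemma subexponentially_amenable_section:
  fixes G :: "'a monoid" and C :: "nat monoid"
  assumes "subexponentially_amenable G" "section_of C G"
  shows "subexponentially_amenable C"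
  unfolding subexponentially_amenable_def
proof (rule section_closure[OF _ assms(1)[unfolded subexponentially_amenable_def] assms(2)])
  fix G :: "'a monoid" and C :: "nat monoid"
  assume G: "group G" and B: "fg_subexponential_growth G" and sec: "section_of C G"
  then have C: "group C" by (simp add: section_of_def)
  interpret G: group G by fact
  interpret C: group C by fact
  obtain S where S: "finite S" "S \<subseteq> carrier G" "generate G S = carrier G"
    "(\<lambda>n. root n (real (card (word_ball G S n)))) \<longlonglongrightarrow> 1"
    using B by (auto simp: fg_subexponential_growth_def)
  show "amenability_closure fg_subexponential_growth C"
  proof (rule amenability_closure_local[OF C])
    fix F assume F: "finite F" "F \<subseteq> carrier C"
    obtain H \<phi> T where H: "subgroup H G" "\<phi> \<in> hom (G\<lparr>carrier := H\<rparr>) C" "\<phi> ` H = carrier C"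
      and T: "finite T" "T \<subseteq> H" "F = \<phi> ` T"
      by (rule section_of_generate[OF G sec F])
    have TG: "T \<union> m_inv G ` T \<subseteq> generate G S" using T(2) subgroup.subset[OF H(1)] S(3) by auto
    have "\<exists>c. T \<union> m_inv G ` T \<subseteq> word_ball G S c"
    proof -
      have "T \<union> m_inv G ` T \<subseteq> (\<Union>n. word_ball G S n)"
        using TG generate_word_ball[OF G S(2)] by blast
      then show ?thesis
        using finite_subset_chain[of "word_ball G S" "T \<union> m_inv G ` T"] T(1) word_ball_mono[of _ "Suc _" G S]
        by (metis finite_Un finite_imageI le_SucI order_refl)
    qed
    then obtain c' where "T \<union> m_inv G ` T \<subseteq> word_ball G S c'" ..
    \<comment> \<open>The successor makes the factor positive, as \<open>subexponential_root\<close>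
      demands.\<close>
    then have c: "T \<union> m_inv G ` T \<subseteq> word_ball G S (Suc c')" using word_ball_mono[of c' "Suc c'" G S] by auto
    let ?c = "Suc c'" and ?D = "C\<lparr>carrier := generate C F\<rparr>"
    have sF: "subgroup (generate C F) C" by (rule C.generate_is_subgroup[OF F(2)])
    have FF: "F \<subseteq> generate C F" by (auto intro: generate.incl)
    have wb: "word_ball ?D F n = word_ball C F n" for n by (rule word_ball_subgroup[OF C sF FF])
    have card: "card (word_ball C F n) \<le> card (word_ball G S (?c * n))" for n
    proof -
      have "word_ball C F n \<subseteq> \<phi> ` word_ball G S (?c * n)"
        using word_ball_section[OF G H(1) C H(2) S(2) T(2) c] T(3) by blast
      then show ?thesis using surj_card_le[OF word_ball_finite[OF S(1)]] by blast
    qed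
    have "(\<lambda>n. root n (real (card (word_ball C F n)))) \<longlonglongrightarrow> 1"
    proof (rule subexponential_root[OF S(4) _ card])
      show "card (word_ball C F n) \<ge> 1" for n
        using one_in_word_ball[of C F n] word_ball_finite[OF F(1), of C n]
        by (metis One_nat_def Suc_leI card_gt_0_iff empty_iff)
    qed simp
    moreover have "generate ?D F = carrier ?D" using C.generate_consistent[OF FF sF] by simp
    ultimately have "fg_subexponential_growth ?D"
      unfolding fg_subexponential_growth_def using F FF by (intro exI[of _ F]) (simp add: wb)
    then show "amenability_closure fg_subexponential_growth ?D"
      by (intro amenability_closure.base C.subgroup_imp_group[OF sF])
  qed
qed

lemma elementary_amenable_integer: "elementary_amenable integer_group"
  unfolding elementary_amenable_def
  by (rule amenability_closure.base) (simp_all add: abelian_integer_group)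

lemma subexponentially_amenable_integer: "subexponentially_amenable integer_group"
proof -
  interpret Z: group integer_group by simp
  have nat: "int n \<in> generate integer_group {1}" for n
  proof (induction n)
    case 0
    show ?case using generate.one[of integer_group "{1}"] by simp
  next
    case (Suc n)
    then show ?case using generate.eng[OF Suc generate.incl[of 1 "{1}" integer_group]]
      by (simp add: add.commute)
  qed
  have gen: "generate integer_group {1} = carrier integer_group"
  proof -
    have "x \<in> generate integer_group {1}" for x
      using nat[of "nat \<bar>x\<bar>"] Z.generate_m_inv_closed[OF _ nat[of "nat \<bar>x\<bar>"]] by (cases "x \<ge> 0") auto
    then show ?thesis by auto
  qed
  have wb: "word_ball integer_group {1} n \<subseteq> {- int n..int n}" for n
  proof
    fix x assume "x \<in> word_ball integer_group {1} n"
    then obtain w where w: "set w \<subseteq> {1, -1}" "length w \<le> n" "x = foldr (\<otimes>\<^bsub>integer_group\<^esub>) w 0"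
      by (auto simp: word_ball_def)
    have "\<bar>foldr (\<otimes>\<^bsub>integer_group\<^esub>) w 0\<bar> \<le> int (length w)" using w(1)
      by (induction w) auto
    then show "x \<in> {- int n..int n}" using w by auto
  qed
  have "card (word_ball integer_group {1} n) \<le> 2 * n + 1" for n
    using card_mono[OF _ wb[of n]] by simp
  \<comment> \<open>The aim is a bound of the form constant times \<open>n\<close>, since
    \<open>root n 6\<close> and \<open>root n n\<close> both tend to 1; for \<open>n > 0\<close> it
    follows from \<open>3 * Suc n \<le> 6 * n\<close>.\<close>
  then have le: "card (word_ball integer_group {1} n) \<le> 3 * Suc n" for n
    by (rule order_trans) simp
  have pos: "card (word_ball integer_group {1} n) \<ge> 1" for n
    using one_in_word_ball[of integer_group "{1}" n] finite_subset[OF wb[of n]]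
    by (metis One_nat_def Suc_leI card_gt_0_iff empty_iff finite_atLeastAtMost_int)
  have "(\<lambda>n. root n (real (card (word_ball integer_group {1} n)))) \<longlonglongrightarrow> 1"
  proof (rule tendsto_sandwich[where f = "\<lambda>_. 1" and h = "\<lambda>n. root n (real (6 * n))"])
    have "(\<lambda>n. root n 6 * root n (real n)) \<longlonglongrightarrow> 1 * 1"
      by (intro tendsto_mult LIMSEQ_root_const LIMSEQ_root) simp
    then show "(\<lambda>n. root n (real (6 * n))) \<longlonglongrightarrow> 1" by (simp add: real_root_mult)
    show "eventually (\<lambda>n. 1 \<le> root n (real (card (word_ball integer_group {1} n)))) sequentially"
      using eventually_gt_at_top[of 0] by eventually_elim (use pos in simp)
    show "eventually (\<lambda>n. root n (real (card (word_ball integer_group {1} n))) \<le> root n (real (6 * n))) sequentially"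
      using eventually_gt_at_top[of 0]
    proof eventually_elim
      case (elim n)
      have "3 * Suc n \<le> 6 * n" using elim by simp
      then have "card (word_ball integer_group {1} n) \<le> 6 * n" using le[of n] by (rule order_trans[rotated])
      then show ?case using elim by (simp del: of_nat_mult)
    qed
  qed simp
  then have "fg_subexponential_growth integer_group"
    unfolding fg_subexponential_growth_def using gen by (intro exI[of _ "{1}"]) auto
  then show ?thesis unfolding subexponentially_amenable_def by (intro amenability_closure.base) simp_all
qed

subsection \<open>Finitely additive integration\<close>

locale fin_add =
  fixes V :: "'x set" and mu :: "'x set \<Rightarrow> real"
  assumes nonneg: "A \<subseteq> V \<Longrightarrow> 0 \<le> mu A"
    and total: "mu V = 1"
    and add: "A \<subseteq> V \<Longrightarrow> B \<subseteq> V \<Longrightarrow> A \<inter> B = {} \<Longrightarrow> mu (A \<union> B) = mu A + mu B"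
begin

lemma empty: "mu {} = 0"
  using add[of "{}" "{}"] by simp

lemma le_one: "A \<subseteq> V \<Longrightarrow> mu A \<le> 1"
  using add[of A "V - A"] nonneg[of "V - A"] total by (simp add: Un_absorb1)

lemma UN_finite:
  assumes "finite I" "\<And>i. i \<in> I \<Longrightarrow> A i \<subseteq> V" "\<And>i j. i \<in> I \<Longrightarrow> j \<in> I \<Longrightarrow> i \<noteq> j \<Longrightarrow> A i \<inter> A j = {}"
  shows "mu (\<Union>i\<in>I. A i) = (\<Sum>i\<in>I. mu (A i))"
  using assms
proof (induction I)
  case empty then show ?case by (simp add: fin_add.empty[OF fin_add_axioms])
next
  case (insert i I)
  have "A i \<inter> (\<Union>i\<in>I. A i) = {}"
  proof -
    have "A i \<inter> A j = {}" if "j \<in> I" for j using insert.prems(2)[of i j] insert.hyps(2) that by auto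
    then show ?thesis by auto
  qed
  moreover have "A i \<subseteq> V" "(\<Union>i\<in>I. A i) \<subseteq> V" using insert.prems(1) by auto
  ultimately have "mu (A i \<union> (\<Union>i\<in>I. A i)) = mu (A i) + mu (\<Union>i\<in>I. A i)" by (intro add)
  also have "mu (\<Union>i\<in>I. A i) = (\<Sum>i\<in>I. mu (A i))" using insert.prems by (intro insert.IH) auto
  finally show ?case using insert.hyps by simp
qed

definition simple_int :: "('x \<Rightarrow> real) \<Rightarrow> real" where
  "simple_int s = (\<Sum>v\<in>s ` V. v * mu {x\<in>V. s x = v})"

text \<open>The sum may be grouped by any finite-valued \<open>r\<close> through which
  \<open>s\<close> factors. With \<open>r\<close> the pair of two simple functions, additivity and
  monotonicity become termwise statements.\<close>

lemma simple_int_refine: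
  assumes "finite R" "\<And>x. x \<in> V \<Longrightarrow> r x \<in> R" "\<And>x. x \<in> V \<Longrightarrow> s x = \<sigma> (r x)"
  shows "simple_int s = (\<Sum>z\<in>R. \<sigma> z * mu {x\<in>V. r x = z})"
proof -
  have sub: "s ` V \<subseteq> \<sigma> ` R" using assms by auto
  have ex: "{x\<in>V. s x = v} = (\<Union>z\<in>{z\<in>R. \<sigma> z = v}. {x\<in>V. r x = z})" for v
    using assms by auto
  have v: "mu {x\<in>V. s x = v} = (\<Sum>z\<in>{z\<in>R. \<sigma> z = v}. mu {x\<in>V. r x = z})" for v
    unfolding ex by (rule UN_finite) (use assms in auto)
  have "simple_int s = (\<Sum>v\<in>\<sigma> ` R. v * mu {x\<in>V. s x = v})"
    unfolding simple_int_def
  proof (rule sum.mono_neutral_left)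
    show "\<forall>i\<in>\<sigma> ` R - s ` V. i * mu {x \<in> V. s x = i} = 0"
    proof
      fix i assume "i \<in> \<sigma> ` R - s ` V"
      then have "{x \<in> V. s x = i} = {}" by (blast intro: rev_image_eqI)
      then show "i * mu {x \<in> V. s x = i} = 0" by (simp only: empty mult_zero_right)
    qed
  qed (use assms sub in auto)
  also have "\<dots> = (\<Sum>v\<in>\<sigma> ` R. \<Sum>z\<in>{z\<in>R. \<sigma> z = v}. \<sigma> z * mu {x\<in>V. r x = z})"
    by (intro sum.cong) (auto simp: v sum_distrib_left)
  also have "\<dots> = (\<Sum>z\<in>R. \<sigma> z * mu {x\<in>V. r x = z})"
    by (rule sum.group) (use assms in auto)
  finally show ?thesis .
qed

lemma simple_int_add:
  assumes "finite (s ` V)" "finite (t ` V)"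
  shows "simple_int (\<lambda>x. s x + t x) = simple_int s + simple_int t"
proof -
  let ?R = "s ` V \<times> t ` V" and ?r = "\<lambda>x. (s x, t x)"
  have "simple_int (\<lambda>x. s x + t x) = (\<Sum>z\<in>?R. (fst z + snd z) * mu {x\<in>V. ?r x = z})"
    by (rule simple_int_refine) (use assms in auto)
  moreover have "simple_int s = (\<Sum>z\<in>?R. fst z * mu {x\<in>V. ?r x = z})"
    by (rule simple_int_refine) (use assms in auto)
  moreover have "simple_int t = (\<Sum>z\<in>?R. snd z * mu {x\<in>V. ?r x = z})"
    by (rule simple_int_refine) (use assms in auto)
  ultimately show ?thesis by (simp add: sum.distrib distrib_right)
qed

lemma simple_int_mono:
  assumes "finite (s ` V)" "finite (t ` V)" "\<And>x. x \<in> V \<Longrightarrow> s x \<le> t x"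
  shows "simple_int s \<le> simple_int t"
proof -
  let ?R = "s ` V \<times> t ` V" and ?r = "\<lambda>x. (s x, t x)"
  have "simple_int s = (\<Sum>z\<in>?R. fst z * mu {x\<in>V. ?r x = z})"
    by (rule simple_int_refine) (use assms in auto)
  moreover have "simple_int t = (\<Sum>z\<in>?R. snd z * mu {x\<in>V. ?r x = z})"
    by (rule simple_int_refine) (use assms in auto)
  moreover have "fst z * mu {x\<in>V. ?r x = z} \<le> snd z * mu {x\<in>V. ?r x = z}" for z
  proof (cases "{x\<in>V. ?r x = z} = {}")
    case False
    then have "fst z \<le> snd z" using assms(3) by auto
    then show ?thesis by (intro mult_right_mono nonneg) auto
  qed (simp only: empty)
  ultimately show ?thesis by (simp add: sum_mono)
qed

lemma simple_int_const: "simple_int (\<lambda>_. c) = c"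
proof -
  have "simple_int (\<lambda>_. c) = (\<Sum>z\<in>{c}. z * mu {x\<in>V. c = z})"
    by (rule simple_int_refine[where r = "\<lambda>_. c"]) auto
  then show ?thesis by (simp add: total)
qed

text \<open>A lower integral. On functions with values in the unit interval it is additive although
  \<open>mu\<close> is only finitely additive, since such functions are uniform limits of simple
  ones.\<close>

definition lint :: "('x \<Rightarrow> real) \<Rightarrow> real" where
  "lint f = Sup {simple_int s |s. finite (s ` V) \<and> (\<forall>x\<in>V. s x \<le> f x)}"

lemma lint_upper:
  assumes "finite (s ` V)" "\<And>x. x \<in> V \<Longrightarrow> s x \<le> f x" "\<And>x. x \<in> V \<Longrightarrow> f x \<le> 1"
  shows "simple_int s \<le> lint f"
  unfolding lint_def
proof (rule cSup_upper)
  show "bdd_above {simple_int s |s. finite (s ` V) \<and> (\<forall>x\<in>V. s x \<le> f x)}"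
  proof (rule bdd_aboveI[of _ 1], clarsimp)
    fix s assume s: "finite (s ` V)" "\<forall>x\<in>V. s x \<le> f x"
    have "simple_int s \<le> simple_int (\<lambda>_. 1)"
      by (rule simple_int_mono) (use s assms(3) in \<open>auto intro: order_trans finite_subset[of _ "{1}"]\<close>)
    then show "simple_int s \<le> 1" by (simp add: simple_int_const)
  qed
qed (use assms in auto)

lemma lint_least:
  assumes "\<And>x. x \<in> V \<Longrightarrow> 0 \<le> f x"
    and "\<And>s. finite (s ` V) \<Longrightarrow> (\<And>x. x \<in> V \<Longrightarrow> s x \<le> f x) \<Longrightarrow> simple_int s \<le> c"
  shows "lint f \<le> c"
  unfolding lint_def
proof (rule cSup_least)
  have "finite ((\<lambda>_. 0::real) ` V)" by (auto intro: finite_subset[of _ "{0}"])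
  then show "{simple_int s |s. finite (s ` V) \<and> (\<forall>x\<in>V. s x \<le> f x)} \<noteq> {}" using assms(1) by auto
qed (use assms(2) in auto)

lemma lint_const: "0 \<le> c \<Longrightarrow> c \<le> 1 \<Longrightarrow> lint (\<lambda>_. c) = c"
proof (rule antisym)
  assume c: "0 \<le> c" "c \<le> 1"
  have f: "finite ((\<lambda>_. c) ` V)" by (auto intro: finite_subset[of _ "{c}"])
  show "lint (\<lambda>_. c) \<le> c"
    using c simple_int_mono[OF _ f] by (intro lint_least) (auto simp: simple_int_const)
  show "c \<le> lint (\<lambda>_. c)" using lint_upper[OF f, of "\<lambda>_. c"] c by (simp add: simple_int_const)
qed

lemma lint_nonneg:
  assumes "\<And>x. x \<in> V \<Longrightarrow> 0 \<le> f x" "\<And>x. x \<in> V \<Longrightarrow> f x \<le> 1"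
  shows "0 \<le> lint f"
  using lint_upper[of "\<lambda>_. 0" f] assms
  by (auto simp: simple_int_const intro: finite_subset[of _ "{0}"])

text \<open>Sums of simple functions below \<open>f\<close> and \<open>g\<close> give one
  inequality. For the other, \<open>f\<close> and \<open>g\<close> are rounded down to multiples of
  \<open>1 / n\<close>, which costs at most \<open>2 / n\<close> in total, and \<open>n\<close>
  tends to infinity.\<close>

lemma lint_add:
  assumes f: "\<And>x. x \<in> V \<Longrightarrow> 0 \<le> f x" and g: "\<And>x. x \<in> V \<Longrightarrow> 0 \<le> g x"
    and fg: "\<And>x. x \<in> V \<Longrightarrow> f x + g x \<le> 1"
  shows "lint (\<lambda>x. f x + g x) = lint f + lint g"
proof (rule antisym)
  have f1: "f x \<le> 1" if "x \<in> V" for x using fg[OF that] g[OF that] by simp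
  have g1: "g x \<le> 1" if "x \<in> V" for x using fg[OF that] f[OF that] by simp
  have "lint g \<le> lint (\<lambda>x. f x + g x) - lint f"
  proof (rule lint_least[OF g])
    fix t assume t: "finite (t ` V)" "\<And>x. x \<in> V \<Longrightarrow> t x \<le> g x"
    have "lint f \<le> lint (\<lambda>x. f x + g x) - simple_int t"
    proof (rule lint_least[OF f])
      fix s assume s: "finite (s ` V)" "\<And>x. x \<in> V \<Longrightarrow> s x \<le> f x"
      have "finite ((\<lambda>x. s x + t x) ` V)"
        by (rule finite_subset[OF _ finite_imageI[OF finite_cartesian_product[OF s(1) t(1)], of "\<lambda>(a,b). a + b"]]) auto
      then have "simple_int (\<lambda>x. s x + t x) \<le> lint (\<lambda>x. f x + g x)"
        by (rule lint_upper) (use s t fg in \<open>auto intro: add_mono\<close>)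
      then show "simple_int s \<le> lint (\<lambda>x. f x + g x) - simple_int t"
        using simple_int_add[OF s(1) t(1)] by simp
    qed
    then show "simple_int t \<le> lint (\<lambda>x. f x + g x) - lint f" by simp
  qed
  then show "lint f + lint g \<le> lint (\<lambda>x. f x + g x)" by simp
  \<comment> \<open>Rounding down leaves finitely many values because \<open>h\<close> lies between
    0 and 1.\<close>
  have fin: "finite ((\<lambda>x. real_of_int \<lfloor>real n * h x\<rfloor> / real n) ` V)"
    if h: "\<And>x. x \<in> V \<Longrightarrow> 0 \<le> h x" "\<And>x. x \<in> V \<Longrightarrow> h x \<le> 1" for h :: "'x \<Rightarrow> real" and n :: nat
  proof (rule finite_subset)
    show "(\<lambda>x. real_of_int \<lfloor>real n * h x\<rfloor> / real n) ` V \<subseteq> (\<lambda>k. real_of_int k / real n) ` {0..int n}"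
    proof (clarsimp)
      fix x assume "x \<in> V"
      then have "0 \<le> real n * h x" "real n * h x \<le> real n * 1" using h by (auto simp only: intro!: mult_left_mono mult_nonneg_nonneg of_nat_0_le_iff)
      then have "\<lfloor>real n * h x\<rfloor> \<in> {0..int n}" by (simp add: floor_le_iff)
      then show "real_of_int \<lfloor>real n * h x\<rfloor> / real n \<in> (\<lambda>k. real_of_int k / real n) ` {0..int n}" by blast
    qed
  qed simp
  have approx: "real_of_int \<lfloor>real n * y\<rfloor> / real n \<le> y" "y \<le> real_of_int \<lfloor>real n * y\<rfloor> / real n + 1 / real n"
    if "n > 0" for y :: real and n :: nat
  proof -
    have "real_of_int \<lfloor>real n * y\<rfloor> \<le> real n * y" "real n * y \<le> real_of_int \<lfloor>real n * y\<rfloor> + 1" by linarith+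
    then show "real_of_int \<lfloor>real n * y\<rfloor> / real n \<le> y" "y \<le> real_of_int \<lfloor>real n * y\<rfloor> / real n + 1 / real n"
      using that by (simp_all add: field_simps)
  qed
  have "lint (\<lambda>x. f x + g x) \<le> lint f + lint g + 2 / real (Suc m)" for m
  proof (rule lint_least)
    show "0 \<le> f x + g x" if "x \<in> V" for x using f g that by auto
    fix s assume s: "finite (s ` V)" "\<And>x. x \<in> V \<Longrightarrow> s x \<le> f x + g x"
    define n where "n = Suc m"
    have n: "n > 0" by (simp add: n_def)
    let ?f = "\<lambda>x. real_of_int \<lfloor>real n * f x\<rfloor> / real n" and ?g = "\<lambda>x. real_of_int \<lfloor>real n * g x\<rfloor> / real n"
    let ?c = "\<lambda>x::'x. 2 / real n"
    have ff: "finite (?f ` V)" by (rule fin) (use f f1 in auto)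
    have fg': "finite (?g ` V)" by (rule fin) (use g g1 in auto)
    have fc: "finite (?c ` V)" by (auto intro: finite_subset[of _ "{2 / real n}"])
    have ffg: "finite ((\<lambda>x. ?f x + ?g x) ` V)"
      by (rule finite_subset[OF _ finite_imageI[OF finite_cartesian_product[OF ff fg'], of "\<lambda>(a,b). a + b"]]) auto
    have ffgc: "finite ((\<lambda>x. ?f x + ?g x + ?c x) ` V)"
      by (rule finite_subset[OF _ finite_imageI[OF finite_cartesian_product[OF ffg fc], of "\<lambda>(a,b). a + b"]]) auto
    have "simple_int s \<le> simple_int (\<lambda>x. ?f x + ?g x + ?c x)"
    proof (rule simple_int_mono[OF s(1) ffgc])
      fix x assume x: "x \<in> V"
      have "2 / real n = 1 / real n + 1 / real n" by simp
      then show "s x \<le> ?f x + ?g x + ?c x"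
        using s(2)[OF x] approx(2)[OF n, of "f x"] approx(2)[OF n, of "g x"] by linarith
    qed
    also have "\<dots> = simple_int ?f + simple_int ?g + 2 / real n"
      using simple_int_add[OF ffg fc] simple_int_add[OF ff fg'] by (simp add: simple_int_const)
    also have "\<dots> \<le> lint f + lint g + 2 / real n"
      using lint_upper[OF ff, of f] lint_upper[OF fg', of g] approx(1)[OF n] f1 g1 by (simp add: add_mono)
    finally show "simple_int s \<le> lint f + lint g + 2 / real (Suc m)" by (simp add: n_def)
  qed
  moreover have "(\<lambda>m. lint f + lint g + 2 / real (Suc m)) \<longlonglongrightarrow> lint f + lint g + 0"
    by (intro tendsto_add tendsto_const LIMSEQ_Suc[OF lim_const_over_n])
  ultimately show "lint (\<lambda>x. f x + g x) \<le> lint f + lint g"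
    using LIMSEQ_le_const[of "\<lambda>m. lint f + lint g + 2 / real (Suc m)"] by auto
qed

lemma simple_int_perm:
  assumes "bij_betw \<tau> V V" "\<And>A. A \<subseteq> V \<Longrightarrow> mu (\<tau> ` A) = mu A"
  shows "simple_int (\<lambda>x. s (\<tau> x)) = simple_int s"
proof -
  have im: "\<tau> ` V = V" using assms(1) by (simp add: bij_betw_def)
  have "(\<lambda>x. s (\<tau> x)) ` V = s ` V" using im by (metis image_image)
  moreover have "mu {x\<in>V. s (\<tau> x) = v} = mu {x\<in>V. s x = v}" for v
  proof -
    have "{x\<in>V. s x = v} = \<tau> ` {x\<in>V. s (\<tau> x) = v}" using im by auto
    then show ?thesis using assms(2)[of "{x\<in>V. s (\<tau> x) = v}"] by simp
  qed
  ultimately show ?thesis by (simp add: simple_int_def)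
qed

text \<open>Substitution turns simple functions below \<open>f\<close> into simple functions below
  the permuted \<open>f\<close>; the converse uses the inverse permutation
  \<open>\<rho>\<close>.\<close>

lemma lint_perm:
  assumes t: "bij_betw \<tau> V V" "\<And>A. A \<subseteq> V \<Longrightarrow> mu (\<tau> ` A) = mu A"
    and f: "\<And>x. x \<in> V \<Longrightarrow> 0 \<le> f x" "\<And>x. x \<in> V \<Longrightarrow> f x \<le> 1"
  shows "lint (\<lambda>x. f (\<tau> x)) = lint f"
proof (rule antisym)
  have im: "\<tau> x \<in> V" if "x \<in> V" for x using t(1) that by (auto simp: bij_betw_def)
  show "lint f \<le> lint (\<lambda>x. f (\<tau> x))"
  proof (rule lint_least[OF f(1)])
    fix s assume s: "finite (s ` V)" "\<And>x. x \<in> V \<Longrightarrow> s x \<le> f x"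
    have "finite ((\<lambda>x. s (\<tau> x)) ` V)" by (rule finite_subset[OF _ s(1)]) (use im in auto)
    then have "simple_int (\<lambda>x. s (\<tau> x)) \<le> lint (\<lambda>x. f (\<tau> x))" by (rule lint_upper) (use im s f in auto)
    then show "simple_int s \<le> lint (\<lambda>x. f (\<tau> x))" by (simp add: simple_int_perm[OF t])
  qed
  define \<rho> where "\<rho> = inv_into V \<tau>"
  have r: "\<rho> x \<in> V" "\<tau> (\<rho> x) = x" if "x \<in> V" for x
    using t(1) that by (auto simp: bij_betw_def \<rho>_def inv_into_into f_inv_into_f)
  have r2: "\<rho> (\<tau> x) = x" if "x \<in> V" for x
    using t(1) that by (auto simp: bij_betw_def \<rho>_def)
  show "lint (\<lambda>x. f (\<tau> x)) \<le> lint f"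
  proof (rule lint_least)
    fix s assume s: "finite (s ` V)" "\<And>x. x \<in> V \<Longrightarrow> s x \<le> f (\<tau> x)"
    have fin: "finite ((\<lambda>x. s (\<rho> x)) ` V)" by (rule finite_subset[OF _ s(1)]) (use r in auto)
    have "simple_int (\<lambda>x. s (\<rho> x)) \<le> lint f"
      by (rule lint_upper[OF fin]) (use r s(2) f in force)+
    moreover have "simple_int s = simple_int (\<lambda>x. s (\<rho> (\<tau> x)))"
    proof -
      have "s ` V = (\<lambda>x. s (\<rho> (\<tau> x))) ` V" using r2 by auto
      moreover have "{x\<in>V. s x = v} = {x\<in>V. s (\<rho> (\<tau> x)) = v}" for v using r2 by auto
      ultimately show ?thesis by (simp add: simple_int_def)
    qed
    ultimately show "simple_int s \<le> lint f" using simple_int_perm[OF t, of "\<lambda>x. s (\<rho> x)"] by simp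
  qed (use im f in auto)
qed

end


subsection \<open>Amenable groups\<close>

lemma amenable_iff:
  "amenable G \<longleftrightarrow> (\<exists>mu. fin_add (carrier G) mu \<and>
     (\<forall>g\<in>carrier G. \<forall>A. A \<subseteq> carrier G \<longrightarrow> mu ((\<lambda>x. g \<otimes>\<^bsub>G\<^esub> x) ` A) = mu A))"
  unfolding amenable_def fin_add_def l_coset_def
  by (simp only: UNION_singleton_eq_range conj_assoc)

text \<open>The mean of \<open>G\<close> is pushed forward along \<open>f\<close>. Since
  \<open>f\<close> turns left translation by \<open>h c\<close> into left translation by
  \<open>c\<close>, the preimage of a translated set is a translated preimage.\<close>

lemma amenable_equivariant:
  fixes C :: "'c monoid"
  assumes "group C" "group G" "h \<in> hom C G" "amenable G"
    and f: "f ` carrier G \<subseteq> carrier C"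
    and eq: "\<And>c x. c \<in> carrier C \<Longrightarrow> x \<in> carrier G \<Longrightarrow> f (h c \<otimes>\<^bsub>G\<^esub> x) = c \<otimes>\<^bsub>C\<^esub> f x"
  shows "amenable C"
proof -
  interpret group_hom C G h by (intro group_homI assms)
  obtain mu where "fin_add (carrier G) mu"
    and inv: "\<And>g A. g \<in> carrier G \<Longrightarrow> A \<subseteq> carrier G \<Longrightarrow> mu ((\<lambda>x. g \<otimes>\<^bsub>G\<^esub> x) ` A) = mu A"
    using assms(4) unfolding amenable_iff by blast
  interpret fin_add "carrier G" mu by fact
  define m where "m A = mu {x\<in>carrier G. f x \<in> A}" for A
  have "fin_add (carrier C) m"
  proof
    show "0 \<le> m A" for A unfolding m_def by (rule nonneg) auto
    have "{x\<in>carrier G. f x \<in> carrier C} = carrier G" using f by auto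
    then show "m (carrier C) = 1" by (simp add: m_def total)
    fix A B :: "'c set" assume "A \<inter> B = {}"
    then have "mu ({x\<in>carrier G. f x \<in> A} \<union> {x\<in>carrier G. f x \<in> B}) = m A + m B"
      unfolding m_def by (intro add) auto
    moreover have "{x\<in>carrier G. f x \<in> A} \<union> {x\<in>carrier G. f x \<in> B} = {x\<in>carrier G. f x \<in> A \<union> B}"
      by auto
    ultimately show "m (A \<union> B) = m A + m B" by (simp add: m_def)
  qed
  moreover have "m ((\<lambda>x. g \<otimes>\<^bsub>C\<^esub> x) ` A) = m A" if g: "g \<in> carrier C" and A: "A \<subseteq> carrier C" for g A
  proof -
    have "{x\<in>carrier G. f x \<in> (\<lambda>x. g \<otimes>\<^bsub>C\<^esub> x) ` A} = (\<lambda>x. h g \<otimes>\<^bsub>G\<^esub> x) ` {x\<in>carrier G. f x \<in> A}"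
    proof (intro equalityI subsetI)
      fix x assume "x \<in> {x\<in>carrier G. f x \<in> (\<lambda>x. g \<otimes>\<^bsub>C\<^esub> x) ` A}"
      then obtain a where x: "x \<in> carrier G" "a \<in> A" "f x = g \<otimes>\<^bsub>C\<^esub> a" by auto
      let ?y = "h (inv\<^bsub>C\<^esub> g) \<otimes>\<^bsub>G\<^esub> x"
      have "f ?y = inv\<^bsub>C\<^esub> g \<otimes>\<^bsub>C\<^esub> (g \<otimes>\<^bsub>C\<^esub> a)" using eq[of "inv\<^bsub>C\<^esub> g" x] x g by simp
      also have "\<dots> = a" using g x A by (simp add: G.m_assoc[symmetric] subset_iff)
      finally have "f ?y \<in> A" using x by simp
      moreover have "h g \<otimes>\<^bsub>G\<^esub> ?y = x" using g x(1) by (simp add: m_assoc[symmetric])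
      moreover have "?y \<in> carrier G" using g x(1) by simp
      ultimately show "x \<in> (\<lambda>x. h g \<otimes>\<^bsub>G\<^esub> x) ` {x\<in>carrier G. f x \<in> A}"
        by (intro image_eqI[of _ _ ?y]) auto
    qed (use g eq in auto)
    then show ?thesis unfolding m_def using inv[of "h g" "{x\<in>carrier G. f x \<in> A}"] g by simp
  qed
  ultimately show ?thesis unfolding amenable_iff by blast
qed

text \<open>The image \<open>K\<close> of \<open>C\<close> acts freely on \<open>G\<close> by left
  multiplication, with the right cosets as orbits. A point \<open>rep x\<close> chosen in every
  orbit writes \<open>x\<close> as an element of \<open>K\<close> times \<open>rep x\<close>;
  reading off the first factor is an equivariant map to \<open>C\<close>.\<close>

lemma amenable_mon:
  assumes "group C" "group G" "h \<in> mon C G" "amenable G"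
  shows "amenable C"
proof -
  have h: "h \<in> hom C G" and inj: "inj_on h (carrier C)" using assms(3) by (auto simp: mon_def)
  interpret group_hom C G h by (intro group_homI assms h)
  define K where "K = h ` carrier C"
  have K: "subgroup K G" unfolding K_def by (rule img_is_subgroup)
  \<comment> \<open>The choice is made from the coset and not from \<open>x\<close>, which is what
    makes \<open>f\<close> equivariant.\<close>
  define rep where "rep x = (SOME y. y \<in> K #>\<^bsub>G\<^esub> x)" for x
  have rep: "rep x \<in> K #>\<^bsub>G\<^esub> x" if "x \<in> carrier G" for x
    unfolding rep_def by (rule someI[of _ x]) (rule H.rcos_self[OF that K])
  have repc: "rep x \<in> carrier G" if "x \<in> carrier G" for x
    using rep[OF that] H.r_coset_subset_G[OF subgroup.subset[OF K] that] by blast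
  have in_K: "x \<otimes>\<^bsub>G\<^esub> inv\<^bsub>G\<^esub> rep x \<in> K" if x: "x \<in> carrier G" for x
  proof -
    obtain k where k: "k \<in> K" "rep x = k \<otimes>\<^bsub>G\<^esub> x" using rep[OF x] by (auto simp: r_coset_def)
    have kc: "k \<in> carrier G" using subgroup.mem_carrier[OF K k(1)] .
    have "x \<otimes>\<^bsub>G\<^esub> inv\<^bsub>G\<^esub> rep x = inv\<^bsub>G\<^esub> k"
      using kc x by (simp add: k(2) H.inv_mult_group H.m_assoc[symmetric])
    then show ?thesis using subgroup.m_inv_closed[OF K k(1)] by simp
  qed
  define f where "f x = inv_into (carrier C) h (x \<otimes>\<^bsub>G\<^esub> inv\<^bsub>G\<^esub> rep x)" for x
  have f: "f x \<in> carrier C" "h (f x) = x \<otimes>\<^bsub>G\<^esub> inv\<^bsub>G\<^esub> rep x" if "x \<in> carrier G" for x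
    using in_K[OF that] unfolding f_def K_def by (auto intro: inv_into_into f_inv_into_f)
  show ?thesis
  proof (rule amenable_equivariant[OF assms(1,2) h assms(4)])
    show "f ` carrier G \<subseteq> carrier C" using f(1) by auto
    fix c x assume c: "c \<in> carrier C" and x: "x \<in> carrier G"
    have "h c \<in> K" using c by (simp add: K_def)
    then have "h c \<otimes>\<^bsub>G\<^esub> x \<in> K #>\<^bsub>G\<^esub> x" by (auto simp: r_coset_def)
    then have "K #>\<^bsub>G\<^esub> x = K #>\<^bsub>G\<^esub> (h c \<otimes>\<^bsub>G\<^esub> x)" using H.repr_independence[OF _ x K] by simp
    then have r: "rep (h c \<otimes>\<^bsub>G\<^esub> x) = rep x" by (simp add: rep_def)
    have "h (f (h c \<otimes>\<^bsub>G\<^esub> x)) = h (c \<otimes>\<^bsub>C\<^esub> f x)"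
      using f c x r repc by (simp add: H.m_assoc)
    then show "f (h c \<otimes>\<^bsub>G\<^esub> x) = c \<otimes>\<^bsub>C\<^esub> f x"
      using inj_onD[OF inj] f c x by simp
  qed
qed

text \<open>The mean of \<open>A\<close> is the integral over \<open>q\<close> in \<open>Q\<close>
  of the proportion that \<open>A\<close> takes of the fibre over \<open>q\<close>, measured by
  moving this fibre to the kernel. By invariance of \<open>mu\<close> it does not matter which point
  of the fibre is used for moving.\<close>

lemma amenable_ext_surj:
  fixes C :: "'c monoid"
  assumes "group C" "group Q" "\<phi> \<in> hom C Q" "\<phi> ` carrier C = carrier Q" "amenable Q"
    and k: "amenable (C\<lparr>carrier := kernel C Q \<phi>\<rparr>)"
  shows "amenable C"
proof -
  interpret group_hom C Q \<phi> by (intro group_homI assms)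
  let ?N = "kernel C Q \<phi>"
  obtain mu where "fin_add ?N mu"
    and mu: "\<And>g A. g \<in> ?N \<Longrightarrow> A \<subseteq> ?N \<Longrightarrow> mu ((\<lambda>x. g \<otimes>\<^bsub>C\<^esub> x) ` A) = mu A"
    using k unfolding amenable_iff by auto
  interpret N: fin_add ?N mu by fact
  obtain nu where "fin_add (carrier Q) nu"
    and nu: "\<And>g A. g \<in> carrier Q \<Longrightarrow> A \<subseteq> carrier Q \<Longrightarrow> nu ((\<lambda>x. g \<otimes>\<^bsub>Q\<^esub> x) ` A) = nu A"
    using assms(5) unfolding amenable_iff by auto
  interpret Q: fin_add "carrier Q" nu by fact
  define s where "s = inv_into (carrier C) \<phi>"
  have s: "s q \<in> carrier C" "\<phi> (s q) = q" if "q \<in> carrier Q" for q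
    using that assms(4) by (auto simp: s_def inv_into_into f_inv_into_f)
  define E where "E A x = {n\<in>?N. x \<otimes>\<^bsub>C\<^esub> n \<in> A}" for A x
  have Ec: "E A x \<subseteq> ?N" for A x by (auto simp: E_def)
  \<comment> \<open>For \<open>x\<close> and \<open>y\<close> over the same point,
    \<open>E A y\<close> is the left translate of \<open>E A x\<close> by the kernel element
    \<open>inv y \<otimes> x\<close>.\<close>
  have indep: "mu (E A x) = mu (E A y)" if xy: "x \<in> carrier C" "y \<in> carrier C" "\<phi> x = \<phi> y" for A x y
  proof -
    let ?g = "inv\<^bsub>C\<^esub> y \<otimes>\<^bsub>C\<^esub> x"
    have g: "?g \<in> ?N" using xy by (simp add: kernel_def)
    have gi: "inv\<^bsub>C\<^esub> ?g \<in> ?N" using subgroup.m_inv_closed[OF subgroup_kernel g] .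
    have yg: "y \<otimes>\<^bsub>C\<^esub> (?g \<otimes>\<^bsub>C\<^esub> n) = x \<otimes>\<^bsub>C\<^esub> n" if "n \<in> carrier C" for n
      using xy that by (simp add: G.m_assoc[symmetric])
    have "E A y = (\<lambda>n. ?g \<otimes>\<^bsub>C\<^esub> n) ` E A x"
    proof (intro equalityI subsetI)
      fix n assume n: "n \<in> E A y"
      then have nN: "n \<in> ?N" "n \<in> carrier C" by (auto simp: E_def kernel_def)
      have m: "inv\<^bsub>C\<^esub> ?g \<otimes>\<^bsub>C\<^esub> n \<in> ?N" using subgroup.m_closed[OF subgroup_kernel gi nN(1)] .
      have gm: "?g \<otimes>\<^bsub>C\<^esub> (inv\<^bsub>C\<^esub> ?g \<otimes>\<^bsub>C\<^esub> n) = n"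
        using nN(2) xy by (simp add: G.m_assoc[symmetric])
      have "inv\<^bsub>C\<^esub> ?g \<otimes>\<^bsub>C\<^esub> n \<in> E A x"
        using n m yg[of "inv\<^bsub>C\<^esub> ?g \<otimes>\<^bsub>C\<^esub> n"] gm by (auto simp: E_def kernel_def)
      then show "n \<in> (\<lambda>n. ?g \<otimes>\<^bsub>C\<^esub> n) ` E A x" using gm by (metis image_eqI)
    next
      fix n' assume "n' \<in> (\<lambda>n. ?g \<otimes>\<^bsub>C\<^esub> n) ` E A x"
      then obtain n where n: "n' = ?g \<otimes>\<^bsub>C\<^esub> n" "n \<in> ?N" "x \<otimes>\<^bsub>C\<^esub> n \<in> A" by (auto simp: E_def)
      have "n \<in> carrier C" using n(2) by (simp add: kernel_def)
      then show "n' \<in> E A y"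
        using n yg[of n] subgroup.m_closed[OF subgroup_kernel g n(2)] by (simp add: E_def)
    qed
    then show ?thesis using mu[OF g Ec[of A x]] by simp
  qed
  define m where "m A = Q.lint (\<lambda>q. mu (E A (s q)))" for A
  have bd: "0 \<le> mu (E A x)" "mu (E A x) \<le> 1" for A x using N.nonneg[OF Ec] N.le_one[OF Ec] by auto
  have "fin_add (carrier C) m"
  proof
    show "0 \<le> m A" for A unfolding m_def by (rule Q.lint_nonneg) (rule bd)+
    have "mu (E (carrier C) (s q)) = 1" if "q \<in> carrier Q" for q
    proof -
      have "E (carrier C) (s q) = ?N" using s[OF that] by (auto simp: E_def kernel_def)
      then show ?thesis by (simp add: N.total)
    qed
    then have "m (carrier C) = Q.lint (\<lambda>_. 1)"
      unfolding m_def Q.lint_def by (simp cong: conj_cong)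
    then show "m (carrier C) = 1" by (simp add: Q.lint_const)
    fix A B :: "'c set" assume AB: "A \<inter> B = {}"
    have e: "mu (E (A \<union> B) x) = mu (E A x) + mu (E B x)" for x
    proof -
      have "E (A \<union> B) x = E A x \<union> E B x" by (auto simp: E_def)
      then show ?thesis using N.add[OF Ec[of A x] Ec[of B x]] AB by (auto simp: E_def)
    qed
    show "m (A \<union> B) = m A + m B"
      unfolding m_def e by (rule Q.lint_add) (use bd e[symmetric] in simp_all)
  qed
  moreover have "m ((\<lambda>x. g \<otimes>\<^bsub>C\<^esub> x) ` A) = m A" if g: "g \<in> carrier C" and A: "A \<subseteq> carrier C" for g A
  proof -
    \<comment> \<open>Translating \<open>A\<close> by \<open>g\<close> permutes the fibres: the
      fibre over \<open>q\<close> now shows what the fibre over \<open>?t q\<close> showed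
      before.\<close>
    let ?t = "\<lambda>q. \<phi> (inv\<^bsub>C\<^esub> g) \<otimes>\<^bsub>Q\<^esub> q"
    have pg: "\<phi> (inv\<^bsub>C\<^esub> g) \<in> carrier Q" using g by simp
    have t: "bij_betw ?t (carrier Q) (carrier Q)"
      by (rule bij_betw_byWitness[where f' = "\<lambda>q. \<phi> g \<otimes>\<^bsub>Q\<^esub> q"])
        (use g in \<open>auto simp: H.m_assoc[symmetric]\<close>)
    have "mu (E ((\<lambda>x. g \<otimes>\<^bsub>C\<^esub> x) ` A) (s q)) = mu (E A (s (?t q)))" if q: "q \<in> carrier Q" for q
    proof -
      have "E ((\<lambda>x. g \<otimes>\<^bsub>C\<^esub> x) ` A) (s q) = E A (inv\<^bsub>C\<^esub> g \<otimes>\<^bsub>C\<^esub> s q)"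
      proof -
        have "s q \<otimes>\<^bsub>C\<^esub> n \<in> (\<lambda>x. g \<otimes>\<^bsub>C\<^esub> x) ` A \<longleftrightarrow> inv\<^bsub>C\<^esub> g \<otimes>\<^bsub>C\<^esub> s q \<otimes>\<^bsub>C\<^esub> n \<in> A" if n: "n \<in> carrier C" for n
        proof
          assume "s q \<otimes>\<^bsub>C\<^esub> n \<in> (\<lambda>x. g \<otimes>\<^bsub>C\<^esub> x) ` A"
          then obtain a where a: "a \<in> A" "s q \<otimes>\<^bsub>C\<^esub> n = g \<otimes>\<^bsub>C\<^esub> a" by blast
          have "inv\<^bsub>C\<^esub> g \<otimes>\<^bsub>C\<^esub> s q \<otimes>\<^bsub>C\<^esub> n = a"
            using a A g n s[OF q] by (auto simp: G.m_assoc) (auto simp: G.m_assoc[symmetric] subset_iff)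
          then show "inv\<^bsub>C\<^esub> g \<otimes>\<^bsub>C\<^esub> s q \<otimes>\<^bsub>C\<^esub> n \<in> A" using a by simp
        next
          assume "inv\<^bsub>C\<^esub> g \<otimes>\<^bsub>C\<^esub> s q \<otimes>\<^bsub>C\<^esub> n \<in> A"
          moreover have "s q \<otimes>\<^bsub>C\<^esub> n = g \<otimes>\<^bsub>C\<^esub> (inv\<^bsub>C\<^esub> g \<otimes>\<^bsub>C\<^esub> s q \<otimes>\<^bsub>C\<^esub> n)"
            using g n s[OF q] by (simp add: G.m_assoc[symmetric])
          ultimately show "s q \<otimes>\<^bsub>C\<^esub> n \<in> (\<lambda>x. g \<otimes>\<^bsub>C\<^esub> x) ` A" by blast
        qed
        then show ?thesis unfolding E_def kernel_def by blast
      qed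
      also have "mu \<dots> = mu (E A (s (?t q)))"
        by (rule indep) (use s q g pg in auto)
      finally show ?thesis .
    qed
    then have "m ((\<lambda>x. g \<otimes>\<^bsub>C\<^esub> x) ` A) = Q.lint (\<lambda>q. mu (E A (s (?t q))))"
      unfolding m_def Q.lint_def by (simp cong: conj_cong)
    also have "\<dots> = m A" unfolding m_def
      by (rule Q.lint_perm[OF t, of "\<lambda>q. mu (E A (s q))"]) (use nu pg bd in auto)
    finally show ?thesis .
  qed
  ultimately show ?thesis unfolding amenable_iff by blast
qed

lemma amenable_ext:
  assumes "group C" "group Q" "\<phi> \<in> hom C Q" "amenable Q"
    and k: "amenable (C\<lparr>carrier := kernel C Q \<phi>\<rparr>)"
  shows "amenable C"
proof -
  interpret group_hom C Q \<phi> by (intro group_homI assms)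
  let ?Q = "Q\<lparr>carrier := \<phi> ` carrier C\<rparr>"
  have s: "subgroup (\<phi> ` carrier C) Q" by (rule img_is_subgroup)
  have Q: "group ?Q" by (rule H.subgroup_imp_group[OF s])
  have "amenable ?Q"
    by (rule amenable_mon[OF Q assms(2) incl_mon assms(4)]) (rule subgroup.subset[OF s])
  moreover have "\<phi> \<in> hom C ?Q" by (auto simp: hom_def)
  moreover have "kernel C ?Q \<phi> = kernel C Q \<phi>" by (simp add: kernel_def)
  ultimately show ?thesis using amenable_ext_surj[OF assms(1) Q] k by simp
qed

text \<open>Intersecting with \<open>K n\<close> makes every mean on \<open>K n\<close> a mean on
  all of \<open>C\<close>. Invariance under \<open>g\<close> is a closed condition that holds from
  the first \<open>n\<close> with \<open>g \<in> K n\<close> on, so it passes to a cluster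
  point.\<close>

lemma amenable_Un:
  assumes "group C" "\<And>n::nat. subgroup (K n) C" "\<And>n. K n \<subseteq> K (Suc n)" "(\<Union>n. K n) = carrier C"
    and k: "\<And>n. amenable (C\<lparr>carrier := K n\<rparr>)"
  shows "amenable C"
proof -
  interpret C: group C by fact
  have "\<forall>n. \<exists>mu. fin_add (K n) mu \<and> (\<forall>g\<in>K n. \<forall>A. A \<subseteq> K n \<longrightarrow> mu ((\<lambda>x. g \<otimes>\<^bsub>C\<^esub> x) ` A) = mu A)"
    using k unfolding amenable_iff by simp
  then obtain mu where mu: "\<And>n. fin_add (K n) (mu n)"
    and inv: "\<And>n g A. g \<in> K n \<Longrightarrow> A \<subseteq> K n \<Longrightarrow> mu n ((\<lambda>x. g \<otimes>\<^bsub>C\<^esub> x) ` A) = mu n A"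
    by metis
  have mono: "K n \<subseteq> K m" if "n \<le> m" for n m
    by (rule lift_Suc_mono_le[of K, OF assms(3) that])
  have ev: "eventually (\<lambda>n. x \<in> K n) sequentially" if x: "x \<in> carrier C" for x
  proof -
    obtain n where "x \<in> K n" using assms(4) x by blast
    then show ?thesis using mono by (auto simp: eventually_sequentially)
  qed
  define u where "u n A = mu n (A \<inter> K n)" for n A
  have u01: "0 \<le> u n A \<and> u n A \<le> 1" for n A
    by (simp add: u_def fin_add.nonneg[OF mu] fin_add.le_one[OF mu])
  obtain l where l: "\<And>S. closed S \<Longrightarrow> eventually (\<lambda>n. u n \<in> S) sequentially \<Longrightarrow> l \<in> S"
    by (rule cluster_function[of u]) (use u01 in auto)
  have c: "continuous_on UNIV (\<lambda>z::'a set \<Rightarrow> real. z A)" for A by simp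
  have "fin_add (carrier C) l"
  proof
    fix A
    have "l \<in> {z. 0 \<le> z A}"
      by (intro l closed_Collect_le continuous_intros c always_eventually)
        (auto simp: u_def intro: fin_add.nonneg[OF mu])
    then show "0 \<le> l A" by simp
  next
    have "carrier C \<inter> K n = K n" for n using subgroup.subset[OF assms(2)] by blast
    then have "l \<in> {z. z (carrier C) = 1}"
      by (intro l closed_Collect_eq continuous_intros c always_eventually)
        (auto simp: u_def fin_add.total[OF mu])
    then show "l (carrier C) = 1" by simp
  next
    fix A B :: "'a set" assume "A \<inter> B = {}"
    then have "mu n ((A \<inter> K n) \<union> (B \<inter> K n)) = mu n (A \<inter> K n) + mu n (B \<inter> K n)" for n
      by (intro fin_add.add[OF mu]) auto
    then have "l \<in> {z. z (A \<union> B) = z A + z B}"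
      by (intro l closed_Collect_eq continuous_intros c always_eventually)
        (simp add: u_def Int_Un_distrib2)
    then show "l (A \<union> B) = l A + l B" by simp
  qed
  moreover have "l ((\<lambda>x. g \<otimes>\<^bsub>C\<^esub> x) ` A) = l A" if g: "g \<in> carrier C" and A: "A \<subseteq> carrier C" for g A
  proof -
    have "u n ((\<lambda>x. g \<otimes>\<^bsub>C\<^esub> x) ` A) = u n A" if n: "g \<in> K n" for n
    proof -
      have "(\<lambda>x. g \<otimes>\<^bsub>C\<^esub> x) ` A \<inter> K n = (\<lambda>x. g \<otimes>\<^bsub>C\<^esub> x) ` (A \<inter> K n)"
      proof -
        have "a \<in> K n" if a: "a \<in> A" "g \<otimes>\<^bsub>C\<^esub> a \<in> K n" for a
        proof -
          have "inv\<^bsub>C\<^esub> g \<otimes>\<^bsub>C\<^esub> (g \<otimes>\<^bsub>C\<^esub> a) \<in> K n"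
            using assms(2) a n by (blast intro: subgroup.m_closed subgroup.m_inv_closed)
          moreover have "inv\<^bsub>C\<^esub> g \<otimes>\<^bsub>C\<^esub> (g \<otimes>\<^bsub>C\<^esub> a) = a"
            using g a A by (simp add: C.m_assoc[symmetric] subset_iff)
          ultimately show ?thesis by simp
        qed
        then show ?thesis using n subgroup.m_closed[OF assms(2)[of n]] by auto
      qed
      then show ?thesis using inv[OF n, of "A \<inter> K n"] by (simp add: u_def)
    qed
    then have "l \<in> {z. z ((\<lambda>x. g \<otimes>\<^bsub>C\<^esub> x) ` A) = z A}"
      by (intro l closed_Collect_eq continuous_intros c, use ev[OF g] in eventually_elim) simp
    then show ?thesis by simp
  qed
  ultimately show ?thesis unfolding amenable_iff by blast
qed

text \<open>The mean is a cluster point of the proportions of \<open>A\<close> in the intervals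
  \<open>{0..int n}\<close>. Translation by \<open>g\<close> changes the count by at most the
  absolute value of \<open>g\<close>, which is negligible against the length.\<close>

lemma amenable_integer: "amenable integer_group"
proof -
  define u where "u n A = real (card (A \<inter> {0..int n})) / (int n + 1)" for n :: nat and A :: "int set"
  have cn: "card {0..int n} = n + 1" for n by simp
  have cle: "card (A \<inter> {0..int n}) \<le> n + 1" for A n
    using card_mono[of "{0..int n}" "A \<inter> {0..int n}"] by simp
  have u01: "0 \<le> u n A \<and> u n A \<le> 1" for n A
    using cle[of A n] by (simp add: u_def divide_le_eq)
  obtain l where l: "\<And>S. closed S \<Longrightarrow> eventually (\<lambda>n. u n \<in> S) sequentially \<Longrightarrow> l \<in> S"
    by (rule cluster_function[of u]) (use u01 in auto)
  have c: "continuous_on UNIV (\<lambda>z::int set \<Rightarrow> real. z A)" for A by simp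
  have "fin_add UNIV l"
  proof
    fix A
    have "l \<in> {z. 0 \<le> z A}"
      by (intro l closed_Collect_le continuous_intros c always_eventually) (use u01 in auto)
    then show "0 \<le> l A" by simp
  next
    have "l \<in> {z. z UNIV = 1}"
      by (intro l closed_Collect_eq continuous_intros c always_eventually) (simp add: u_def)
    then show "l UNIV = 1" by simp
  next
    fix A B :: "int set" assume AB: "A \<inter> B = {}"
    have "card ((A \<inter> {0..int n}) \<union> (B \<inter> {0..int n})) = card (A \<inter> {0..int n}) + card (B \<inter> {0..int n})" for n
      by (rule card_Un_disjoint) (use AB in auto)
    then have "u n (A \<union> B) = u n A + u n B" for n
      by (simp add: u_def Int_Un_distrib2 add_divide_distrib)
    then have "l \<in> {z. z (A \<union> B) = z A + z B}"
      by (intro l closed_Collect_eq continuous_intros c always_eventually) simp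
    then show "l (A \<union> B) = l A + l B" by simp
  qed
  \<comment> \<open>One inequality is enough, as it can be applied to \<open>- g\<close> as
    well.\<close>
  moreover have le: "l ((\<lambda>x. g + x) ` A) \<le> l A" for g A
  proof -
    have b: "u n ((\<lambda>x. g + x) ` A) \<le> u n A + \<bar>g\<bar> / (int n + 1)" for n
    proof -
      \<comment> \<open>The points of the interval that translation by \<open>g\<close> does not
        reach from within it.\<close>
      let ?Z = "{0..int n} - {g..int n + g}"
      have "(\<lambda>x. g + x) ` A \<inter> {0..int n} \<subseteq> (\<lambda>x. g + x) ` (A \<inter> {0..int n}) \<union> ?Z"
      proof
        fix y assume y: "y \<in> (\<lambda>x. g + x) ` A \<inter> {0..int n}"
        then obtain a where a: "a \<in> A" "y = g + a" by blast
        show "y \<in> (\<lambda>x. g + x) ` (A \<inter> {0..int n}) \<union> ?Z"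
        proof (cases "a \<in> {0..int n}")
          case False
          then have "y \<notin> {g..int n + g}" using a(2) by simp
          then show ?thesis using y by blast
        qed (use a in blast)
      qed
      then have "card ((\<lambda>x. g + x) ` A \<inter> {0..int n}) \<le> card ((\<lambda>x. g + x) ` (A \<inter> {0..int n}) \<union> ?Z)"
        by (intro card_mono) auto
      also have "\<dots> \<le> card ((\<lambda>x. g + x) ` (A \<inter> {0..int n})) + card ?Z" by (rule card_Un_le)
      also have "\<dots> \<le> card (A \<inter> {0..int n}) + nat \<bar>g\<bar>"
      proof (rule add_mono[OF card_image_le])
        show "card ?Z \<le> nat \<bar>g\<bar>"
        proof (cases "g \<ge> 0")
          case True
          then have "?Z \<subseteq> {0..<g}" by (intro subsetI, simp only: Diff_iff atLeastAtMost_iff atLeastLessThan_iff simp_thms) linarith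
          then have "card ?Z \<le> card {0..<g}" by (intro card_mono) simp_all
          then show ?thesis using True by simp
        next
          case False
          then have "?Z \<subseteq> {int n + g + 1..int n}" by (intro subsetI, simp only: Diff_iff atLeastAtMost_iff atLeastLessThan_iff simp_thms) linarith
          then have "card ?Z \<le> card {int n + g + 1..int n}" by (intro card_mono) simp_all
          then show ?thesis using False by simp
        qed
      qed simp
      finally have "real (card ((\<lambda>x. g + x) ` A \<inter> {0..int n})) \<le> real (card (A \<inter> {0..int n})) + real_of_int \<bar>g\<bar>"
        by linarith
      then show ?thesis unfolding u_def add_divide_distrib[symmetric] by (intro divide_right_mono) auto
    qed
    have "l ((\<lambda>x. g + x) ` A) \<le> l A + e" if e: "e > 0" for e
    proof -
      have "(\<lambda>n. real_of_int \<bar>g\<bar> / real (Suc n)) \<longlonglongrightarrow> 0" by (rule LIMSEQ_Suc[OF lim_const_over_n])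
      then have "eventually (\<lambda>n. real_of_int \<bar>g\<bar> / real (Suc n) < e) sequentially"
        by (rule order_tendstoD(2)) (rule e)
      then have "eventually (\<lambda>n. u n \<in> {z. z ((\<lambda>x. g + x) ` A) \<le> z A + e}) sequentially"
      proof eventually_elim
        case (elim n)
        then show ?case using b[of n] by (simp add: add.commute)
      qed
      then have "l \<in> {z. z ((\<lambda>x. g + x) ` A) \<le> z A + e}"
        by (intro l closed_Collect_le continuous_intros c)
      then show ?thesis by simp
    qed
    then show ?thesis by (rule field_le_epsilon)
  qed
  moreover have "l ((\<lambda>x. g + x) ` A) = l A" for g A
    using le[of g A] le[of "- g" "(\<lambda>x. g + x) ` A"] by (simp add: image_image)
  ultimately show ?thesis unfolding amenable_iff by (auto intro!: exI[of _ l])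
qed

subsection \<open>Closure properties\<close>

text \<open>The change of type from \<open>'a\<close> to \<open>nat\<close> is the point: for the
  two inductive classes it rests on closure under sections, while the other properties are pulled
  back directly.\<close>

lemma has_property_mon:
  fixes C :: "nat monoid" and G :: "'a monoid"
  assumes "group C" "group G" "h \<in> mon C G" "has_property G p"
  shows "has_property C p"
proof (cases p)
  case Torsion_Free
  then show ?thesis using torsion_free_mon[OF assms(1-3)] assms(4) by simp
next
  case Locally_Indicable
  then show ?thesis using locally_indicable_mon[OF assms(1-3)] assms(4) by simp
next
  case Amenable
  then show ?thesis using amenable_mon[OF assms(1-3)] assms(4) by simp
next
  case Elementary_Amenable
  then show ?thesis using elementary_amenable_section[OF _ mon_section[OF assms(1-3)]] assms(4) by simp
next
  case Subexponentially_Amenable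
  then show ?thesis using subexponentially_amenable_section[OF _ mon_section[OF assms(1-3)]] assms(4) by simp
next
  case Right_Orderable
  then show ?thesis using right_orderable_mon[OF assms(1-3)] assms(4) by simp
next
  case Orderable
  then show ?thesis using orderable_mon[OF assms(1-3)] assms(4) by simp
qed

text \<open>\<open>Orderable\<close> is excluded: the Klein bottle group is an extension of the
  integers by the integers but has no two-sided invariant order.\<close>

lemma has_property_ext:
  fixes C Q :: "'a monoid"
  assumes "group C" "group Q" "\<phi> \<in> hom C Q" "has_property Q p"
    and "has_property (C\<lparr>carrier := kernel C Q \<phi>\<rparr>) p" and "p \<noteq> Orderable"
  shows "has_property C p"
proof (cases p)
  case Torsion_Free
  then show ?thesis using torsion_free_ext[OF assms(1-3)] assms(4,5) by simp
next
  case Locally_Indicable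
  then show ?thesis using locally_indicable_ext[OF assms(1-3)] assms(4,5) by simp
next
  case Amenable
  then show ?thesis using amenable_ext[OF assms(1-3)] assms(4,5) by simp
next
  case Elementary_Amenable
  then show ?thesis using amenability_closure_ext[OF assms(1-3)] assms(4,5)
    by (simp add: elementary_amenable_def)
next
  case Subexponentially_Amenable
  then show ?thesis using amenability_closure_ext[OF assms(1-3)] assms(4,5)
    by (simp add: subexponentially_amenable_def)
next
  case Right_Orderable
  then show ?thesis using right_orderable_ext[OF assms(1-3)] assms(4,5) by simp
qed (use assms(6) in simp)

lemma has_property_Un:
  assumes "group C" "\<And>n::nat. subgroup (K n) C" "\<And>n. K n \<subseteq> K (Suc n)" "(\<Union>n. K n) = carrier C"
    and "\<And>n. has_property (C\<lparr>carrier := K n\<rparr>) p"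
  shows "has_property C p"
proof (cases p)
  case Torsion_Free
  then show ?thesis using torsion_free_Un[OF assms(4)] assms(5) by simp
next
  case Locally_Indicable
  then show ?thesis using locally_indicable_Un[of C K, OF assms(1-4)] assms(5) by simp
next
  case Amenable
  then show ?thesis using amenable_Un[of C K, OF assms(1-4)] assms(5) by simp
next
  case Elementary_Amenable
  then show ?thesis using amenability_closure_Un[of C K, OF assms(1-4)] assms(5)
    by (simp add: elementary_amenable_def)
next
  case Subexponentially_Amenable
  then show ?thesis using amenability_closure_Un[of C K, OF assms(1-4)] assms(5)
    by (simp add: subexponentially_amenable_def)
next
  case Right_Orderable
  then show ?thesis using right_orderable_Un[of C K, OF assms(1-4)] assms(5) by simp
next
  case Orderable
  then show ?thesis using orderable_Un[of C K, OF assms(1-4)] assms(5) by simp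
qed

lemma has_property_integer: "has_property integer_group p"
proof (cases p)
  case Right_Orderable
  then show ?thesis using cone_integer by (auto simp: right_orderable_iff)
next
  case Orderable
  then show ?thesis using cone_integer by (auto simp: orderable_iff)
qed (simp_all add: torsion_free_integer locally_indicable_integer amenable_integer
    elementary_amenable_integer subexponentially_amenable_integer)

text \<open>The closure rules of the inductive classes only speak about groups on one type; this
  variant, which is about the countable subgroups, transports along monomorphisms between
  groups of different types.\<close>

definition countably_has :: "group_property \<Rightarrow> 'a monoid \<Rightarrow> bool" where
  "countably_has p G \<longleftrightarrow> (\<forall>C :: nat monoid. \<forall>h. group C \<longrightarrow> h \<in> mon C G \<longrightarrow> has_property C p)"

lemma countably_hasI: "group G \<Longrightarrow> has_property G p \<Longrightarrow> countably_has p G"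
  unfolding countably_has_def using has_property_mon by blast

lemma countably_has_mon: "h \<in> mon C G \<Longrightarrow> countably_has p G \<Longrightarrow> countably_has p C"
  unfolding countably_has_def using mon_compose by blast

lemma countably_has_integer: "countably_has p integer_group"
  by (intro countably_hasI has_property_integer) simp

lemma countably_has_trivial: "carrier C = {\<one>\<^bsub>C\<^esub>} \<Longrightarrow> group C \<Longrightarrow> countably_has p C"
  by (rule countably_has_mon[OF _ countably_has_integer, of "\<lambda>_. 0"]) (simp add: mon_def hom_def)

text \<open>A countable subgroup of \<open>C\<close> is an extension of its image in
  \<open>Q\<close> by its part in the kernel. The image is countable and can be copied, so that the
  extension rule is applied to groups on \<open>nat\<close> only.\<close>

lemma countably_has_ext:
  assumes C: "group C" and Q: "group Q" and \<phi>: "\<phi> \<in> hom C Q" and "countably_has p Q"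
    and k: "countably_has p (C\<lparr>carrier := kernel C Q \<phi>\<rparr>)" and p: "p \<noteq> Orderable"
  shows "countably_has p C"
  unfolding countably_has_def
proof (intro allI impI)
  fix C' :: "nat monoid" and h assume C': "group C'" and h: "h \<in> mon C' C"
  have "\<phi> \<circ> h \<in> hom C' Q" using h \<phi> by (intro hom_compose) (auto simp: mon_def)
  then interpret c: group_hom C' Q "\<phi> \<circ> h" by (intro group_homI C' Q)
  let ?I = "Q\<lparr>carrier := (\<phi> \<circ> h) ` carrier C'\<rparr>"
  have I: "group ?I" by (rule c.H.subgroup_imp_group[OF c.img_is_subgroup])
  have "countable (carrier ?I)" by simp
  then obtain Q' :: "nat monoid" and k where Q': "group Q'" and k: "k \<in> iso ?I Q'"
    using nat_copy[OF I] by blast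
  have "countably_has p ?I"
    by (rule countably_has_mon[OF incl_mon assms(4)]) (rule subgroup.subset[OF c.img_is_subgroup])
  then have "has_property Q' p"
    using Q' group.iso_set_sym[OF I k] unfolding countably_has_def by (auto simp: iso_iff_mon_epi)
  moreover have \<psi>: "k \<circ> (\<phi> \<circ> h) \<in> hom C' Q'"
    using k c.homh by (intro hom_compose[of _ _ ?I]) (auto simp: iso_def hom_def)
  moreover have "has_property (C'\<lparr>carrier := kernel C' Q' (k \<circ> (\<phi> \<circ> h))\<rparr>) p"
  proof -
    let ?K = "C'\<lparr>carrier := kernel C' Q' (k \<circ> (\<phi> \<circ> h))\<rparr>"
    have "group ?K"
      by (intro group.subgroup_imp_group C' group_hom.subgroup_kernel group_homI Q' \<psi>)
    moreover have "h \<in> mon ?K (C\<lparr>carrier := kernel C Q \<phi>\<rparr>)"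
    proof -
      have km: "k \<in> mon ?I Q'" using k by (simp add: iso_iff_mon_epi)
      have "\<phi> (h x) = \<one>\<^bsub>Q\<^esub>" if "x \<in> carrier C'" "k (\<phi> (h x)) = \<one>\<^bsub>Q'\<^esub>" for x
        using mon_eq_one_iff[OF km I Q', of "\<phi> (h x)"] that by auto
      then show ?thesis using h by (auto simp: mon_def hom_def kernel_def inj_on_def)
    qed
    ultimately show ?thesis using assms(5) unfolding countably_has_def by blast
  qed
  ultimately show "has_property C' p" using has_property_ext[OF C' Q'] p by blast
qed

lemma countably_has_Un:
  assumes "group C" "\<And>n::nat. subgroup (K n) C" "\<And>n. K n \<subseteq> K (Suc n)" "(\<Union>n. K n) = carrier C"
    and k: "\<And>n. countably_has p (C\<lparr>carrier := K n\<rparr>)"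
  shows "countably_has p C"
  unfolding countably_has_def
proof (intro allI impI)
  fix C' :: "nat monoid" and h assume C': "group C'" and h: "h \<in> mon C' C"
  interpret h: group_hom C' C h using h by (intro group_homI C' assms) (simp add: mon_def)
  define K' where "K' n = {x \<in> carrier C'. h x \<in> K n}" for n
  have sub: "subgroup (K' n) C'" for n
  proof (rule h.G.subgroupI)
    have "\<one>\<^bsub>C'\<^esub> \<in> K' n" using subgroup.one_closed[OF assms(2)] by (simp add: K'_def)
    then show "K' n \<noteq> {}" by blast
  qed (use assms(2) in \<open>auto simp: K'_def intro: subgroup.m_closed subgroup.m_inv_closed\<close>)
  show "has_property C' p"
  proof (rule has_property_Un[OF C' sub])
    show "K' n \<subseteq> K' (Suc n)" for n using assms(3)[of n] by (auto simp: K'_def)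
    show "(\<Union>n. K' n) = carrier C'" using assms(4) h.hom_closed by (auto simp: K'_def)
    fix n
    have "h \<in> mon (C'\<lparr>carrier := K' n\<rparr>) (C\<lparr>carrier := K n\<rparr>)"
      using h by (auto simp: mon_def hom_def K'_def inj_on_def)
    then show "has_property (C'\<lparr>carrier := K' n\<rparr>) p"
      using k[of n] h.G.subgroup_imp_group[OF sub] unfolding countably_has_def by blast
  qed
qed

text \<open>\<open>K\<close> embeds into a direct sum of copies of \<open>G\<close> indexed by the
  naturals. The elements killed by all \<open>e m\<close> with \<open>m \<ge> n\<close> form an
  ascending chain that starts with the trivial group, and \<open>e n\<close> presents each step as
  an extension whose kernel is the previous member.\<close>

lemma countably_has_joint:
  assumes K: "group K" and G: "group G" and e: "\<And>n::nat. e n \<in> hom K G"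
    and fin: "\<And>x. x \<in> carrier K \<Longrightarrow> \<exists>n. \<forall>m\<ge>n. e m x = \<one>\<^bsub>G\<^esub>"
    and inj: "\<And>x. x \<in> carrier K \<Longrightarrow> (\<And>n. e n x = \<one>\<^bsub>G\<^esub>) \<Longrightarrow> x = \<one>\<^bsub>K\<^esub>"
    and p: "countably_has p G" "p \<noteq> Orderable"
  shows "countably_has p K"
proof -
  interpret K: group K by fact
  interpret e: group_hom K G "e n" for n by (intro group_homI K G e)
  interpret G: group G by fact
  define F where "F n = {x \<in> carrier K. \<forall>m\<ge>n. e m x = \<one>\<^bsub>G\<^esub>}" for n
  have sub: "subgroup (F n) K" for n
  proof (rule K.subgroupI)
    have "\<one>\<^bsub>K\<^esub> \<in> F n" by (simp add: F_def)
    then show "F n \<noteq> {}" by blast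
  qed (auto simp: F_def)
  show ?thesis
  proof (rule countably_has_Un[OF K sub])
    show "F n \<subseteq> F (Suc n)" for n by (auto simp: F_def)
    show "(\<Union>n. F n) = carrier K" using fin by (auto simp: F_def)
    show "countably_has p (K\<lparr>carrier := F n\<rparr>)" for n
    proof (induction n)
      case 0
      have "F 0 = {\<one>\<^bsub>K\<^esub>}" using inj by (auto simp: F_def)
      then show ?case by (intro countably_has_trivial K.subgroup_imp_group sub) simp
    next
      case (Suc n)
      let ?S = "K\<lparr>carrier := F (Suc n)\<rparr>"
      have h: "e n \<in> hom ?S G" using e[of n] by (auto simp: hom_def F_def)
      have "kernel ?S G (e n) = F n"
        by (auto simp: kernel_def F_def) (metis le_antisym not_less_eq_eq)
      then have "countably_has p (?S\<lparr>carrier := kernel ?S G (e n)\<rparr>)" using Suc by simp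
      then show ?case using countably_has_ext[OF K.subgroup_imp_group[OF sub] G h] p by blast
    qed
  qed
qed

subsection \<open>Semidirect products with the integers\<close>

definition semidirect :: "'k monoid \<Rightarrow> (int \<Rightarrow> 'k \<Rightarrow> 'k) \<Rightarrow> ('k \<times> int) monoid" where
  "semidirect K \<alpha> = \<lparr>carrier = carrier K \<times> UNIV,
     monoid.mult = (\<lambda>(x, m) (y, n). (x \<otimes>\<^bsub>K\<^esub> \<alpha> m y, m + n)), one = (\<one>\<^bsub>K\<^esub>, 0)\<rparr>"

locale int_action = K: group K for K :: "'k monoid" (structure) +
  fixes \<alpha> :: "int \<Rightarrow> 'k \<Rightarrow> 'k"
  assumes hom: "\<alpha> n \<in> hom K K"
    and zero: "x \<in> carrier K \<Longrightarrow> \<alpha> 0 x = x"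
    and plus: "x \<in> carrier K \<Longrightarrow> \<alpha> (m + n) x = \<alpha> m (\<alpha> n x)"
begin

lemma \<alpha>_closed [simp]: "x \<in> carrier K \<Longrightarrow> \<alpha> n x \<in> carrier K"
  using hom[of n] by (auto simp: hom_def)

lemma \<alpha>_mult: "x \<in> carrier K \<Longrightarrow> y \<in> carrier K \<Longrightarrow> \<alpha> n (x \<otimes> y) = \<alpha> n x \<otimes> \<alpha> n y"
  using hom[of n] by (auto simp: hom_def)

lemma \<alpha>_one [simp]: "\<alpha> n \<one> = \<one>"
  using hom_one[OF hom K.group_axioms K.group_axioms] .

lemma \<alpha>_cancel [simp]: "x \<in> carrier K \<Longrightarrow> \<alpha> (- n) (\<alpha> n x) = x" "x \<in> carrier K \<Longrightarrow> \<alpha> n (\<alpha> (- n) x) = x"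
  using plus[of x "- n" n] plus[of x n "- n"] zero[of x] by auto

lemma semidirect_group: "group (semidirect K \<alpha>)"
proof (rule groupI)
  show "\<exists>y\<in>carrier (semidirect K \<alpha>). y \<otimes>\<^bsub>semidirect K \<alpha>\<^esub> x = \<one>\<^bsub>semidirect K \<alpha>\<^esub>"
    if x: "x \<in> carrier (semidirect K \<alpha>)" for x
  proof (cases x)
    case (Pair a m)
    then have a: "a \<in> carrier K" using x by (simp add: semidirect_def)
    have "\<alpha> (- m) (inv a) \<otimes> \<alpha> (- m) a = \<one>" using a by (simp flip: \<alpha>_mult)
    then show ?thesis using a Pair
      by (intro bexI[of _ "(\<alpha> (- m) (inv a), - m)"]) (simp_all add: semidirect_def)
  qed
qed (auto simp: semidirect_def \<alpha>_mult plus zero K.m_assoc)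

lemma semidirect_inv:
  assumes "x \<in> carrier K"
  shows "inv\<^bsub>semidirect K \<alpha>\<^esub> (x, m) = (\<alpha> (- m) (inv x), - m)"
proof (rule group.inv_equality[OF semidirect_group])
  have "\<alpha> (- m) (inv x) \<otimes> \<alpha> (- m) x = \<one>" using assms by (simp flip: \<alpha>_mult)
  then show "(\<alpha> (- m) (inv x), - m) \<otimes>\<^bsub>semidirect K \<alpha>\<^esub> (x, m) = \<one>\<^bsub>semidirect K \<alpha>\<^esub>"
    by (simp add: semidirect_def)
qed (use assms in \<open>simp_all add: semidirect_def\<close>)

lemma semidirect_conj:
  assumes "x \<in> carrier K" "y \<in> carrier K"
  shows "(x, m) \<otimes>\<^bsub>semidirect K \<alpha>\<^esub> (y, 0) \<otimes>\<^bsub>semidirect K \<alpha>\<^esub> inv\<^bsub>semidirect K \<alpha>\<^esub> (x, m)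
    = (x \<otimes> \<alpha> m y \<otimes> inv x, 0)"
  unfolding semidirect_inv[OF assms(1)] using assms by (simp add: semidirect_def)

lemma snd_hom: "snd \<in> hom (semidirect K \<alpha>) integer_group"
  by (auto simp: hom_def semidirect_def)

lemma semidirect_kernel: "kernel (semidirect K \<alpha>) integer_group snd = carrier K \<times> {0}"
  by (auto simp: kernel_def semidirect_def)

lemma semidirect_incl: "(\<lambda>x. (x, 0)) \<in> mon K (semidirect K \<alpha>)"
  by (auto simp: mon_def hom_def inj_on_def semidirect_def zero)

lemma countably_has_semidirect:
  assumes "countably_has p K" "p \<noteq> Orderable"
  shows "countably_has p (semidirect K \<alpha>)"
proof (rule countably_has_ext[OF semidirect_group group_integer_group snd_hom countably_has_integer _ assms(2)])
  show "countably_has p (semidirect K \<alpha>\<lparr>carrier := kernel (semidirect K \<alpha>) integer_group snd\<rparr>)"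
    unfolding semidirect_kernel
    by (rule countably_has_mon[OF _ assms(1), of fst])
      (auto simp: mon_def hom_def inj_on_def semidirect_def zero)
qed

text \<open>The order is lexicographic with the integer first. Invariance of \<open>P\<close> under
  the action, on top of conjugation in \<open>K\<close>, makes it invariant under conjugation in the
  semidirect product, as \<open>cone_ext\<close> asks for.\<close>

lemma orderable_semidirect:
  assumes P: "cone K P" "conj_invariant K P" and inv: "\<And>n x. x \<in> P \<Longrightarrow> \<alpha> n x \<in> P"
  shows "orderable (semidirect K \<alpha>)"
proof -
  let ?S = "semidirect K \<alpha>"
  have Pc: "x \<in> carrier K" if "x \<in> P" for x using P(1) that by (auto simp: cone_def)
  let ?N = "?S\<lparr>carrier := kernel ?S integer_group snd\<rparr>"
  have ks: "subgroup (kernel ?S integer_group snd) ?S"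
    by (intro group_hom.subgroup_kernel group_homI semidirect_group group_integer_group snd_hom)
  have Ng: "group ?N" by (rule group.subgroup_imp_group[OF semidirect_group ks])
  have m: "fst \<in> mon ?N K" unfolding semidirect_kernel
    by (auto simp: mon_def hom_def inj_on_def semidirect_def zero)
  have "cone ?N {x \<in> carrier ?N. fst x \<in> P}" by (rule cone_mon(1)[OF Ng K.group_axioms m P(1)])
  note c = cone_ext[OF semidirect_group group_integer_group snd_hom cone_integer(1) this]
  show ?thesis unfolding orderable_iff[OF semidirect_group]
  proof (intro exI conjI)
    show "conj_invariant ?S ({x \<in> carrier ?S. snd x \<in> {0..} \<and> snd x \<noteq> \<one>\<^bsub>integer_group\<^esub>} \<union> {x \<in> carrier ?N. fst x \<in> P})"
    proof (rule c(2)[OF cone_integer(2)])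
      fix g x assume g: "g \<in> carrier ?S" and x: "x \<in> {x \<in> carrier ?N. fst x \<in> P}"
      obtain a n where a: "g = (a, n)" "a \<in> carrier K" using g by (cases g) (auto simp: semidirect_def)
      obtain b where b: "x = (b, 0)" "b \<in> P" using x by (cases x) (auto simp: semidirect_kernel)
      have "a \<otimes> \<alpha> n b \<otimes> inv a \<in> P" using P(2) inv a b unfolding conj_invariant_def by blast
      then show "g \<otimes>\<^bsub>?S\<^esub> x \<otimes>\<^bsub>?S\<^esub> inv\<^bsub>?S\<^esub> g \<in> {x \<in> carrier ?N. fst x \<in> P}"
        using semidirect_conj[OF a(2) Pc[OF b(2)]] a b Pc by (auto simp: semidirect_kernel)
    qed
  qed (rule c(1))
qed

end

subsection \<open>Embedding a group into a commutator subgroup\<close>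

text \<open>One bound \<open>n\<close> controls both ends, so that these sets form a chain and an
  element is determined by its values from \<open>- n\<close> to \<open>n\<close>; the final value
  is the one at \<open>n\<close>.\<close>

definition tail_functions :: "'a monoid \<Rightarrow> nat \<Rightarrow> (int \<Rightarrow> 'a) set" where
  "tail_functions G n = {f. (\<forall>k. f k \<in> carrier G) \<and> (\<forall>k < - int n. f k = \<one>\<^bsub>G\<^esub>) \<and>
     (\<forall>k \<ge> int n. f k = f (int n))}"

definition tail_group :: "'a monoid \<Rightarrow> (int \<Rightarrow> 'a) monoid" where
  "tail_group G = \<lparr>carrier = (\<Union>n. tail_functions G n),
     monoid.mult = (\<lambda>f g k. f k \<otimes>\<^bsub>G\<^esub> g k), one = (\<lambda>_. \<one>\<^bsub>G\<^esub>)\<rparr>"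

definition translate :: "int \<Rightarrow> (int \<Rightarrow> 'a) \<Rightarrow> int \<Rightarrow> 'a" where
  "translate n f = (\<lambda>k. f (k - n))"

lemma first_int:
  fixes Q :: "int \<Rightarrow> bool"
  assumes "Q k" "\<And>j. j < n \<Longrightarrow> \<not> Q j"
  obtains m where "Q m" "\<And>j. j < m \<Longrightarrow> \<not> Q j"
proof -
  have ex: "\<exists>i. Q (n + int i)"
    using assms by (intro exI[of _ "nat (k - n)"]) (cases "k < n"; simp)
  define i where "i = (LEAST i. Q (n + int i))"
  have "Q (n + int i)" unfolding i_def by (rule LeastI_ex[OF ex])
  moreover have "\<not> Q j" if "j < n + int i" for j
  proof (cases "j < n")
    case False
    then have "nat (j - n) < i" using that by auto
    then have "\<not> Q (n + int (nat (j - n)))" unfolding i_def by (rule not_less_Least)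
    then show ?thesis using False by simp
  qed (use assms(2) in simp)
  ultimately show ?thesis using that by blast
qed

lemma tail_functions_mono: "m \<le> n \<Longrightarrow> tail_functions G m \<subseteq> tail_functions G n"
proof
  fix f assume mn: "m \<le> n" and f: "f \<in> tail_functions G m"
  show "f \<in> tail_functions G n"
    unfolding tail_functions_def mem_Collect_eq
  proof (intro conjI allI impI)
    fix k assume "k \<ge> int n"
    then have "f k = f (int m)" "f (int n) = f (int m)"
      using f mn unfolding tail_functions_def mem_Collect_eq by (meson order_trans of_nat_mono)+
    then show "f k = f (int n)" by simp
  qed (use f mn in \<open>auto simp: tail_functions_def\<close>)
qed

lemma tail_functionsI:
  assumes "\<And>k. f k \<in> carrier G" "\<And>k. k < a \<Longrightarrow> f k = \<one>\<^bsub>G\<^esub>" "\<And>k. k \<ge> b \<Longrightarrow> f k = c"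
  shows "f \<in> carrier (tail_group G)"
proof -
  have "f \<in> tail_functions G (nat (max (- a) b))"
    using assms unfolding tail_functions_def by (auto simp: max_def)
  then show ?thesis by (auto simp: tail_group_def)
qed

context
  fixes G :: "'a monoid" (structure)
  assumes G: "group G"
begin

interpretation group G by (rule G)

lemma tail_mult_closed:
  assumes "f \<in> tail_functions G n" "g \<in> tail_functions G n"
  shows "(\<lambda>k. f k \<otimes> g k) \<in> tail_functions G n"
  unfolding tail_functions_def mem_Collect_eq
proof (intro conjI allI impI)
  fix k assume "k \<ge> int n"
  then have "f k = f (int n)" "g k = g (int n)" using assms unfolding tail_functions_def by blast+
  then show "f k \<otimes> g k = f (int n) \<otimes> g (int n)" by simp
qed (use assms in \<open>auto simp: tail_functions_def\<close>)

lemma tail_inv_closed: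
  assumes "f \<in> tail_functions G n"
  shows "(\<lambda>k. inv (f k)) \<in> tail_functions G n"
  unfolding tail_functions_def mem_Collect_eq
proof (intro conjI allI impI)
  fix k assume "k \<ge> int n"
  then have "f k = f (int n)" using assms unfolding tail_functions_def by blast
  then show "inv (f k) = inv (f (int n))" by simp
qed (use assms in \<open>auto simp: tail_functions_def\<close>)

lemma tail_closed: "f \<in> carrier (tail_group G) \<Longrightarrow> f k \<in> carrier G"
  by (auto simp: tail_group_def tail_functions_def)

lemma tail_group: "group (tail_group G)"
proof (rule groupI)
  fix f g assume "f \<in> carrier (tail_group G)" "g \<in> carrier (tail_group G)"
  then obtain m n where "f \<in> tail_functions G m" "g \<in> tail_functions G n" by (auto simp: tail_group_def)
  then have "f \<in> tail_functions G (max m n)" "g \<in> tail_functions G (max m n)"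
    using tail_functions_mono[of m "max m n" G] tail_functions_mono[of n "max m n" G] by auto
  then show "f \<otimes>\<^bsub>tail_group G\<^esub> g \<in> carrier (tail_group G)"
    using tail_mult_closed by (auto simp: tail_group_def)
next
  show "\<one>\<^bsub>tail_group G\<^esub> \<in> carrier (tail_group G)"
    by (auto simp: tail_group_def tail_functions_def)
next
  fix f assume "f \<in> carrier (tail_group G)"
  then obtain n where n: "f \<in> tail_functions G n" by (auto simp: tail_group_def)
  have "(\<lambda>k. inv (f k)) \<in> carrier (tail_group G)" using tail_inv_closed[OF n] by (auto simp: tail_group_def)
  moreover have "(\<lambda>k. inv (f k)) \<otimes>\<^bsub>tail_group G\<^esub> f = \<one>\<^bsub>tail_group G\<^esub>"
    using n by (auto simp: tail_group_def tail_functions_def)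
  ultimately show "\<exists>g\<in>carrier (tail_group G). g \<otimes>\<^bsub>tail_group G\<^esub> f = \<one>\<^bsub>tail_group G\<^esub>" by blast
qed (auto simp: tail_group_def tail_functions_def m_assoc)

lemma tail_inv:
  assumes "f \<in> carrier (tail_group G)"
  shows "inv\<^bsub>tail_group G\<^esub> f = (\<lambda>k. inv (f k))"
proof (rule group.inv_equality[OF tail_group])
  obtain n where n: "f \<in> tail_functions G n" using assms by (auto simp: tail_group_def)
  show "(\<lambda>k. inv (f k)) \<in> carrier (tail_group G)" using tail_inv_closed[OF n] by (auto simp: tail_group_def)
  show "(\<lambda>k. inv (f k)) \<otimes>\<^bsub>tail_group G\<^esub> f = \<one>\<^bsub>tail_group G\<^esub>"
    using n by (auto simp: tail_group_def tail_functions_def)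
qed fact

lemma tail_action: "int_action (tail_group G) translate"
proof -
  have c: "translate n f \<in> carrier (tail_group G)" if f: "f \<in> carrier (tail_group G)" for n f
  proof -
    obtain m where m: "f \<in> tail_functions G m" using f by (auto simp: tail_group_def)
    show ?thesis
    proof (rule tail_functionsI)
      show "translate n f k \<in> carrier G" for k using m by (simp add: tail_functions_def translate_def)
      show "translate n f k = \<one>" if "k < - int m + n" for k
        using m that by (simp add: tail_functions_def translate_def)
      show "translate n f k = f (int m)" if "k \<ge> int m + n" for k
      proof -
        have "k - n \<ge> int m" using that by simp
        then show ?thesis using m unfolding tail_functions_def translate_def by blast
      qed
    qed
  qed
  show ?thesis
    by (intro int_action.intro int_action_axioms.intro tail_group)
      (auto simp: hom_def c, auto simp: tail_group_def translate_def algebra_simps)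
qed

interpretation T: int_action "tail_group G" translate by (rule tail_action)

lemma countable_tail:
  assumes "countable (carrier G)"
  shows "countable (carrier (tail_group G))"
proof -
  have "countable (tail_functions G n)" for n
  proof (rule countable_image_inj_on)
    let ?l = "\<lambda>f. map f [- int n..int n]"
    have "?l ` tail_functions G n \<subseteq> lists (carrier G)" by (auto simp: tail_functions_def)
    then show "countable (?l ` tail_functions G n)"
      by (rule countable_subset[OF _ countable_lists[OF assms]])
    show "inj_on ?l (tail_functions G n)"
    proof (rule inj_onI)
      fix f g assume f: "f \<in> tail_functions G n" and g: "g \<in> tail_functions G n" and "?l f = ?l g"
      then have eq: "f k = g k" if "- int n \<le> k" "k \<le> int n" for k using that by auto
      show "f = g"
      proof
        fix k
        consider "k < - int n" | "- int n \<le> k" "k \<le> int n" | "k \<ge> int n" by linarith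
        then show "f k = g k"
        proof cases
          case 3
          then have "f k = f (int n)" "g k = g (int n)" using f g unfolding tail_functions_def by blast+
          then show ?thesis using eq by simp
        next
          case 1
          then have "f k = \<one>" "g k = \<one>" using f g unfolding tail_functions_def by blast+
          then show ?thesis by simp
        qed (rule eq)
      qed
    qed
  qed
  then show ?thesis by (simp add: tail_group_def)
qed

text \<open>For fixed \<open>n\<close> a function is determined by \<open>2 * n + 1\<close> values,
  so evaluations embed the subgroup jointly; the tail group is the union of these subgroups.\<close>

lemma countably_has_tail:
  assumes "countably_has p G" "p \<noteq> Orderable"
  shows "countably_has p (tail_group G)"
proof (rule countably_has_Un[OF tail_group])
  show "(\<Union>n. tail_functions G n) = carrier (tail_group G)" by (simp add: tail_group_def)
  show "tail_functions G n \<subseteq> tail_functions G (Suc n)" for n by (rule tail_functions_mono) simp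
  fix n
  show s: "subgroup (tail_functions G n) (tail_group G)"
  proof (rule T.K.subgroupI)
    show "tail_functions G n \<subseteq> carrier (tail_group G)" by (auto simp: tail_group_def)
    have "(\<lambda>_. \<one>) \<in> tail_functions G n" by (simp add: tail_functions_def)
    then show "tail_functions G n \<noteq> {}" by blast
    fix f assume f: "f \<in> tail_functions G n"
    then have "f \<in> carrier (tail_group G)" by (auto simp: tail_group_def)
    then show "inv\<^bsub>tail_group G\<^esub> f \<in> tail_functions G n" using tail_inv_closed[OF f] by (simp add: tail_inv)
    fix g assume "g \<in> tail_functions G n"
    then show "f \<otimes>\<^bsub>tail_group G\<^esub> g \<in> tail_functions G n"
      using tail_mult_closed[OF f] by (simp add: tail_group_def)
  qed
  \<comment> \<open>Index \<open>m\<close> stands for the point \<open>m - n\<close>, so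
    \<open>m \<le> 2 * n\<close> covers the points from \<open>- n\<close> to \<open>n\<close>;
    further indices carry the trivial homomorphism.\<close>
  let ?e = "\<lambda>m f. if m \<le> 2 * n then f (int m - int n) else \<one>"
  show "countably_has p (tail_group G\<lparr>carrier := tail_functions G n\<rparr>)"
  proof (rule countably_has_joint[OF _ G _ _ _ assms, of _ ?e])
    show "group (tail_group G\<lparr>carrier := tail_functions G n\<rparr>)" by (rule T.K.subgroup_imp_group[OF s])
    show "?e m \<in> hom (tail_group G\<lparr>carrier := tail_functions G n\<rparr>) G" for m
      by (auto simp: hom_def tail_functions_def tail_group_def)
    show "\<exists>k. \<forall>m\<ge>k. ?e m f = \<one>" for f by (rule exI[of _ "Suc (2 * n)"]) auto
    fix f assume "f \<in> carrier (tail_group G\<lparr>carrier := tail_functions G n\<rparr>)" and e: "\<And>m. ?e m f = \<one>"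
    then have f: "f \<in> tail_functions G n" by simp
    have i: "f k = \<one>" if "- int n \<le> k" "k \<le> int n" for k
      using e[of "nat (k + int n)"] that by (simp split: if_splits)
    have "f k = \<one>" for k
    proof -
      consider "k < - int n" | "- int n \<le> k" "k \<le> int n" | "k \<ge> int n" by linarith
      then show ?thesis
      proof cases
        case 3
        then have "f k = f (int n)" using f unfolding tail_functions_def by blast
        then show ?thesis using i by simp
      qed (use f i in \<open>auto simp: tail_functions_def\<close>)
    qed
    then show "f = \<one>\<^bsub>tail_group G\<lparr>carrier := tail_functions G n\<rparr>\<^esub>" by (auto simp: tail_group_def)
  qed
qed

lemma tail_first:
  assumes "f \<in> carrier (tail_group G)" "f \<noteq> \<one>\<^bsub>tail_group G\<^esub>"
  obtains m where "f m \<noteq> \<one>" "\<And>k. k < m \<Longrightarrow> f k = \<one>"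
proof -
  obtain n where n: "f \<in> tail_functions G n" using assms(1) by (auto simp: tail_group_def)
  obtain k where k: "f k \<noteq> \<one>" using assms(2) by (auto simp: tail_group_def)
  have l: "\<not> f j \<noteq> \<one>" if "j < - int n" for j using n that unfolding tail_functions_def by blast
  show ?thesis using first_int[of "\<lambda>k. f k \<noteq> \<one>", OF k l] that by (metis (full_types))
qed

text \<open>The sign of a function is that of its first non-trivial value, which exists because
  functions are trivial near minus infinity. Conjugation acts pointwise and translation only moves
  the first position, so the cone is invariant under both.\<close>

lemma orderable_tail:
  assumes "orderable G"
  shows "orderable (semidirect (tail_group G) translate)"
proof -
  obtain P where P: "cone G P" "conj_invariant G P" using assms orderable_iff[OF G] by blast
  have Pc: "x \<in> carrier G" if "x \<in> P" for x using P(1) that by (auto simp: cone_def)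
  have Pa: "x = \<one>" if "x \<in> P" "inv x \<in> P" for x
    using P(1) that unfolding cone_def by blast
  have P1: "x \<otimes> y \<noteq> \<one>" if "x \<in> P" "y \<in> P" "x \<noteq> \<one>" for x y
  proof
    assume "x \<otimes> y = \<one>"
    then have "inv y = x" using Pc that by (intro inv_equality) auto
    moreover then have "y = \<one>" using Pa[of y] that(1,2) by (simp only: simp_thms)
    ultimately have "x = \<one>" by simp
    then show False using that(3) by simp
  qed
  define pos where "pos m f \<longleftrightarrow> (\<forall>k<m. f k = \<one>) \<and> f m \<in> P \<and> f m \<noteq> \<one>" for m :: int and f
  define R where "R = {f \<in> carrier (tail_group G). f = \<one>\<^bsub>tail_group G\<^esub> \<or> (\<exists>m. pos m f)}"
  show ?thesis
  proof (rule T.orderable_semidirect[of R])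
    show "cone (tail_group G) R"
      unfolding cone_def
    proof (intro conjI ballI impI)
      show "R \<subseteq> carrier (tail_group G)" by (auto simp: R_def)
    next
      fix f g assume f: "f \<in> R" and g: "g \<in> R"
      show "f \<otimes>\<^bsub>tail_group G\<^esub> g \<in> R"
      proof (cases "f = \<one>\<^bsub>tail_group G\<^esub> \<or> g = \<one>\<^bsub>tail_group G\<^esub>")
        case True
        then show ?thesis using f g by (auto simp: R_def)
      next
        case False
        then obtain m n where m: "pos m f" and n: "pos n g" using f g by (auto simp: R_def)
        have fc: "f k \<in> carrier G" "g k \<in> carrier G" for k
          using f g tail_closed by (auto simp: R_def)
        consider "m < n" | "m = n" | "n < m" by linarith
        then have "pos (min m n) (\<lambda>k. f k \<otimes> g k)"
        proof cases
          case 2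
          then show ?thesis using m n P(1) P1 by (auto simp: pos_def cone_def)
        qed (use m n fc in \<open>auto simp: pos_def\<close>)
        moreover have "f \<otimes>\<^bsub>tail_group G\<^esub> g = (\<lambda>k. f k \<otimes> g k)" by (simp add: tail_group_def)
        moreover have "f \<otimes>\<^bsub>tail_group G\<^esub> g \<in> carrier (tail_group G)" using f g by (auto simp: R_def)
        ultimately show ?thesis unfolding R_def by auto
      qed
    next
      fix f assume f: "f \<in> carrier (tail_group G)"
      show "f \<in> R \<or> inv\<^bsub>tail_group G\<^esub> f \<in> R"
      proof (cases "f = \<one>\<^bsub>tail_group G\<^esub>")
        case False
        then obtain m where m: "f m \<noteq> \<one>" "\<And>k. k < m \<Longrightarrow> f k = \<one>" using tail_first[OF f] by blast
        have "f m \<in> P \<or> inv (f m) \<in> P" using P(1) tail_closed[OF f] by (auto simp: cone_def)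
        then have "pos m f \<or> pos m (\<lambda>k. inv (f k))"
          using m tail_closed[OF f] by (auto simp: pos_def)
        moreover have "inv\<^bsub>tail_group G\<^esub> f \<in> carrier (tail_group G)" using f by simp
        ultimately show ?thesis using f unfolding R_def tail_inv[OF f] by blast
      qed (use f in \<open>simp add: R_def\<close>)
    next
      fix f assume f: "f \<in> R" "inv\<^bsub>tail_group G\<^esub> f \<in> R"
      then have fc: "f \<in> carrier (tail_group G)" by (simp add: R_def)
      show "f = \<one>\<^bsub>tail_group G\<^esub>"
      proof (rule ccontr)
        assume n1: "f \<noteq> \<one>\<^bsub>tail_group G\<^esub>"
        then have "inv\<^bsub>tail_group G\<^esub> f \<noteq> \<one>\<^bsub>tail_group G\<^esub>" using fc by simp
        then obtain m n where m: "pos m f" and n: "pos n (\<lambda>k. inv (f k))"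
          using f n1 by (auto simp: R_def tail_inv[OF fc])
        have fk: "f k \<in> carrier G" for k using tail_closed[OF fc] .
        have "m = n"
          using m n fk unfolding pos_def by (metis inv_eq_1_iff linorder_neqE)
        then show False using m n P(1) by (auto simp: pos_def cone_def)
      qed
    qed
    show "conj_invariant (tail_group G) R"
      unfolding conj_invariant_def
    proof (intro ballI)
      fix g f assume g: "g \<in> carrier (tail_group G)" and f: "f \<in> R"
      have fc: "f \<in> carrier (tail_group G)" using f by (simp add: R_def)
      have c: "g \<otimes>\<^bsub>tail_group G\<^esub> f \<otimes>\<^bsub>tail_group G\<^esub> inv\<^bsub>tail_group G\<^esub> g \<in> carrier (tail_group G)"
        using fc g by simp
      show "g \<otimes>\<^bsub>tail_group G\<^esub> f \<otimes>\<^bsub>tail_group G\<^esub> inv\<^bsub>tail_group G\<^esub> g \<in> R"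
      proof (cases "f = \<one>\<^bsub>tail_group G\<^esub>")
        case True
        then show ?thesis using g by (simp add: R_def)
      next
        case False
        then obtain m where m: "pos m f" using f by (auto simp: R_def)
        have e: "g \<otimes>\<^bsub>tail_group G\<^esub> f \<otimes>\<^bsub>tail_group G\<^esub> inv\<^bsub>tail_group G\<^esub> g = (\<lambda>k. g k \<otimes> f k \<otimes> inv (g k))"
          unfolding tail_inv[OF g] by (simp add: tail_group_def)
        have gk: "g k \<in> carrier G" "f k \<in> carrier G" for k using tail_closed g fc by auto
        have "g m \<otimes> f m \<otimes> inv (g m) \<noteq> \<one>"
        proof
          assume "g m \<otimes> f m \<otimes> inv (g m) = \<one>"
          then have "g m \<otimes> f m = g m" using gk inv_solve_right'[of \<one> "g m \<otimes> f m" "g m"] by simp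
          then show False using m gk by (simp add: pos_def)
        qed
        then have "pos m (\<lambda>k. g k \<otimes> f k \<otimes> inv (g k))"
          using m gk P(2) by (auto simp: pos_def conj_invariant_def)
        then show ?thesis using c unfolding R_def e by blast
      qed
    qed
    fix n f assume f: "f \<in> R"
    then have c: "translate n f \<in> carrier (tail_group G)" by (auto simp: R_def)
    show "translate n f \<in> R"
    proof (cases "f = \<one>\<^bsub>tail_group G\<^esub>")
      case True
      then show ?thesis using T.\<alpha>_one by (simp add: R_def)
    next
      case False
      then obtain m where "pos m f" using f by (auto simp: R_def)
      then have "pos (m + n) (translate n f)" by (auto simp: pos_def translate_def)
      then show ?thesis using c by (auto simp: R_def)
    qed
  qed
qed

definition pulse :: "'a \<Rightarrow> int \<Rightarrow> 'a" where "pulse g = (\<lambda>k. if k = 0 then g else \<one>)"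
definition ramp :: "'a \<Rightarrow> int \<Rightarrow> 'a" where "ramp g = (\<lambda>k. if k \<ge> 0 then g else \<one>)"

lemma pulse_mon: "(\<lambda>g. (pulse g, 0)) \<in> mon G (semidirect (tail_group G) translate)"
proof -
  have "pulse g \<in> carrier (tail_group G)" if "g \<in> carrier G" for g
    by (rule tail_functionsI[where a = 0 and b = 1 and c = \<one>]) (use that in \<open>auto simp: pulse_def\<close>)
  then have "pulse \<in> mon G (tail_group G)"
    by (auto simp: mon_def hom_def inj_on_def) (auto simp: pulse_def tail_group_def fun_eq_iff dest: spec[of _ 0])
  then have "(\<lambda>x. (x, 0)) \<circ> pulse \<in> mon G (semidirect (tail_group G) translate)"
    by (rule mon_compose) (rule T.semidirect_incl)
  then show ?thesis by (simp add: o_def)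
qed

text \<open>Conjugation by the translation moves the step from 0 to 1; dividing the original step
  function by the moved one leaves a value at 0 only.\<close>

lemma pulse_commutator:
  assumes g: "g \<in> carrier G"
  defines "L \<equiv> semidirect (tail_group G) translate"
  shows "(pulse g, 0) = (ramp g, 0) \<otimes>\<^bsub>L\<^esub> (\<one>\<^bsub>tail_group G\<^esub>, 1) \<otimes>\<^bsub>L\<^esub> inv\<^bsub>L\<^esub> (ramp g, 0) \<otimes>\<^bsub>L\<^esub> inv\<^bsub>L\<^esub> (\<one>\<^bsub>tail_group G\<^esub>, 1)"
    and "(ramp g, 0) \<in> carrier L" "(\<one>\<^bsub>tail_group G\<^esub>, 1) \<in> carrier L"
proof -
  have r: "ramp g \<in> carrier (tail_group G)"
    by (rule tail_functionsI[where a = 0 and b = 0 and c = g]) (use g in \<open>auto simp: ramp_def\<close>)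
  show "(ramp g, 0) \<in> carrier L" "(\<one>\<^bsub>tail_group G\<^esub>, 1) \<in> carrier L"
    using r by (simp_all add: L_def semidirect_def)
  have i: "inv\<^bsub>L\<^esub> (ramp g, 0) = (\<lambda>k. inv (ramp g k), 0)"
    "inv\<^bsub>L\<^esub> (\<one>\<^bsub>tail_group G\<^esub>, 1) = (\<one>\<^bsub>tail_group G\<^esub>, -1)"
    unfolding L_def using r by (simp_all add: T.semidirect_inv T.zero tail_inv[symmetric])
  show "(pulse g, 0) = (ramp g, 0) \<otimes>\<^bsub>L\<^esub> (\<one>\<^bsub>tail_group G\<^esub>, 1) \<otimes>\<^bsub>L\<^esub> inv\<^bsub>L\<^esub> (ramp g, 0) \<otimes>\<^bsub>L\<^esub> inv\<^bsub>L\<^esub> (\<one>\<^bsub>tail_group G\<^esub>, 1)"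
    unfolding i unfolding L_def semidirect_def
    using g by (auto simp: translate_def tail_group_def pulse_def ramp_def fun_eq_iff)
qed

lemma commutator_embedding:
  assumes "countable (carrier G)"
  obtains L :: "((int \<Rightarrow> 'a) \<times> int) monoid" and h where "group L" "countable (carrier L)" "h \<in> mon G L"
    "\<And>p. p \<noteq> Orderable \<Longrightarrow> countably_has p G \<Longrightarrow> countably_has p L" "orderable G \<Longrightarrow> orderable L"
    "\<And>g. g \<in> carrier G \<Longrightarrow> \<exists>a\<in>carrier L. \<exists>b\<in>carrier L. h g = a \<otimes>\<^bsub>L\<^esub> b \<otimes>\<^bsub>L\<^esub> inv\<^bsub>L\<^esub> a \<otimes>\<^bsub>L\<^esub> inv\<^bsub>L\<^esub> b"
proof
  show "countable (carrier (semidirect (tail_group G) translate))"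
    using countable_tail[OF assms] by (simp add: semidirect_def)
  show "\<exists>a\<in>carrier (semidirect (tail_group G) translate). \<exists>b\<in>carrier (semidirect (tail_group G) translate).
      (pulse g, 0) = a \<otimes>\<^bsub>semidirect (tail_group G) translate\<^esub> b \<otimes>\<^bsub>semidirect (tail_group G) translate\<^esub>
        inv\<^bsub>semidirect (tail_group G) translate\<^esub> a \<otimes>\<^bsub>semidirect (tail_group G) translate\<^esub>
        inv\<^bsub>semidirect (tail_group G) translate\<^esub> b" if "g \<in> carrier G" for g
    using pulse_commutator[OF that] by blast
qed (use T.semidirect_group pulse_mon T.countably_has_semidirect countably_has_tail orderable_tail in auto)

end

lemma countably_has_joint_set:
  assumes K: "group K" and G: "group G" and V: "countable V" and e: "\<And>v. v \<in> V \<Longrightarrow> e v \<in> hom K G"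
    and fin: "\<And>x. x \<in> carrier K \<Longrightarrow> finite {v \<in> V. e v x \<noteq> \<one>\<^bsub>G\<^esub>}"
    and inj: "\<And>x. x \<in> carrier K \<Longrightarrow> (\<And>v. v \<in> V \<Longrightarrow> e v x = \<one>\<^bsub>G\<^esub>) \<Longrightarrow> x = \<one>\<^bsub>K\<^esub>"
    and p: "countably_has p G" "p \<noteq> Orderable"
  shows "countably_has p K"
proof -
  let ?c = "to_nat_on V"
  have cinj: "inj_on ?c V" by (rule inj_on_to_nat_on[OF V])
  \<comment> \<open>Numbers outside the enumeration of \<open>V\<close> get the trivial
    homomorphism.\<close>
  define e' where "e' n x = (if n \<in> ?c ` V then e (inv_into V ?c n) x else \<one>\<^bsub>G\<^esub>)" for n x
  have e'v: "e' (?c v) x = e v x" if "v \<in> V" for v x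
    using that inv_into_f_f[OF cinj that] by (simp add: e'_def)
  show ?thesis
  proof (rule countably_has_joint[OF K G _ _ _ p, of e'])
    show "e' n \<in> hom K G" for n
    proof (cases "n \<in> ?c ` V")
      case True
      then have "e' n = e (inv_into V ?c n)" by (auto simp: e'_def)
      then show ?thesis using e inv_into_into[OF True] by simp
    next
      case False
      interpret G: group G by fact
      show ?thesis using False by (simp add: e'_def hom_def)
    qed
    fix x assume x: "x \<in> carrier K"
    obtain N where N: "\<forall>n\<in>?c ` {v \<in> V. e v x \<noteq> \<one>\<^bsub>G\<^esub>}. n < N"
      using finite_imageI[OF fin[OF x], of ?c] finite_nat_set_iff_bounded by blast
    have "e' n x = \<one>\<^bsub>G\<^esub>" if "n \<ge> N" for n
    proof (rule ccontr)
      assume a: "e' n x \<noteq> \<one>\<^bsub>G\<^esub>"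
      then have "n \<in> ?c ` V" unfolding e'_def by presburger
      then obtain v where v: "v \<in> V" "n = ?c v" by blast
      then have "e v x \<noteq> \<one>\<^bsub>G\<^esub>" using a e'v by simp
      then have "n < N" using N v by blast
      then show False using that by simp
    qed
    then show "\<exists>n. \<forall>m\<ge>n. e' m x = \<one>\<^bsub>G\<^esub>" by blast
    assume "\<And>n. e' n x = \<one>\<^bsub>G\<^esub>"
    then show "x = \<one>\<^bsub>K\<^esub>" using inj[OF x] e'v by metis
  qed
qed

subsection \<open>The tower of wreath products\<close>

locale wreath_tower = group G for G :: "'a monoid" (structure)
begin

lemmas G = group_axioms

text \<open>A vertex of level \<open>i\<close> of the infinite tree is a node restricted to the coordinates below
  \<open>i\<close>; coordinate \<open>i\<close> selects one of its children. The permutation \<open>gen i g\<close> translates the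
  children of the trivial vertex of level \<open>i\<close> by \<open>g\<close>, together with the subtrees below them.\<close>

definition nodes :: "(int \<Rightarrow> 'a) set" where
  "nodes = {x. (\<forall>j. x j \<in> carrier G) \<and> finite {j. x j \<noteq> \<one>}}"

definition gen :: "int \<Rightarrow> 'a \<Rightarrow> (int \<Rightarrow> 'a) \<Rightarrow> int \<Rightarrow> 'a" where
  "gen i g x = (if x \<in> nodes \<and> (\<forall>j<i. x j = \<one>) then x(i := g \<otimes> x i) else x)"

text \<open>Words grow by one generator on the left, and inverses are covered since
  \<open>gen i (inv g)\<close> is again a generator. So facts about the tower can be proved by an
  induction with a single kind of step. \<open>J\<close> is the set of levels on which the group may
  act.\<close>

inductive in_tower :: "int set \<Rightarrow> ((int \<Rightarrow> 'a) \<Rightarrow> int \<Rightarrow> 'a) \<Rightarrow> bool" for J where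
  id: "in_tower J id"
| step: "in_tower J w \<Longrightarrow> i \<in> J \<Longrightarrow> g \<in> carrier G \<Longrightarrow> in_tower J (gen i g \<circ> w)"

definition tower_set :: "int set \<Rightarrow> ((int \<Rightarrow> 'a) \<Rightarrow> int \<Rightarrow> 'a) set" where
  "tower_set J = {w. in_tower J w}"

lemma tower_set_id: "id \<in> tower_set J"
  by (simp add: tower_set_def in_tower.id)

lemma tower_set_step:
  "w \<in> tower_set J \<Longrightarrow> i \<in> J \<Longrightarrow> g \<in> carrier G \<Longrightarrow> gen i g \<circ> w \<in> tower_set J"
  by (simp add: tower_set_def in_tower.step)

lemma tower_set_induct [consumes 1, case_names id step]:
  assumes "w \<in> tower_set J" and "P id"
    and "\<And>w i g. w \<in> tower_set J \<Longrightarrow> i \<in> J \<Longrightarrow> g \<in> carrier G \<Longrightarrow> P w \<Longrightarrow> P (gen i g \<circ> w)"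
  shows "P w"
proof -
  have "in_tower J w" using assms(1) by (simp add: tower_set_def)
  then show ?thesis
    by (induction rule: in_tower.induct) (use assms(2,3) in \<open>auto simp: tower_set_def id_def comp_def\<close>)
qed

definition tower :: "int set \<Rightarrow> ((int \<Rightarrow> 'a) \<Rightarrow> int \<Rightarrow> 'a) monoid" where
  "tower J = \<lparr>carrier = tower_set J, monoid.mult = (\<circ>), one = id\<rparr>"

lemma nodes_closed: "x \<in> nodes \<Longrightarrow> x j \<in> carrier G"
  by (simp add: nodes_def)

lemma nodes_upd: "x \<in> nodes \<Longrightarrow> a \<in> carrier G \<Longrightarrow> x(i := a) \<in> nodes"
proof -
  assume x: "x \<in> nodes" "a \<in> carrier G"
  have "{j. (x(i := a)) j \<noteq> \<one>} \<subseteq> insert i {j. x j \<noteq> \<one>}" by auto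
  moreover have "finite (insert i {j. x j \<noteq> \<one>})" using x by (simp add: nodes_def)
  ultimately have "finite {j. (x(i := a)) j \<noteq> \<one>}" by (rule finite_subset)
  then show ?thesis using x by (simp add: nodes_def)
qed

lemma one_node: "(\<lambda>_. \<one>) \<in> nodes"
  by (simp add: nodes_def)

lemma gen_nodes: "x \<in> nodes \<Longrightarrow> g \<in> carrier G \<Longrightarrow> gen i g x \<in> nodes"
  by (simp add: gen_def nodes_upd nodes_closed)

lemma gen_comp: "g \<in> carrier G \<Longrightarrow> h \<in> carrier G \<Longrightarrow> gen i g \<circ> gen i h = gen i (g \<otimes> h)"
  by (auto simp: gen_def fun_eq_iff nodes_upd nodes_closed m_assoc)

lemma gen_one: "gen i \<one> = id"
  by (auto simp: gen_def fun_eq_iff nodes_closed)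

lemma tower_nodes: "w \<in> tower_set J \<Longrightarrow> x \<in> nodes \<Longrightarrow> w x \<in> nodes"
  by (induction rule: tower_set_induct) (auto simp: gen_nodes)

lemma tower_outside: "w \<in> tower_set J \<Longrightarrow> x \<notin> nodes \<Longrightarrow> w x = x"
  by (induction rule: tower_set_induct) (auto simp: gen_def)

lemma tower_comp: "u \<in> tower_set J \<Longrightarrow> w \<in> tower_set J \<Longrightarrow> u \<circ> w \<in> tower_set J"
  by (induction rule: tower_set_induct) (auto simp: comp_assoc intro: tower_set_step)

lemma gen_tower: "i \<in> J \<Longrightarrow> g \<in> carrier G \<Longrightarrow> gen i g \<in> tower_set J"
  using tower_set_step[OF tower_set_id, of i J g] by simp

lemma tower_mono: "J \<subseteq> J' \<Longrightarrow> tower_set J \<subseteq> tower_set J'"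
proof
  fix w assume "w \<in> tower_set J" "J \<subseteq> J'"
  then show "w \<in> tower_set J'" by (induction rule: tower_set_induct) (auto intro: tower_set_id tower_set_step)
qed

lemma tower_inverse: "w \<in> tower_set J \<Longrightarrow> \<exists>u\<in>tower_set J. u \<circ> w = id \<and> w \<circ> u = id"
proof (induction rule: tower_set_induct)
  case id
  then show ?case by (intro bexI[of _ id]) (auto intro: tower_set_id)
next
  case (step w i g)
  then obtain u where u: "u \<in> tower_set J" "u \<circ> w = id" "w \<circ> u = id" by blast
  have g: "gen i (inv g) \<circ> gen i g = id" "gen i g \<circ> gen i (inv g) = id"
    using step by (simp_all add: gen_comp gen_one)
  have "u \<circ> gen i (inv g) \<in> tower_set J" using u step by (intro tower_comp gen_tower) auto
  moreover have "(u \<circ> gen i (inv g)) \<circ> (gen i g \<circ> w) = id" "(gen i g \<circ> w) \<circ> (u \<circ> gen i (inv g)) = id"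
    using u g by (metis comp_assoc id_comp)+
  ultimately show ?case by blast
qed

lemma tower_finite_levels: "w \<in> tower_set UNIV \<Longrightarrow> \<exists>n. w \<in> tower_set {- int n..<int n}"
proof (induction rule: tower_set_induct)
  case id
  then show ?case by (blast intro: tower_set_id)
next
  case (step w i g)
  then obtain n where n: "w \<in> tower_set {- int n..<int n}" by blast
  let ?m = "max n (Suc (nat \<bar>i\<bar>))"
  have "w \<in> tower_set {- int ?m..<int ?m}"
    using n tower_mono[of "{- int n..<int n}" "{- int ?m..<int ?m}"] by auto
  moreover have "i \<in> {- int ?m..<int ?m}" by auto
  ultimately show ?case using step by (blast intro: tower_set_step)
qed

lemma tower_group: "group (tower J)"
  by (rule groupI)
    (use tower_inverse in \<open>auto simp: tower_def intro: tower_comp tower_set_id simp: comp_assoc\<close>)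

lemma tower_inv:
  assumes "w \<in> tower_set J"
  shows "inv\<^bsub>tower J\<^esub> w \<in> tower_set J" "inv\<^bsub>tower J\<^esub> w \<circ> w = id" "w \<circ> inv\<^bsub>tower J\<^esub> w = id"
  using group.inv_closed[OF tower_group, of w J] group.l_inv[OF tower_group, of w J]
    group.r_inv[OF tower_group, of w J] assms by (auto simp: tower_def)

lemma tower_subgroup: "J \<subseteq> J' \<Longrightarrow> subgroup (tower_set J) (tower J')"
proof (rule group.subgroupI[OF tower_group])
  assume J: "J \<subseteq> J'"
  show "tower_set J \<subseteq> carrier (tower J')" using tower_mono[OF J] by (simp add: tower_def)
  show "tower_set J \<noteq> {}" using tower_set_id by blast
  show "u \<otimes>\<^bsub>tower J'\<^esub> w \<in> tower_set J" if "u \<in> tower_set J" "w \<in> tower_set J" for u w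
    using that by (simp add: tower_def tower_comp)
  fix w assume w: "w \<in> tower_set J"
  then obtain u where u: "u \<in> tower_set J" "u \<circ> w = id" using tower_inverse by blast
  have "inv\<^bsub>tower J'\<^esub> w = u"
    by (rule group.inv_equality[OF tower_group]) (use u w tower_mono[OF J] in \<open>auto simp: tower_def\<close>)
  then show "inv\<^bsub>tower J'\<^esub> w \<in> tower_set J" using u by simp
qed

text \<open>\<open>port w i x\<close> is the label in \<open>G\<close> by which \<open>w\<close> translates the children of the vertex of level
  \<open>i\<close> below which \<open>x\<close> lies. That it only depends on this vertex is \<open>tower_agree_port\<close> below.\<close>

definition port :: "((int \<Rightarrow> 'a) \<Rightarrow> int \<Rightarrow> 'a) \<Rightarrow> int \<Rightarrow> (int \<Rightarrow> 'a) \<Rightarrow> 'a" where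
  "port w i x = w x i \<otimes> inv (x i)"

definition agree :: "int \<Rightarrow> (int \<Rightarrow> 'a) \<Rightarrow> (int \<Rightarrow> 'a) \<Rightarrow> bool" where
  "agree i x y \<longleftrightarrow> (\<forall>j<i. x j = y j)"

lemma agree_sym: "agree i x y \<Longrightarrow> agree i y x" by (simp add: agree_def)
lemma agree_trans: "agree i x y \<Longrightarrow> agree i y z \<Longrightarrow> agree i x z" by (simp add: agree_def)
lemma agree_le: "agree i x y \<Longrightarrow> j \<le> i \<Longrightarrow> agree j x y" by (simp add: agree_def)

lemma port_closed: "w \<in> tower_set J \<Longrightarrow> x \<in> nodes \<Longrightarrow> port w i x \<in> carrier G"
  using tower_nodes nodes_closed by (simp add: port_def)

lemma port_apply: "w \<in> tower_set J \<Longrightarrow> x \<in> nodes \<Longrightarrow> w x i = port w i x \<otimes> x i"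
  using tower_nodes nodes_closed by (simp add: port_def m_assoc)

text \<open>The cocycle rule: \<open>w\<close> moves the vertex first, and the label of
  \<open>u\<close> is taken at its new place.\<close>

lemma port_comp:
  "u \<in> tower_set J \<Longrightarrow> w \<in> tower_set J' \<Longrightarrow> x \<in> nodes \<Longrightarrow> port (u \<circ> w) i x = port u i (w x) \<otimes> port w i x"
proof -
  assume a: "u \<in> tower_set J" "w \<in> tower_set J'" "x \<in> nodes"
  have c: "w x i \<in> carrier G" "u (w x) i \<in> carrier G" "x i \<in> carrier G"
    using a tower_nodes nodes_closed by blast+
  have "inv (w x i) \<otimes> (w x i \<otimes> inv (x i)) = inv (x i)" using c by (simp flip: m_assoc)
  then show ?thesis using c by (simp add: port_def m_assoc)
qed

lemma port_id: "x \<in> nodes \<Longrightarrow> port id i x = \<one>"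
  using nodes_closed by (simp add: port_def)

lemmas port_comp' = port_comp[unfolded comp_def] and port_id' = port_id[unfolded id_def]

lemma port_gen: "x \<in> nodes \<Longrightarrow> g \<in> carrier G \<Longrightarrow>
    port (gen j g) i x = (if i = j \<and> (\<forall>l<i. x l = \<one>) then g else \<one>)"
  using nodes_closed[of x] by (auto simp: port_def gen_def m_assoc)

text \<open>Elements of the tower are automorphisms of the tree. Both claims are proved together
  because the coordinates of \<open>w x\<close> below \<open>i\<close> are given by the labels on
  lower levels.\<close>

lemma tower_agree_port:
  assumes "w \<in> tower_set J" "x \<in> nodes" "y \<in> nodes" "agree i x y"
  shows "agree i (w x) (w y) \<and> port w i x = port w i y"
  using assms
proof (induction arbitrary: i rule: tower_set_induct)
  case id
  then show ?case by (simp add: port_id port_id')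
next
  case (step w k g)
  have wx: "w x \<in> nodes" "w y \<in> nodes" using step tower_nodes by blast+
  have gt: "gen k g \<in> tower_set J" using step gen_tower by blast
  \<comment> \<open>Levels below \<open>i\<close> serve the agreement, level \<open>i\<close> itself
    serves the label; hence \<open>j \<le> i\<close>.\<close>
  have pg: "port (gen k g) j (w x) = port (gen k g) j (w y)" if "j \<le> i" for j
  proof -
    have "agree j (w x) (w y)" using step.IH[of j] step.prems agree_le[OF step.prems(3) that] by blast
    then show ?thesis using wx step.hyps by (simp add: port_gen agree_def)
  qed
  have ag: "agree i (w x) (w y)" and pw: "port w i x = port w i y" using step by blast+
  have "agree i (gen k g (w x)) (gen k g (w y))"
    unfolding agree_def
  proof (intro allI impI)
    fix j assume "j < i"
    then have "w x j = w y j" "port (gen k g) j (w x) = port (gen k g) j (w y)"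
      using ag pg[of j] by (auto simp: agree_def)
    then show "gen k g (w x) j = gen k g (w y) j"
      using port_apply[OF gt wx(1), of j] port_apply[OF gt wx(2), of j] by simp
  qed
  moreover have "port (gen k g \<circ> w) i x = port (gen k g \<circ> w) i y"
    using port_comp[OF gt step.hyps(1)] step.prems pg[of i] pw by simp
  ultimately show ?case by (simp add: comp_def)
qed

lemmas tower_agree = tower_agree_port[THEN conjunct1]
lemmas port_cong = tower_agree_port[THEN conjunct2]

lemma port_outside: "w \<in> tower_set J \<Longrightarrow> i \<notin> J \<Longrightarrow> x \<in> nodes \<Longrightarrow> port w i x = \<one>"
proof (induction rule: tower_set_induct)
  case id
  then show ?case by (simp add: port_id port_id')
next
  case (step w k g)
  have "gen k g \<in> tower_set J" using step gen_tower by blast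
  moreover have "w x \<in> nodes" using step tower_nodes by blast
  moreover have "i \<noteq> k" using step by blast
  ultimately show ?case using step by (simp add: port_comp port_comp' port_gen)
qed

lemma tower_eq_id:
  assumes w: "w \<in> tower_set J" and p: "\<And>x i. x \<in> nodes \<Longrightarrow> port w i x = \<one>"
  shows "w = id"
proof
  fix x show "w x = id x"
  proof (cases "x \<in> nodes")
    case True
    have "w x i = x i" for i using port_apply[OF w True, of i] p[OF True] nodes_closed[OF True] by simp
    then show ?thesis by auto
  qed (use tower_outside[OF w] in simp)
qed

text \<open>A canonical node below the vertex of level \<open>i\<close> that contains
  \<open>x\<close>; through it, sets of vertices become sets of nodes.\<close>

definition trunc :: "int \<Rightarrow> (int \<Rightarrow> 'a) \<Rightarrow> int \<Rightarrow> 'a" where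
  "trunc i x = (\<lambda>j. if j < i then x j else \<one>)"

lemma trunc_nodes: "x \<in> nodes \<Longrightarrow> trunc i x \<in> nodes"
proof -
  assume x: "x \<in> nodes"
  have "{j. trunc i x j \<noteq> \<one>} \<subseteq> {j. x j \<noteq> \<one>}" by (auto simp: trunc_def)
  moreover have "finite {j. x j \<noteq> \<one>}" using x by (simp add: nodes_def)
  ultimately have "finite {j. trunc i x j \<noteq> \<one>}" by (rule finite_subset)
  then show ?thesis using x by (simp add: nodes_def trunc_def)
qed

lemma agree_trunc: "agree i x (trunc i x)" by (simp add: agree_def trunc_def)

lemma trunc_eq_iff: "trunc i x = trunc i y \<longleftrightarrow> agree i x y"
  by (auto simp: agree_def trunc_def fun_eq_iff)

text \<open>This is what makes the wreath products restricted. A generator put in front of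
  \<open>w\<close> can change labels on level \<open>i\<close> only at the single vertex that
  \<open>w\<close> carries to the trivial vertex of this level.\<close>

lemma finite_portrait: "w \<in> tower_set J \<Longrightarrow> finite {trunc i x |x. x \<in> nodes \<and> port w i x \<noteq> \<one>}"
proof (induction rule: tower_set_induct)
  case id
  have "{trunc i x |x. x \<in> nodes \<and> port id i x \<noteq> \<one>} = {}" by (auto simp: port_id port_id')
  then show ?case by (simp only: id_def finite.emptyI)
next
  case (step w k g)
  let ?S = "{trunc i x |x. x \<in> nodes \<and> port w i x \<noteq> \<one>}"
  let ?T = "{trunc i x |x. x \<in> nodes \<and> agree i (w x) (\<lambda>_. \<one>)}"
  obtain u where u: "u \<in> tower_set J" "u \<circ> w = id" using tower_inverse[OF step.hyps(1)] by blast
  have uw: "u (w x) = x" for x using u(2) by (metis comp_apply id_apply)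
  have "s = t" if "s \<in> ?T" "t \<in> ?T" for s t
  proof -
    obtain x y where x: "s = trunc i x" "x \<in> nodes" "agree i (w x) (\<lambda>_. \<one>)"
      and y: "t = trunc i y" "y \<in> nodes" "agree i (w y) (\<lambda>_. \<one>)" using \<open>s \<in> ?T\<close> \<open>t \<in> ?T\<close> by blast
    have "agree i (w x) (w y)" using x y by (simp add: agree_def)
    then have "agree i (u (w x)) (u (w y))"
      using tower_agree[OF u(1)] tower_nodes[OF step.hyps(1)] x y by blast
    then show ?thesis using x(1) y(1) by (simp add: uw trunc_eq_iff)
  qed
  \<comment> \<open>At most one element, expressed as inclusion in a singleton to obtain
    finiteness.\<close>
  then have "?T \<subseteq> {SOME t. t \<in> ?T}" by (metis (no_types, lifting) insertCI someI subsetI)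
  then have fT: "finite ?T" by (rule finite_subset) simp
  have "{trunc i x |x. x \<in> nodes \<and> port (gen k g \<circ> w) i x \<noteq> \<one>} \<subseteq> ?S \<union> ?T"
  proof
    fix s assume "s \<in> {trunc i x |x. x \<in> nodes \<and> port (gen k g \<circ> w) i x \<noteq> \<one>}"
    then obtain x where x: "s = trunc i x" "x \<in> nodes" "port (gen k g \<circ> w) i x \<noteq> \<one>" by blast
    have gt: "gen k g \<in> tower_set J" using step gen_tower by blast
    have "port (gen k g) i (w x) \<otimes> port w i x \<noteq> \<one>"
      using x(3) port_comp[OF gt step.hyps(1) x(2)] by simp
    moreover have "port (gen k g) i (w x) = \<one>" if "\<not> agree i (w x) (\<lambda>_. \<one>)"
      using that port_gen[OF tower_nodes[OF step.hyps(1) x(2)] step.hyps(3)] by (auto simp: agree_def)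
    ultimately have "port w i x \<noteq> \<one> \<or> agree i (w x) (\<lambda>_. \<one>)" by fastforce
    then show "s \<in> ?S \<union> ?T" using x by blast
  qed
  then have "finite {trunc i x |x. x \<in> nodes \<and> port (gen k g \<circ> w) i x \<noteq> \<one>}"
    using step.IH fT by (meson finite_UnI finite_subset)
  then show ?case by (simp add: comp_def)
qed

section \<open>Cutting off levels: the tower as an iterated extension\<close>

definition cut :: "int \<Rightarrow> ((int \<Rightarrow> 'a) \<Rightarrow> int \<Rightarrow> 'a) \<Rightarrow> (int \<Rightarrow> 'a) \<Rightarrow> int \<Rightarrow> 'a" where
  "cut i w x = (if x \<in> nodes then (\<lambda>j. if j < i then w x j else x j) else x)"

lemma cut_nodes: "w \<in> tower_set J \<Longrightarrow> x \<in> nodes \<Longrightarrow> cut i w x \<in> nodes"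
proof -
  assume w: "w \<in> tower_set J" and x: "x \<in> nodes"
  have "{j. cut i w x j \<noteq> \<one>} \<subseteq> {j. w x j \<noteq> \<one>} \<union> {j. x j \<noteq> \<one>}" by (auto simp: cut_def)
  moreover have "finite ({j. w x j \<noteq> \<one>} \<union> {j. x j \<noteq> \<one>})"
    using x tower_nodes[OF w x] by (simp add: nodes_def)
  ultimately have "finite {j. cut i w x j \<noteq> \<one>}" by (rule finite_subset)
  moreover have "cut i w x j \<in> carrier G" for j
    using nodes_closed[OF x] nodes_closed[OF tower_nodes[OF w x]] x by (simp add: cut_def)
  ultimately show ?thesis by (simp add: nodes_def)
qed

text \<open>By \<open>tower_agree\<close> the coordinates of \<open>u y\<close> below
  \<open>i\<close> depend only on those of \<open>y\<close>, so resetting the upper coordinates of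
  \<open>w x\<close> before applying \<open>u\<close> does no harm.\<close>

lemma cut_comp:
  assumes u: "u \<in> tower_set J" and w: "w \<in> tower_set J'"
  shows "cut i (u \<circ> w) = cut i u \<circ> cut i w"
proof
  fix x show "cut i (u \<circ> w) x = (cut i u \<circ> cut i w) x"
  proof (cases "x \<in> nodes")
    case True
    have "agree i (w x) (cut i w x)" using True by (simp add: agree_def cut_def)
    then have "agree i (u (w x)) (u (cut i w x))"
      using tower_agree[OF u tower_nodes[OF w True] cut_nodes[OF w True]] by blast
    then show ?thesis using True cut_nodes[OF w True, of i]
      by (auto simp: cut_def agree_def fun_eq_iff)
  qed (simp add: cut_def)
qed

lemma cut_gen: "g \<in> carrier G \<Longrightarrow> cut i (gen j g) = (if j < i then gen j g else id)"
  by (auto simp: cut_def gen_def fun_eq_iff)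

text \<open>On words, \<open>cut i\<close> keeps the generators of level below \<open>i\<close> and
  erases the others.\<close>

lemma cut_tower: "w \<in> tower_set J \<Longrightarrow> cut i w \<in> tower_set {j \<in> J. j < i}"
proof (induction rule: tower_set_induct)
  case id
  have "cut i id = id" by (auto simp: cut_def fun_eq_iff)
  then show ?case using tower_set_id by (simp add: id_def)
next
  case (step w k g)
  have "gen k g \<in> tower_set J" using step gen_tower by blast
  then have "cut i (gen k g \<circ> w) = cut i (gen k g) \<circ> cut i w" using cut_comp step by blast
  then have "cut i (gen k g \<circ> w) \<in> tower_set {j \<in> J. j < i}"
    using step by (auto simp: cut_gen intro: tower_set_step)
  then show ?case by (simp add: comp_def)
qed

text \<open>Nodes are tail functions with final value \<one>; their countability is inherited from
  there.\<close>

lemma nodes_tail: "nodes \<subseteq> carrier (tail_group G)"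
proof
  fix x assume x: "x \<in> nodes"
  have "finite ((\<lambda>j. nat \<bar>j\<bar>) ` {j. x j \<noteq> \<one>})" using x by (simp add: nodes_def)
  then obtain n where n: "\<forall>m\<in>(\<lambda>j. nat \<bar>j\<bar>) ` {j. x j \<noteq> \<one>}. m < n"
    using finite_nat_set_iff_bounded by blast
  have "x j = \<one>" if "\<bar>j\<bar> \<ge> int n" for j
  proof (rule ccontr)
    assume "x j \<noteq> \<one>"
    then have "nat \<bar>j\<bar> < n" using n by blast
    then show False using that by simp
  qed
  then show "x \<in> carrier (tail_group G)"
    by (intro tail_functionsI[where a = "- int n" and b = "int n" and c = \<one>]) (use x in \<open>auto simp: nodes_def\<close>)
qed

lemma countable_nodes: "countable (carrier G) \<Longrightarrow> countable nodes"
  using countable_subset[OF nodes_tail countable_tail[OF G]] .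

lemma countable_tower: "countable (carrier G) \<Longrightarrow> countable (tower_set J)"
proof -
  assume c: "countable (carrier G)"
  let ?f = "\<lambda>l. foldr (\<lambda>(i, g) w. gen i g \<circ> w) l id"
  have "tower_set J \<subseteq> ?f ` lists (UNIV \<times> carrier G)"
  proof
    fix w assume "w \<in> tower_set J"
    then show "w \<in> ?f ` lists (UNIV \<times> carrier G)"
    proof (induction rule: tower_set_induct)
      case id
      show ?case by (rule image_eqI[of _ _ "[]"]) auto
    next
      case (step w i g)
      then obtain l where "w = ?f l" "l \<in> lists (UNIV \<times> carrier G)" by blast
      then show ?case using step(3) by (intro image_eqI[of _ _ "(i, g) # l"]) (simp_all add: comp_def id_def)
    qed
  qed
  moreover have "countable (lists ((UNIV :: int set) \<times> carrier G))" using c by simp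
  ultimately show ?thesis by (meson countable_image countable_subset)
qed

text \<open>\<open>cut i\<close> splits off the top level. Elements of its kernel fix every vertex
  of level \<open>i\<close>, so the label at each such vertex is a homomorphism to \<open>G\<close>.
  Almost all labels of an element are trivial and together they determine it, so the kernel embeds
  into a direct sum of copies of \<open>G\<close>.\<close>

lemma countably_has_level:
  assumes c: "countable (carrier G)" and p: "countably_has p G" "p \<noteq> Orderable"
    and less: "\<And>j. j \<in> J \<Longrightarrow> j < i" and IH: "countably_has p (tower J)"
  shows "countably_has p (tower (insert i J))"
proof (rule countably_has_ext[OF tower_group tower_group _ IH _ p(2)])
  let ?J = "insert i J"
  have J: "{j \<in> ?J. j < i} = J" using less by auto
  show "cut i \<in> hom (tower ?J) (tower J)"
    using cut_tower[of _ ?J i] cut_comp[of _ ?J _ ?J i] unfolding J by (auto simp: hom_def tower_def)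
  let ?K = "tower ?J\<lparr>carrier := kernel (tower ?J) (tower J) (cut i)\<rparr>"
  have Kg: "group ?K"
    by (intro group.subgroup_imp_group tower_group group_hom.subgroup_kernel group_homI) fact
  have K: "w \<in> carrier ?K \<longleftrightarrow> w \<in> tower_set ?J \<and> cut i w = id" for w
    by (auto simp: kernel_def tower_def)
  have Kag: "agree i (w x) x" if "w \<in> carrier ?K" "x \<in> nodes" for w x
  proof -
    have c: "cut i w x = x" using that(1) K by simp
    show ?thesis unfolding agree_def
    proof (intro allI impI)
      fix j assume "j < i"
      then have "cut i w x j = w x j" using that(2) by (simp add: cut_def)
      then show "w x j = x j" using c by simp
    qed
  qed
  let ?V = "trunc i ` nodes"
  show "countably_has p ?K"
  proof (rule countably_has_joint_set[OF Kg G _ _ _ _ p, of ?V "\<lambda>v w. port w i v"])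
    show "countable ?V" using countable_nodes[OF c] by simp
    show "(\<lambda>w. port w i v) \<in> hom ?K G" if "v \<in> ?V" for v
      unfolding hom_def
    proof (intro CollectI conjI funcsetI ballI)
      have v: "v \<in> nodes" using that trunc_nodes by auto
      show "port w i v \<in> carrier G" if "w \<in> carrier ?K" for w
        using that K port_closed[OF _ v] by blast
      fix u w assume u: "u \<in> carrier ?K" and w: "w \<in> carrier ?K"
      have ut: "u \<in> tower_set ?J" and wt: "w \<in> tower_set ?J" using u w K by blast+
      \<comment> \<open>Since \<open>w\<close> fixes the vertex of \<open>v\<close>, the cocycle
        rule becomes plain multiplicativity.\<close>
      have "port u i (w v) = port u i v"
        by (rule port_cong[OF ut tower_nodes[OF wt v] v Kag[OF w v]])
      then show "port (u \<otimes>\<^bsub>?K\<^esub> w) i v = port u i v \<otimes> port w i v"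
        using port_comp[OF ut wt v] by (simp add: tower_def)
    qed
    fix w assume w: "w \<in> carrier ?K"
    then have wt: "w \<in> tower_set ?J" using K by blast
    have "{v \<in> ?V. port w i v \<noteq> \<one>} \<subseteq> {trunc i x |x. x \<in> nodes \<and> port w i x \<noteq> \<one>}"
    proof
      fix v assume v: "v \<in> {v \<in> ?V. port w i v \<noteq> \<one>}"
      then obtain x where x: "x \<in> nodes" "v = trunc i x" by blast
      have "trunc i v = v" using x(2) by (auto simp: trunc_def)
      then show "v \<in> {trunc i x |x. x \<in> nodes \<and> port w i x \<noteq> \<one>}"
        using v x trunc_nodes by (metis (mono_tags, lifting) mem_Collect_eq)
    qed
    then show "finite {v \<in> ?V. port w i v \<noteq> \<one>}" using finite_portrait[OF wt] finite_subset by blast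
    assume triv: "\<And>v. v \<in> ?V \<Longrightarrow> port w i v = \<one>"
    have "w = id"
    proof (rule tower_eq_id[OF wt])
      fix x j assume x: "x \<in> nodes"
      \<comment> \<open>Below \<open>i\<close> the element acts trivially as it lies in the kernel,
        on level \<open>i\<close> by assumption, and above \<open>i\<close> there are no
        generators.\<close>
      consider "j < i" | "j = i" | "i < j" by linarith
      then show "port w j x = \<one>"
      proof cases
        case 1
        then have "w x j = x j" using Kag[OF w x] by (simp add: agree_def)
        then show ?thesis using nodes_closed[OF x] by (simp add: port_def)
      next
        case 2
        have "port w i x = port w i (trunc i x)"
          by (rule port_cong[OF wt x trunc_nodes[OF x] agree_trunc])
        also have "\<dots> = \<one>" by (rule triv) (use x in simp)
        finally show ?thesis using 2 by simp
      next
        case 3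
        then have "j \<notin> ?J" using less[of j] by auto
        then show ?thesis by (rule port_outside[OF wt _ x])
      qed
    qed
    then show "w = \<one>\<^bsub>?K\<^esub>" by (simp add: tower_def)
  qed
qed

text \<open>A finite interval of levels is built up by adding one level on top at a time; the
  symmetric intervals exhaust all levels.\<close>

lemma countably_has_tower:
  assumes c: "countable (carrier G)" and p: "countably_has p G" "p \<noteq> Orderable"
  shows "countably_has p (tower UNIV)"
proof -
  have fin: "countably_has p (tower {m..<m + int k})" for m k
  proof (induction k)
    case 0
    have "w = id" if "w \<in> tower_set {}" for w using that by (induction rule: tower_set_induct) auto
    then have "carrier (tower {}) = {\<one>\<^bsub>tower {}\<^esub>}" using tower_set_id by (auto simp: tower_def)
    then show ?case using countably_has_trivial[OF _ tower_group] by simp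
  next
    case (Suc k)
    have "{m..<m + int (Suc k)} = insert (m + int k) {m..<m + int k}" by auto
    then show ?case using countably_has_level[OF c p _ Suc] by simp
  qed
  show ?thesis
  proof (rule countably_has_Un[OF tower_group])
    show "subgroup (tower_set {- int n..<int n}) (tower UNIV)" for n by (rule tower_subgroup) simp
    show "tower_set {- int n..<int n} \<subseteq> tower_set {- int (Suc n)..<int (Suc n)}" for n
      by (rule tower_mono) auto
    show "(\<Union>n. tower_set {- int n..<int n}) = carrier (tower UNIV)"
      using tower_finite_levels tower_mono[of _ UNIV] by (auto simp: tower_def)
    fix n
    have "{- int n..<int n} = {- int n..<- int n + int (2 * n)}" by simp
    moreover have "tower UNIV\<lparr>carrier := tower_set {- int n..<int n}\<rparr> = tower {- int n..<int n}"
      by (simp add: tower_def)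
    ultimately show "countably_has p (tower UNIV\<lparr>carrier := tower_set {- int n..<int n}\<rparr>)"
      using fin[of "- int n" "2 * n"] by simp
  qed
qed

section \<open>Shifting the levels\<close>

lemma translate_translate: "translate m (translate n x) = translate (m + n) x"
  by (simp add: translate_def algebra_simps)

lemma translate_zero: "translate 0 x = x"
  by (simp add: translate_def)

lemma translate_nodes: "translate n x \<in> nodes \<longleftrightarrow> x \<in> nodes"
proof -
  have *: "translate n x \<in> nodes" if x: "x \<in> nodes" for n x
  proof -
    have "{j. translate n x j \<noteq> \<one>} = (\<lambda>j. j + n) ` {j. x j \<noteq> \<one>}"
    proof (intro equalityI subsetI)
      fix j assume "j \<in> {j. translate n x j \<noteq> \<one>}"
      then show "j \<in> (\<lambda>j. j + n) ` {j. x j \<noteq> \<one>}"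
        by (intro image_eqI[of _ _ "j - n"]) (simp_all add: translate_def)
    qed (auto simp: translate_def)
    then show ?thesis using x by (simp add: nodes_def) (simp add: translate_def)
  qed
  show ?thesis using *[of x n] *[of "translate n x" "- n"] by (auto simp: translate_translate translate_zero)
qed

lemma gen_other: "\<not> (x \<in> nodes \<and> (\<forall>j<i. x j = \<one>)) \<Longrightarrow> gen i g x = x"
  unfolding gen_def by (rule if_not_P)

lemma gen_node: "x \<in> nodes \<and> (\<forall>j<i. x j = \<one>) \<Longrightarrow> gen i g x = x(i := g \<otimes> x i)"
  unfolding gen_def by (rule if_P)

definition conj_shift :: "int \<Rightarrow> ((int \<Rightarrow> 'a) \<Rightarrow> int \<Rightarrow> 'a) \<Rightarrow> (int \<Rightarrow> 'a) \<Rightarrow> int \<Rightarrow> 'a" where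
  "conj_shift n w = (\<lambda>x. translate n (w (translate (- n) x)))"

lemma conj_shift_comp: "conj_shift n (u \<circ> w) = conj_shift n u \<circ> conj_shift n w"
  by (simp add: conj_shift_def fun_eq_iff translate_translate translate_zero)

text \<open>Translation carries the trivial vertex of level \<open>i\<close> to that of level
  \<open>i + n\<close>.\<close>

lemma conj_shift_gen:
  assumes "g \<in> carrier G"
  shows "conj_shift n (gen i g) = gen (i + n) g"
proof
  fix x
  have iff: "(\<forall>j<i. translate (- n) x j = \<one>) \<longleftrightarrow> (\<forall>j<i + n. x j = \<one>)"
  proof
    assume l: "\<forall>j<i. translate (- n) x j = \<one>"
    show "\<forall>j<i + n. x j = \<one>"
    proof (intro allI impI)
      fix j assume "j < i + n"
      then have "translate (- n) x (j - n) = \<one>" using l by simp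
      then show "x j = \<one>" by (simp add: translate_def)
    qed
  qed (simp add: translate_def)
  show "conj_shift n (gen i g) x = gen (i + n) g x"
  proof (cases "x \<in> nodes \<and> (\<forall>j<i + n. x j = \<one>)")
    case True
    then have "translate (- n) x \<in> nodes \<and> (\<forall>j<i. translate (- n) x j = \<one>)"
      unfolding iff translate_nodes .
    then have "gen i g (translate (- n) x) = (translate (- n) x)(i := g \<otimes> translate (- n) x i)"
      by (rule gen_node)
    then have "conj_shift n (gen i g) x = x(i + n := g \<otimes> x (i + n))"
      by (auto simp: conj_shift_def translate_def fun_eq_iff)
    then show ?thesis using True by (simp add: gen_def)
  next
    case False
    then have "\<not> (translate (- n) x \<in> nodes \<and> (\<forall>j<i. translate (- n) x j = \<one>))"
      unfolding iff translate_nodes .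
    then have "gen i g (translate (- n) x) = translate (- n) x"
      by (rule gen_other)
    moreover have "gen (i + n) g x = x" using False by (rule gen_other)
    ultimately show ?thesis by (simp add: conj_shift_def translate_translate translate_zero)
  qed
qed

lemma conj_shift_tower: "w \<in> tower_set UNIV \<Longrightarrow> conj_shift n w \<in> tower_set UNIV"
proof (induction rule: tower_set_induct)
  case id
  have "conj_shift n id = id" by (simp add: conj_shift_def fun_eq_iff translate_translate translate_zero)
  then have "conj_shift n id \<in> tower_set UNIV" using tower_set_id by simp
  then show ?case by (simp only: id_def)
next
  case (step w i g)
  then have "conj_shift n (gen i g \<circ> w) \<in> tower_set UNIV"
    by (simp add: conj_shift_comp conj_shift_gen tower_set_step)
  then show ?case by (simp only: comp_def)
qed

lemma tower_action: "int_action (tower UNIV) conj_shift"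
proof (intro int_action.intro int_action_axioms.intro tower_group)
  show "conj_shift n \<in> hom (tower UNIV) (tower UNIV)" for n
    using conj_shift_tower conj_shift_comp by (auto simp: hom_def tower_def)
qed (simp_all add: conj_shift_def translate_translate translate_zero fun_eq_iff add.commute)

sublocale T: int_action "tower UNIV" conj_shift
  by (rule tower_action)

section \<open>The tower extended by the shift, and normal closures in it\<close>

definition shifted_tower :: "(((int \<Rightarrow> 'a) \<Rightarrow> int \<Rightarrow> 'a) \<times> int) monoid" where
  "shifted_tower = semidirect (tower UNIV) conj_shift"

lemma shifted_tower_group: "group shifted_tower"
  unfolding shifted_tower_def by (rule T.semidirect_group)

lemma gen_mem_shifted: "g \<in> carrier G \<Longrightarrow> (gen i g, 0) \<in> carrier shifted_tower"
  using gen_tower by (simp add: shifted_tower_def semidirect_def tower_def)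

lemma shifted_mult: "(u, 0) \<otimes>\<^bsub>shifted_tower\<^esub> (w, 0) = (u \<circ> w, 0)"
proof -
  have "conj_shift 0 w = w" by (simp add: conj_shift_def translate_zero fun_eq_iff)
  then show ?thesis by (simp add: shifted_tower_def semidirect_def tower_def)
qed

lemma shifted_one: "\<one>\<^bsub>shifted_tower\<^esub> = (id, 0)"
  by (simp add: shifted_tower_def semidirect_def tower_def)

lemma shifted_inv_gen:
  assumes "g \<in> carrier G"
  shows "inv\<^bsub>shifted_tower\<^esub> (gen i g, 0) = (gen i (inv g), 0)"
  by (rule group.inv_equality[OF shifted_tower_group])
    (use assms in \<open>simp_all add: gen_mem_shifted shifted_mult gen_comp gen_one shifted_one\<close>)

lemma gen_mon: "(\<lambda>g. (gen 0 g, 0)) \<in> mon G shifted_tower"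
proof -
  have "g = h" if "g \<in> carrier G" "h \<in> carrier G" "gen 0 g = gen 0 h" for g h
  proof -
    have "gen 0 g (\<lambda>_. \<one>) 0 = gen 0 h (\<lambda>_. \<one>) 0" using that by simp
    then show ?thesis using that(1,2) by (simp add: gen_def one_node)
  qed
  then show ?thesis
    by (auto simp: mon_def hom_def inj_on_def gen_mem_shifted shifted_mult gen_comp)
qed

text \<open>Let \<open>a'\<close> be the conjugate of \<open>a\<close> by \<open>c\<close>. Then
  \<open>d = a' \<otimes> inv a\<close> is a commutator of \<open>c\<close> with \<open>a\<close>
  and lies in \<open>N\<close>. As \<open>a'\<close> commutes with \<open>a\<close> and
  \<open>b\<close>, conjugation by \<open>d\<close> acts on \<open>b\<close> like conjugation by
  \<open>inv a\<close>, so the commutator of \<open>d\<close> with \<open>b\<close>, again an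
  element of \<open>N\<close>, is the claimed one.\<close>

lemma normal_closure_commutator:
  assumes "group H" "N \<lhd> H" "c \<in> N" "a \<in> carrier H" "b \<in> carrier H"
    and comm: "c \<otimes>\<^bsub>H\<^esub> a \<otimes>\<^bsub>H\<^esub> inv\<^bsub>H\<^esub> c \<otimes>\<^bsub>H\<^esub> a = a \<otimes>\<^bsub>H\<^esub> (c \<otimes>\<^bsub>H\<^esub> a \<otimes>\<^bsub>H\<^esub> inv\<^bsub>H\<^esub> c)"
      "c \<otimes>\<^bsub>H\<^esub> a \<otimes>\<^bsub>H\<^esub> inv\<^bsub>H\<^esub> c \<otimes>\<^bsub>H\<^esub> b = b \<otimes>\<^bsub>H\<^esub> (c \<otimes>\<^bsub>H\<^esub> a \<otimes>\<^bsub>H\<^esub> inv\<^bsub>H\<^esub> c)"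
  shows "inv\<^bsub>H\<^esub> a \<otimes>\<^bsub>H\<^esub> b \<otimes>\<^bsub>H\<^esub> a \<otimes>\<^bsub>H\<^esub> inv\<^bsub>H\<^esub> b \<in> N"
proof -
  interpret H: group H by fact
  interpret N: normal N H by fact
  have c: "c \<in> carrier H" by (rule N.mem_carrier[OF assms(3)])
  note ab = assms(4,5)
  define a' where "a' = c \<otimes>\<^bsub>H\<^esub> a \<otimes>\<^bsub>H\<^esub> inv\<^bsub>H\<^esub> c"
  have a': "a' \<in> carrier H" using c ab by (simp add: a'_def)
  define d where "d = a' \<otimes>\<^bsub>H\<^esub> inv\<^bsub>H\<^esub> a"
  have "d = c \<otimes>\<^bsub>H\<^esub> (a \<otimes>\<^bsub>H\<^esub> inv\<^bsub>H\<^esub> c \<otimes>\<^bsub>H\<^esub> inv\<^bsub>H\<^esub> a)" using c ab by (simp add: d_def a'_def H.m_assoc)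
  moreover have "a \<otimes>\<^bsub>H\<^esub> inv\<^bsub>H\<^esub> c \<otimes>\<^bsub>H\<^esub> inv\<^bsub>H\<^esub> a \<in> N"
    by (rule N.inv_op_closed2[OF ab(1) N.m_inv_closed[OF assms(3)]])
  ultimately have dN: "d \<in> N" using N.m_closed[OF assms(3)] by simp
  have dc: "d \<in> carrier H" by (rule N.mem_carrier[OF dN])
  have "b \<otimes>\<^bsub>H\<^esub> inv\<^bsub>H\<^esub> d \<otimes>\<^bsub>H\<^esub> inv\<^bsub>H\<^esub> b \<in> N" by (rule N.inv_op_closed2[OF ab(2) N.m_inv_closed[OF dN]])
  then have "d \<otimes>\<^bsub>H\<^esub> (b \<otimes>\<^bsub>H\<^esub> inv\<^bsub>H\<^esub> d \<otimes>\<^bsub>H\<^esub> inv\<^bsub>H\<^esub> b) \<in> N" by (rule N.m_closed[OF dN])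
  moreover have "d \<otimes>\<^bsub>H\<^esub> (b \<otimes>\<^bsub>H\<^esub> inv\<^bsub>H\<^esub> d \<otimes>\<^bsub>H\<^esub> inv\<^bsub>H\<^esub> b) = inv\<^bsub>H\<^esub> a \<otimes>\<^bsub>H\<^esub> b \<otimes>\<^bsub>H\<^esub> a \<otimes>\<^bsub>H\<^esub> inv\<^bsub>H\<^esub> b"
  proof -
    have ca: "a' \<otimes>\<^bsub>H\<^esub> inv\<^bsub>H\<^esub> a = inv\<^bsub>H\<^esub> a \<otimes>\<^bsub>H\<^esub> a'"
    proof -
      have "a \<otimes>\<^bsub>H\<^esub> a' \<otimes>\<^bsub>H\<^esub> inv\<^bsub>H\<^esub> a = a'"
        using comm(1)[symmetric] a' ab by (simp add: a'_def[symmetric] H.m_assoc)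
      then have "inv\<^bsub>H\<^esub> a \<otimes>\<^bsub>H\<^esub> (a \<otimes>\<^bsub>H\<^esub> (a' \<otimes>\<^bsub>H\<^esub> inv\<^bsub>H\<^esub> a)) = inv\<^bsub>H\<^esub> a \<otimes>\<^bsub>H\<^esub> a'"
        using a' ab by (simp add: H.m_assoc)
      moreover have "inv\<^bsub>H\<^esub> a \<otimes>\<^bsub>H\<^esub> (a \<otimes>\<^bsub>H\<^esub> (a' \<otimes>\<^bsub>H\<^esub> inv\<^bsub>H\<^esub> a)) = a' \<otimes>\<^bsub>H\<^esub> inv\<^bsub>H\<^esub> a"
        using a' ab by (simp add: H.m_assoc[symmetric])
      ultimately show ?thesis by simp
    qed
    have cb: "a' \<otimes>\<^bsub>H\<^esub> b = b \<otimes>\<^bsub>H\<^esub> a'" using comm(2) by (simp add: a'_def)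
    have id: "inv\<^bsub>H\<^esub> d = a \<otimes>\<^bsub>H\<^esub> inv\<^bsub>H\<^esub> a'" using a' ab by (simp add: d_def H.inv_mult_group)
    have "d \<otimes>\<^bsub>H\<^esub> b \<otimes>\<^bsub>H\<^esub> a = inv\<^bsub>H\<^esub> a \<otimes>\<^bsub>H\<^esub> (a' \<otimes>\<^bsub>H\<^esub> b) \<otimes>\<^bsub>H\<^esub> a"
      using a' ab unfolding d_def ca by (simp add: H.m_assoc)
    also have "\<dots> = inv\<^bsub>H\<^esub> a \<otimes>\<^bsub>H\<^esub> b \<otimes>\<^bsub>H\<^esub> (a' \<otimes>\<^bsub>H\<^esub> a)" unfolding cb using a' ab by (simp add: H.m_assoc)
    also have "a' \<otimes>\<^bsub>H\<^esub> a = a \<otimes>\<^bsub>H\<^esub> a'" using comm(1) by (simp add: a'_def)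
    finally have e: "d \<otimes>\<^bsub>H\<^esub> b \<otimes>\<^bsub>H\<^esub> a = inv\<^bsub>H\<^esub> a \<otimes>\<^bsub>H\<^esub> b \<otimes>\<^bsub>H\<^esub> (a \<otimes>\<^bsub>H\<^esub> a')" .
    have "d \<otimes>\<^bsub>H\<^esub> (b \<otimes>\<^bsub>H\<^esub> inv\<^bsub>H\<^esub> d \<otimes>\<^bsub>H\<^esub> inv\<^bsub>H\<^esub> b) = d \<otimes>\<^bsub>H\<^esub> b \<otimes>\<^bsub>H\<^esub> a \<otimes>\<^bsub>H\<^esub> inv\<^bsub>H\<^esub> a' \<otimes>\<^bsub>H\<^esub> inv\<^bsub>H\<^esub> b"
      unfolding id using a' ab dc by (simp add: H.m_assoc)
    also have "\<dots> = inv\<^bsub>H\<^esub> a \<otimes>\<^bsub>H\<^esub> b \<otimes>\<^bsub>H\<^esub> a \<otimes>\<^bsub>H\<^esub> inv\<^bsub>H\<^esub> b"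
      unfolding e using a' ab by (simp add: H.m_assoc)
    finally show ?thesis .
  qed
  ultimately show ?thesis by simp
qed

text \<open>\<open>displaced g a\<close> acts like \<open>gen 1 a\<close>, but below the vertex \<open>g\<close> instead of \<open>\<one>\<close> of level 0.\<close>

definition displaced :: "'a \<Rightarrow> 'a \<Rightarrow> (int \<Rightarrow> 'a) \<Rightarrow> int \<Rightarrow> 'a" where
  "displaced g a x = (if x \<in> nodes \<and> (\<forall>j<0. x j = \<one>) \<and> x 0 = g then x(1 := a \<otimes> x 1) else x)"

lemma less_one_iff: "(\<forall>j<1::int. P j) \<longleftrightarrow> (\<forall>j<0. P j) \<and> P 0"
  by (metis add_0 int_less_induct linorder_neqE order_less_trans zless_add1_eq zero_less_one)

text \<open>\<open>gen 0 g\<close> carries the subtree with coordinate \<one> on level 0 to the one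
  with coordinate \<open>g\<close>, and conjugation moves the action along.\<close>

lemma conj_gen_displaced:
  assumes g: "g \<in> carrier G" and a: "a \<in> carrier G"
  shows "gen 0 g \<circ> gen 1 a \<circ> gen 0 (inv g) = displaced g a"
proof
  fix x show "(gen 0 g \<circ> gen 1 a \<circ> gen 0 (inv g)) x = displaced g a x"
  proof (cases "x \<in> nodes \<and> (\<forall>j<0. x j = \<one>)")
    case True
    then have xc: "x j \<in> carrier G" for j using nodes_closed by blast
    let ?y = "x(0 := inv g \<otimes> x 0)"
    have y: "gen 0 (inv g) x = ?y" "?y \<in> nodes" using True g xc nodes_upd by (simp_all add: gen_def)
    have "inv g \<otimes> x 0 = \<one> \<longleftrightarrow> x 0 = g" using g xc by (metis inv_closed inv_equality inv_inv l_inv)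
    then have l: "(\<forall>j<1. ?y j = \<one>) \<longleftrightarrow> x 0 = g" using True by (simp add: less_one_iff)
    show ?thesis
    proof (cases "x 0 = g")
      case gx: True
      let ?z = "?y(1 := a \<otimes> x 1)"
      have z: "gen 1 a ?y = ?z" using l gx y by (simp add: gen_def)
      have "?z \<in> nodes" by (rule nodes_upd[OF y(2)]) (use a xc in simp)
      then have "gen 0 g ?z = ?z(0 := g \<otimes> ?z 0)" using True by (simp add: gen_def)
      also have "\<dots> = x(1 := a \<otimes> x 1)" using gx g by (auto simp: fun_eq_iff)
      finally show ?thesis using True gx y z by (simp add: displaced_def)
    next
      case False
      have z: "gen 1 a ?y = ?y" using l False unfolding gen_def by presburger
      have "gen 0 g ?y = x" using True y(2) g xc by (auto simp: gen_def fun_eq_iff m_assoc[symmetric])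
      then show ?thesis using True False y z by (simp add: displaced_def)
    qed
  next
    case False
    then have "gen 0 h x = x" for h by (rule gen_other)
    moreover have "gen 1 a x = x" by (rule gen_other) (use False less_one_iff in auto)
    ultimately show ?thesis using False unfolding displaced_def by auto
  qed
qed

text \<open>The supports are disjoint: the two maps act on nodes whose coordinate on level 0 is
  \<open>g\<close> and \<one>, respectively, and neither changes this coordinate.\<close>

lemma displaced_commutes:
  assumes g: "g \<noteq> \<one>" and a: "a \<in> carrier G" and b: "b \<in> carrier G"
  shows "displaced g a \<circ> gen 1 b = gen 1 b \<circ> displaced g a"
proof
  fix x show "(displaced g a \<circ> gen 1 b) x = (gen 1 b \<circ> displaced g a) x"
  proof (cases "x \<in> nodes \<and> (\<forall>j<0. x j = \<one>)")
    case True
    then have xc: "x j \<in> carrier G" for j using nodes_closed by blast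
    have up: "x(1 := c) \<in> nodes" if "c \<in> carrier G" for c using True that nodes_upd by blast
    show ?thesis
      using True g a b xc up[of "a \<otimes> x 1"] up[of "b \<otimes> x 1"]
      by (auto simp: gen_def displaced_def less_one_iff)
  next
    case False
    then have "displaced g a x = x" by (auto simp: displaced_def)
    moreover have "gen 1 b x = x" by (rule gen_other) (use False less_one_iff in auto)
    ultimately show ?thesis by simp
  qed
qed

text \<open>A commutator of level 1 is caught by \<open>normal_closure_commutator\<close> with
  \<open>gen 0 g\<close> as \<open>c\<close>, because conjugation by it makes elements of level 1
  commute with level 1. The shift then lowers the commutator to level 0.\<close>

lemma shifted_normal_closure:
  assumes N: "N \<lhd> shifted_tower" and g: "g \<in> carrier G" "g \<noteq> \<one>" "(gen 0 g, 0) \<in> N"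
    and a: "a \<in> carrier G" and b: "b \<in> carrier G"
  shows "(gen 0 (a \<otimes> b \<otimes> inv a \<otimes> inv b), 0) \<in> N"
proof -
  let ?H = shifted_tower
  interpret H: group ?H by (rule shifted_tower_group)
  interpret N: normal N ?H by fact
  note ia = inv_closed[OF a]
  have c: "(gen 0 g, 0) \<otimes>\<^bsub>?H\<^esub> (gen 1 (inv a), 0) \<otimes>\<^bsub>?H\<^esub> inv\<^bsub>?H\<^esub> (gen 0 g, 0) = (displaced g (inv a), 0)"
    by (simp add: shifted_inv_gen[OF g(1)] shifted_mult conj_gen_displaced[OF g(1) ia])
  \<comment> \<open>The inverse of \<open>a\<close> is inserted so that the commutator comes out in
    the order \<open>a\<close>, \<open>b\<close>, \<open>inv a\<close>,
    \<open>inv b\<close>.\<close>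
  have "inv\<^bsub>?H\<^esub> (gen 1 (inv a), 0) \<otimes>\<^bsub>?H\<^esub> (gen 1 b, 0) \<otimes>\<^bsub>?H\<^esub> (gen 1 (inv a), 0) \<otimes>\<^bsub>?H\<^esub> inv\<^bsub>?H\<^esub> (gen 1 b, 0) \<in> N"
    by (rule normal_closure_commutator[OF H.group_axioms N g(3)])
      (simp_all only: c gen_mem_shifted ia b,
       simp_all only: shifted_mult displaced_commutes[OF g(2) ia ia] displaced_commutes[OF g(2) ia b])
  then have n1: "(gen 1 (a \<otimes> b \<otimes> inv a \<otimes> inv b), 0) \<in> N"
    using a b by (simp add: shifted_inv_gen shifted_mult gen_comp)
  \<comment> \<open>Conjugation by the shift by -1 takes level 1 to level 0.\<close>
  have t: "(id, -1) \<in> carrier ?H" by (simp add: shifted_tower_def semidirect_def tower_def tower_set_id)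
  have cc: "a \<otimes> b \<otimes> inv a \<otimes> inv b \<in> carrier G" using a b by simp
  have idc: "id \<in> carrier (tower UNIV)" by (simp add: tower_def tower_set_id)
  have gc: "gen 1 (a \<otimes> b \<otimes> inv a \<otimes> inv b) \<in> carrier (tower UNIV)" using gen_tower cc by (simp add: tower_def)
  have "(id, -1) \<otimes>\<^bsub>?H\<^esub> (gen 1 (a \<otimes> b \<otimes> inv a \<otimes> inv b), 0) \<otimes>\<^bsub>?H\<^esub> inv\<^bsub>?H\<^esub> (id, -1) \<in> N"
    by (rule N.inv_op_closed2[OF t n1])
  moreover have "inv\<^bsub>tower UNIV\<^esub> id = id" using T.K.inv_one by (simp add: tower_def)
  ultimately show ?thesis
    using T.semidirect_conj[OF idc gc, of "-1"] cc
    by (simp add: shifted_tower_def conj_shift_gen) (simp add: tower_def)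
qed

end

subsection \<open>Ordering the tower\<close>

locale ordered_tower = wreath_tower +
  fixes P
  assumes cone: "cone G P" and conj: "conj_invariant G P"
begin

lemma P_closed: "x \<in> P \<Longrightarrow> x \<in> carrier G"
  using cone by (auto simp: cone_def)

lemma P_mult: "x \<in> P \<Longrightarrow> y \<in> P \<Longrightarrow> x \<otimes> y \<in> P"
  using cone by (auto simp: cone_def)

lemma P_total: "x \<in> carrier G \<Longrightarrow> x \<in> P \<or> inv x \<in> P"
  using cone unfolding cone_def by blast

lemma P_antisym: "x \<in> P \<Longrightarrow> inv x \<in> P \<Longrightarrow> x = \<one>"
  using cone unfolding cone_def by blast

definition strict :: "'a \<Rightarrow> bool" where "strict x \<longleftrightarrow> x \<in> P \<and> x \<noteq> \<one>"

lemma strict_closed: "strict x \<Longrightarrow> x \<in> carrier G"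
  by (simp add: strict_def P_closed)

lemma strict_mult: "strict x \<Longrightarrow> strict y \<Longrightarrow> strict (x \<otimes> y)"
proof -
  assume x: "strict x" and y: "strict y"
  have "x \<otimes> y \<noteq> \<one>"
  proof
    assume "x \<otimes> y = \<one>"
    then have "inv y = x" using strict_closed[OF x] strict_closed[OF y] by (intro inv_equality) auto
    then have "y = \<one>" using P_antisym[of y] x y by (simp add: strict_def)
    then show False using y by (simp add: strict_def)
  qed
  then show ?thesis using x y P_mult by (simp add: strict_def)
qed

lemma strict_total: "x \<in> carrier G \<Longrightarrow> x \<noteq> \<one> \<Longrightarrow> strict x \<or> strict (inv x)"
  using P_total[of x] by (auto simp: strict_def)

lemma strict_conj: "strict x \<Longrightarrow> g \<in> carrier G \<Longrightarrow> strict (g \<otimes> x \<otimes> inv g)"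
proof -
  assume x: "strict x" and g: "g \<in> carrier G"
  have xc: "x \<in> carrier G" by (rule strict_closed[OF x])
  have "g \<otimes> x \<otimes> inv g \<noteq> \<one>"
  proof
    assume "g \<otimes> x \<otimes> inv g = \<one>"
    then have "g \<otimes> x = g" using g xc inv_solve_right'[of \<one> "g \<otimes> x" g] by simp
    then show False using x g xc by (simp add: strict_def)
  qed
  then show ?thesis using conj x g by (simp add: strict_def conj_invariant_def)
qed

definition lex :: "int \<Rightarrow> (int \<Rightarrow> 'a) \<Rightarrow> (int \<Rightarrow> 'a) \<Rightarrow> bool" where
  "lex i x y \<longleftrightarrow> (\<exists>j<i. agree j x y \<and> strict (y j \<otimes> inv (x j)))"

text \<open>Where \<open>x\<close> and \<open>y\<close> first differ, both coordinates are
  multiplied on the left by the same label, so \<open>y j \<otimes> inv (x j)\<close> is merely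
  conjugated by it; here the invariance of \<open>P\<close> under conjugation enters.\<close>

lemma lex_tower:
  assumes u: "u \<in> tower_set J" and x: "x \<in> nodes" and y: "y \<in> nodes" and "lex i x y"
  shows "lex i (u x) (u y)"
proof -
  obtain j where j: "j < i" "agree j x y" "strict (y j \<otimes> inv (x j))" using assms(4) by (auto simp: lex_def)
  let ?p = "port u j x"
  have p: "?p \<in> carrier G" by (rule port_closed[OF u x])
  have c: "x j \<in> carrier G" "y j \<in> carrier G" using nodes_closed x y by auto
  have "u x j = ?p \<otimes> x j" "u y j = ?p \<otimes> y j"
    using port_apply[OF u x, of j] port_apply[OF u y, of j] port_cong[OF u x y j(2)] by simp_all
  then have "u y j \<otimes> inv (u x j) = ?p \<otimes> (y j \<otimes> inv (x j)) \<otimes> inv ?p"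
    using p c by (simp add: inv_mult_group m_assoc)
  then have "strict (u y j \<otimes> inv (u x j))" using strict_conj[OF j(3) p] by simp
  then show ?thesis using j(1) tower_agree[OF u x y j(2)] by (auto simp: lex_def)
qed

lemma lex_agree_left: "agree i x x' \<Longrightarrow> lex i x y \<Longrightarrow> lex i x' y"
proof -
  assume a: "agree i x x'" and "lex i x y"
  then obtain j where j: "j < i" "agree j x y" "strict (y j \<otimes> inv (x j))" by (auto simp: lex_def)
  have "agree j x' y" using agree_trans[OF agree_sym[OF agree_le[OF a]] j(2)] j(1) by simp
  moreover have "x' j = x j" using a j(1) by (simp add: agree_def)
  ultimately show ?thesis using j by (auto simp: lex_def)
qed

lemma lex_agree_right: "agree i y y' \<Longrightarrow> lex i x y \<Longrightarrow> lex i x y'"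
proof -
  assume a: "agree i y y'" and "lex i x y"
  then obtain j where j: "j < i" "agree j x y" "strict (y j \<otimes> inv (x j))" by (auto simp: lex_def)
  have "agree j x y'" using agree_trans[OF j(2) agree_le[OF a]] j(1) by simp
  moreover have "y' j = y j" using a j(1) by (simp add: agree_def)
  ultimately show ?thesis using j by (auto simp: lex_def)
qed

lemma lex_irrefl: "x \<in> nodes \<Longrightarrow> \<not> lex i x x"
  using nodes_closed by (auto simp: lex_def strict_def)

lemma lex_trans:
  assumes x: "x \<in> nodes" and y: "y \<in> nodes" and z: "z \<in> nodes" and "lex i x y" "lex i y z"
  shows "lex i x z"
proof -
  obtain j where j: "j < i" "agree j x y" "strict (y j \<otimes> inv (x j))" using assms(4) by (auto simp: lex_def)
  obtain k where k: "k < i" "agree k y z" "strict (z k \<otimes> inv (y k))" using assms(5) by (auto simp: lex_def)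
  have c: "x n \<in> carrier G" "y n \<in> carrier G" "z n \<in> carrier G" for n using nodes_closed x y z by auto
  consider "j < k" | "j = k" | "k < j" by linarith
  then show ?thesis
  proof cases
    case 1
    then have "agree j x z" using agree_trans[OF j(2) agree_le[OF k(2)]] by simp
    moreover have "z j = y j" using k(2) 1 by (simp add: agree_def)
    ultimately show ?thesis using j by (auto simp: lex_def)
  next
    case 2
    have "(z j \<otimes> inv (y j)) \<otimes> (y j \<otimes> inv (x j)) = z j \<otimes> (inv (y j) \<otimes> (y j \<otimes> inv (x j)))"
      using c by (simp add: m_assoc)
    also have "\<dots> = z j \<otimes> inv (x j)" using c by (simp add: m_assoc[symmetric, of "inv (y j)"])
    finally have "strict (z j \<otimes> inv (x j))" using strict_mult[OF k(3)[folded 2] j(3)] by simp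
    then show ?thesis using agree_trans[OF j(2)] k(2) 2 j(1) by (auto simp: lex_def)
  next
    case 3
    then have "agree k x z" using agree_trans[OF agree_le[OF j(2)] k(2)] by simp
    moreover have "x k = y k" using j(2) 3 by (simp add: agree_def)
    ultimately show ?thesis using k by (auto simp: lex_def)
  qed
qed

text \<open>Nodes have finite support, so there is a first coordinate at which two of them differ
  although the levels extend to minus infinity.\<close>

lemma lex_total:
  assumes x: "x \<in> nodes" and y: "y \<in> nodes" and "\<not> agree i x y"
  shows "lex i x y \<or> lex i y x"
proof -
  let ?D = "{j. j < i \<and> x j \<noteq> y j}"
  have "?D \<subseteq> {j. x j \<noteq> \<one>} \<union> {j. y j \<noteq> \<one>}" by auto
  moreover have "finite ({j. x j \<noteq> \<one>} \<union> {j. y j \<noteq> \<one>})" using x y by (simp add: nodes_def)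
  ultimately have fin: "finite ?D" by (rule finite_subset)
  have ne: "?D \<noteq> {}" using assms(3) by (auto simp: agree_def)
  define j where "j = Min ?D"
  have j: "j < i" "x j \<noteq> y j" using Min_in[OF fin ne] by (auto simp: j_def)
  have ag: "agree j x y" unfolding agree_def
  proof (intro allI impI, rule ccontr)
    fix l assume l: "l < j" "x l \<noteq> y l"
    then have "l \<in> ?D" using j by simp
    then have "j \<le> l" unfolding j_def using Min_le[OF fin] by blast
    then show False using l by simp
  qed
  have c: "x j \<in> carrier G" "y j \<in> carrier G" using nodes_closed x y by auto
  have "y j \<otimes> inv (x j) \<noteq> \<one>"
  proof
    assume "y j \<otimes> inv (x j) = \<one>"
    then have "y j = x j" using c inv_solve_right'[of \<one> "y j" "x j"] by simp
    then show False using j(2) by simp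
  qed
  then have "strict (y j \<otimes> inv (x j)) \<or> strict (inv (y j \<otimes> inv (x j)))" using c by (intro strict_total) auto
  moreover have "inv (y j \<otimes> inv (x j)) = x j \<otimes> inv (y j)" using c by (simp add: inv_mult_group)
  ultimately show ?thesis using j(1) ag agree_sym[OF ag] by (auto simp: lex_def)
qed

definition trivial_below :: "int \<Rightarrow> ((int \<Rightarrow> 'a) \<Rightarrow> int \<Rightarrow> 'a) \<Rightarrow> bool" where
  "trivial_below i w \<longleftrightarrow> (\<forall>x\<in>nodes. agree i (w x) x)"

text \<open>The sign of \<open>w\<close> is that of its label at the lexicographically largest vertex with a
  non-trivial label on the lowest level on which \<open>w\<close> acts. No reference to the origin of the levels is
  made, so this is invariant under the shift.\<close>

definition positive :: "int \<Rightarrow> (int \<Rightarrow> 'a) \<Rightarrow> ((int \<Rightarrow> 'a) \<Rightarrow> int \<Rightarrow> 'a) \<Rightarrow> bool" where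
  "positive i v w \<longleftrightarrow> v \<in> nodes \<and> trivial_below i w \<and> strict (port w i v) \<and>
     (\<forall>x\<in>nodes. lex i v x \<longrightarrow> port w i x = \<one>)"

lemma trivial_below_le: "trivial_below i w \<Longrightarrow> j \<le> i \<Longrightarrow> trivial_below j w"
  using agree_le by (auto simp: trivial_below_def)

lemma trivial_below_port: "trivial_below i w \<Longrightarrow> j < i \<Longrightarrow> x \<in> nodes \<Longrightarrow> port w j x = \<one>"
  using nodes_closed by (simp add: trivial_below_def agree_def port_def)

text \<open>Both factors fix all vertices of level \<open>i\<close>, so in the cocycle rule no
  vertex moves and the labels on this level multiply as in a direct sum.\<close>

lemma trivial_below_comp:
  assumes u: "u \<in> tower_set UNIV" "trivial_below i u" and w: "w \<in> tower_set UNIV" "trivial_below i w"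
  shows "trivial_below i (u \<circ> w)"
    and "x \<in> nodes \<Longrightarrow> port (u \<circ> w) i x = port u i x \<otimes> port w i x"
proof -
  show "trivial_below i (u \<circ> w)" unfolding trivial_below_def
  proof
    fix x assume x: "x \<in> nodes"
    have "agree i (u (w x)) (w x)" using u(2) tower_nodes[OF w(1) x] by (simp add: trivial_below_def)
    moreover have "agree i (w x) x" using w(2) x by (simp add: trivial_below_def)
    ultimately show "agree i ((u \<circ> w) x) x" using agree_trans by simp
  qed
  assume x: "x \<in> nodes"
  have "agree i (w x) x" using w(2) x by (simp add: trivial_below_def)
  then have "port u i (w x) = port u i x" by (rule port_cong[OF u(1) tower_nodes[OF w(1) x] x])
  then show "port (u \<circ> w) i x = port u i x \<otimes> port w i x" using port_comp[OF u(1) w(1) x] by simp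
qed

text \<open>If the lowest levels differ, the lower one decides, as the other factor has only trivial
  labels there. On a common level the larger of the two deciding vertices decides; if they coincide,
  two strictly positive labels are multiplied.\<close>

lemma positive_comp:
  assumes u: "u \<in> tower_set UNIV" "positive i v u" and w: "w \<in> tower_set UNIV" "positive i' v' w"
  shows "\<exists>k z. positive k z (u \<circ> w)"
proof -
  have tu: "trivial_below i u" and tw: "trivial_below i' w" and v: "v \<in> nodes" and v': "v' \<in> nodes"
    and su: "strict (port u i v)" and sw: "strict (port w i' v')"
    using u w by (auto simp: positive_def)
  have mu: "port u i x = \<one>" if "x \<in> nodes" "lex i v x" for x using u(2) that by (simp add: positive_def)
  have mw: "port w i' x = \<one>" if "x \<in> nodes" "lex i' v' x" for x using w(2) that by (simp add: positive_def)
  have c: "port u k x \<in> carrier G" "port w k x \<in> carrier G" if "x \<in> nodes" for k x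
    using port_closed u(1) w(1) that by auto
  consider "i < i'" | "i' < i" | "i = i'" by linarith
  then show ?thesis
  proof cases
    case 1
    note t = trivial_below_comp[OF u(1) tu w(1) trivial_below_le[OF tw]]
    have "port (u \<circ> w) i x = port u i x" if "x \<in> nodes" for x
      using t(2)[OF _ that] trivial_below_port[OF tw 1 that] c[OF that] 1 by simp
    then have "positive i v (u \<circ> w)" using t(1) v su mu 1 by (simp add: positive_def)
    then show ?thesis by blast
  next
    case 2
    note t = trivial_below_comp[OF u(1) trivial_below_le[OF tu] w(1) tw]
    have "port (u \<circ> w) i' x = port w i' x" if "x \<in> nodes" for x
      using t(2)[OF _ that] trivial_below_port[OF tu 2 that] c[OF that] 2 by simp
    then have "positive i' v' (u \<circ> w)" using t(1) v' sw mw 2 by (simp add: positive_def)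
    then show ?thesis by blast
  next
    case 3
    note tw' = tw[folded 3] and sw' = sw[folded 3] and mw' = mw[folded 3]
    note t = trivial_below_comp[OF u(1) tu w(1) tw']
    have "\<exists>z. z \<in> nodes \<and> strict (port (u \<circ> w) i z) \<and> (\<forall>x\<in>nodes. lex i z x \<longrightarrow> port (u \<circ> w) i x = \<one>)"
    proof (cases "agree i v v'")
      case True
      have "port w i v = port w i v'" by (rule port_cong[OF w(1) v v' True])
      then have "strict (port (u \<circ> w) i v)" using t(2)[OF v] strict_mult[OF su sw'] by simp
      moreover have "port (u \<circ> w) i x = \<one>" if "x \<in> nodes" "lex i v x" for x
        using t(2)[OF that(1)] mu[OF that] mw'[OF that(1) lex_agree_left[OF True that(2)]] by simp
      ultimately show ?thesis using v by blast
    next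
      case False
      then consider "lex i v v'" | "lex i v' v" using lex_total[OF v v'] by blast
      then show ?thesis
      proof cases
        case 1
        have "strict (port (u \<circ> w) i v')" using t(2)[OF v'] mu[OF v' 1] sw' c[OF v'] by simp
        moreover have "port (u \<circ> w) i x = \<one>" if "x \<in> nodes" "lex i v' x" for x
          using t(2)[OF that(1)] mu[OF that(1) lex_trans[OF v v' that(1) 1 that(2)]] mw'[OF that] by simp
        ultimately show ?thesis using v' by blast
      next
        case 2
        have "strict (port (u \<circ> w) i v)" using t(2)[OF v] mw'[OF v 2] su c[OF v] by simp
        moreover have "port (u \<circ> w) i x = \<one>" if "x \<in> nodes" "lex i v x" for x
          using t(2)[OF that(1)] mw'[OF that(1) lex_trans[OF v' v that(1) 2 that(2)]] mu[OF that] by simp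
        ultimately show ?thesis using v by blast
      qed
    qed
    then show ?thesis using t(1) unfolding positive_def by blast
  qed
qed

lemma not_positive_id: "\<not> positive i v id"
  using port_id by (auto simp: positive_def strict_def)

lemma trivial_below_inv:
  assumes w: "w \<in> tower_set UNIV" and t: "trivial_below i w"
    and u: "u \<in> tower_set UNIV" "w \<circ> u = id"
  shows "trivial_below i u" and "x \<in> nodes \<Longrightarrow> port u i x = inv (port w i x)"
proof -
  have wu: "w (u x) = x" for x using u(2) by (metis comp_apply id_apply)
  show tu: "trivial_below i u" unfolding trivial_below_def
  proof
    fix x assume x: "x \<in> nodes"
    have "agree i (w (u x)) (u x)" using t tower_nodes[OF u(1) x] by (simp add: trivial_below_def)
    then show "agree i (u x) x" using agree_sym by (simp add: wu)
  qed
  assume x: "x \<in> nodes"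
  have "port w i x \<otimes> port u i x = \<one>"
    using trivial_below_comp(2)[OF w t u(1) tu x] port_id[OF x] u(2) by simp
  then show "port u i x = inv (port w i x)"
    using port_closed[OF w x] port_closed[OF u(1) x] by (metis inv_equality inv_inv inv_closed)
qed

text \<open>Labels of \<open>w\<close> occur on finitely many levels and at finitely many vertices
  of each, so there are a lowest level and a lexicographically largest vertex on it. The label
  there, or its inverse, which is the label of \<open>u\<close>, is strictly positive.\<close>

lemma positive_total:
  assumes w: "w \<in> tower_set UNIV" "w \<noteq> id" and u: "u \<in> tower_set UNIV" "w \<circ> u = id"
  shows "(\<exists>i v. positive i v w) \<or> (\<exists>i v. positive i v u)"
proof -
  obtain n where n: "w \<in> tower_set {- int n..<int n}" using tower_finite_levels[OF w(1)] by blast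
  let ?L = "{i. \<exists>x\<in>nodes. port w i x \<noteq> \<one>}"
  have "?L \<subseteq> {- int n..<int n}" using port_outside[OF n] by blast
  then have fin: "finite ?L" by (rule finite_subset) simp
  have ne: "?L \<noteq> {}" using tower_eq_id[OF w(1)] w(2) by blast
  define i where "i = Min ?L"
  have iL: "i \<in> ?L" unfolding i_def by (rule Min_in[OF fin ne])
  have t: "trivial_below i w"
    unfolding trivial_below_def agree_def
  proof (intro ballI allI impI)
    fix x j assume x: "x \<in> nodes" and j: "j < i"
    have "j \<notin> ?L" using Min_le[OF fin, of j] j by (auto simp: i_def)
    then have "port w j x = \<one>" using x by blast
    then show "w x j = x j" using port_apply[OF w(1) x, of j] nodes_closed[OF x] by simp
  qed
  \<comment> \<open>Canonical representatives turn the vertices into a finite set of nodes, which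
    has a maximal element for \<open>lex\<close>.\<close>
  let ?A = "{trunc i x |x. x \<in> nodes \<and> port w i x \<noteq> \<one>}"
  have fA: "finite ?A" by (rule finite_portrait[OF w(1)])
  have nA: "?A \<noteq> {}" using iL by blast
  have An: "a \<in> nodes" if "a \<in> ?A" for a using that trunc_nodes by blast
  have "\<exists>v\<in>?A. \<forall>a\<in>?A. a \<noteq> v \<longrightarrow> \<not> lex i v a"
  proof (rule Finite_Set.bex_max_element[OF fA _ _ nA])
    show "asymp_on ?A (lex i)"
    proof (intro asymp_onI notI)
      fix a b assume "a \<in> ?A" "b \<in> ?A" "lex i a b" "lex i b a"
      then have "lex i a a" using lex_trans[OF An An An, of a b a] by blast
      then show False using lex_irrefl[OF An[OF \<open>a \<in> ?A\<close>]] by blast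
    qed
    show "transp_on ?A (lex i)"
    proof (intro transp_onI)
      fix a b c assume "a \<in> ?A" "b \<in> ?A" "c \<in> ?A" "lex i a b" "lex i b c"
      then show "lex i a c" using lex_trans[OF An An An, of a b c] by blast
    qed
  qed
  then obtain v where v: "v \<in> ?A" "\<And>a. a \<in> ?A \<Longrightarrow> a \<noteq> v \<Longrightarrow> \<not> lex i v a" by blast
  have vn: "v \<in> nodes" by (rule An[OF v(1)])
  have max: "port w i x = \<one>" if x: "x \<in> nodes" "lex i v x" for x
  proof (rule ccontr)
    assume "port w i x \<noteq> \<one>"
    then have "trunc i x \<in> ?A" using x by blast
    moreover have "lex i v (trunc i x)" by (rule lex_agree_right[OF agree_trunc x(2)])
    moreover then have "trunc i x \<noteq> v" using lex_irrefl[OF vn, of i] by (auto simp only:)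
    ultimately show False using v(2) by blast
  qed
  obtain x0 where x0: "v = trunc i x0" "x0 \<in> nodes" "port w i x0 \<noteq> \<one>" using v(1) by blast
  have "port w i v \<noteq> \<one>"
    using x0(3) port_cong[OF w(1) x0(2) trunc_nodes[OF x0(2)] agree_trunc] by (simp add: x0(1))
  then have "strict (port w i v) \<or> strict (inv (port w i v))"
    using strict_total port_closed[OF w(1) vn] by blast
  then show ?thesis
  proof
    assume "strict (port w i v)"
    then have "positive i v w" using vn t max by (simp add: positive_def)
    then show ?thesis by blast
  next
    assume s: "strict (inv (port w i v))"
    note tu = trivial_below_inv[OF w(1) t u]
    have "positive i v u" unfolding positive_def
      using vn tu(1) s tu(2)[OF vn] tu(2) max by simp
    then show ?thesis by blast
  qed
qed

text \<open>Conjugation by \<open>u\<close> carries the deciding vertex \<open>v\<close> to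
  \<open>u v\<close> and conjugates its label; by \<open>lex_tower\<close> the vertices keep their
  lexicographic order, so maximality is preserved.\<close>

lemma positive_conj:
  assumes w: "w \<in> tower_set UNIV" "positive i v w"
    and u: "u \<in> tower_set UNIV" and u': "u' \<in> tower_set UNIV" "u \<circ> u' = id" "u' \<circ> u = id"
  shows "positive i (u v) (u \<circ> w \<circ> u')"
proof -
  have uu: "u (u' x) = x" "u' (u x) = x" for x using u'(2,3) by (metis comp_apply id_apply)+
  have v: "v \<in> nodes" and t: "trivial_below i w" and s: "strict (port w i v)"
    and m: "\<And>x. x \<in> nodes \<Longrightarrow> lex i v x \<Longrightarrow> port w i x = \<one>" using w(2) by (auto simp: positive_def)
  note n = tower_nodes[OF w(1)] tower_nodes[OF u] tower_nodes[OF u'(1)]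
  have ag: "agree i (w (u' x)) (u' x)" if "x \<in> nodes" for x
    using t n(3)[OF that] by (simp add: trivial_below_def)
  have t': "trivial_below i (u \<circ> w \<circ> u')" unfolding trivial_below_def
  proof
    fix x assume x: "x \<in> nodes"
    have "agree i (u (w (u' x))) (u (u' x))"
      by (rule tower_agree[OF u n(1)[OF n(3)[OF x]] n(3)[OF x] ag[OF x]])
    then show "agree i ((u \<circ> w \<circ> u') x) x" by (simp add: uu)
  qed
  have p: "port (u \<circ> w \<circ> u') i x = port u i (u' x) \<otimes> port w i (u' x) \<otimes> inv (port u i (u' x))"
    if x: "x \<in> nodes" for x
  proof -
    have "port (u \<circ> w \<circ> u') i x = port (u \<circ> w) i (u' x) \<otimes> port u' i x"
      by (rule port_comp[OF tower_comp[OF u w(1)] u'(1) x])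
    also have "port (u \<circ> w) i (u' x) = port u i (w (u' x)) \<otimes> port w i (u' x)"
      by (rule port_comp[OF u w(1) n(3)[OF x]])
    also have "port u i (w (u' x)) = port u i (u' x)"
      by (rule port_cong[OF u n(1)[OF n(3)[OF x]] n(3)[OF x] ag[OF x]])
    also have "port u' i x = inv (port u i (u' x))"
    proof -
      have "port u i (u' x) \<otimes> port u' i x = \<one>"
        using port_comp[OF u u'(1) x, of i] port_id[OF x] u'(2) by simp
      then show ?thesis
        using port_closed[OF u n(3)[OF x]] port_closed[OF u'(1) x] by (metis inv_equality inv_inv inv_closed)
    qed
    finally show ?thesis .
  qed
  show ?thesis unfolding positive_def
  proof (intro conjI ballI impI)
    show "u v \<in> nodes" by (rule n(2)[OF v])
    show "trivial_below i (u \<circ> w \<circ> u')" by (rule t')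
    show "strict (port (u \<circ> w \<circ> u') i (u v))"
      unfolding p[OF n(2)[OF v]] uu using strict_conj[OF s port_closed[OF u v]] .
    fix x assume x: "x \<in> nodes" and "lex i (u v) x"
    then have "lex i (u' (u v)) (u' x)" by (intro lex_tower[OF u'(1) n(2)[OF v]])
    then have "port w i (u' x) = \<one>" using m[OF n(3)[OF x]] by (simp add: uu)
    then show "port (u \<circ> w \<circ> u') i x = \<one>" using p[OF x] port_closed[OF u n(3)[OF x]] by simp
  qed
qed

lemma positive_shift:
  assumes "positive i v w"
  shows "positive (i + n) (translate n v) (conj_shift n w)"
proof -
  have v: "v \<in> nodes" and t: "trivial_below i w" and s: "strict (port w i v)"
    and m: "\<And>x. x \<in> nodes \<Longrightarrow> lex i v x \<Longrightarrow> port w i x = \<one>" using assms by (auto simp: positive_def)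
  have p: "port (conj_shift n w) (i + n) x = port w i (translate (- n) x)" for x
    by (simp add: port_def conj_shift_def translate_def)
  show ?thesis unfolding positive_def
  proof (intro conjI ballI impI)
    show "translate n v \<in> nodes" using v translate_nodes by simp
    show "trivial_below (i + n) (conj_shift n w)"
      unfolding trivial_below_def agree_def
    proof (intro ballI allI impI)
      fix x j assume "x \<in> nodes" "j < i + n"
      then have "w (translate (- n) x) (j - n) = translate (- n) x (j - n)"
        using t translate_nodes by (simp add: trivial_below_def agree_def)
      then show "conj_shift n w x j = x j" by (simp add: conj_shift_def translate_def)
    qed
    show "strict (port (conj_shift n w) (i + n) (translate n v))"
      using s by (simp add: p translate_translate translate_zero)
    fix x assume x: "x \<in> nodes" and "lex (i + n) (translate n v) x"
    then obtain j where j: "j < i + n" "agree j (translate n v) x" "strict (x j \<otimes> inv (translate n v j))"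
      by (auto simp: lex_def)
    have "agree (j - n) v (translate (- n) x)"
      unfolding agree_def
    proof (intro allI impI)
      fix l assume "l < j - n"
      then have "translate n v (l + n) = x (l + n)" using j(2) unfolding agree_def by simp
      then show "v l = translate (- n) x l" by (simp add: translate_def)
    qed
    then have "lex i v (translate (- n) x)"
      unfolding lex_def using j by (intro exI[of _ "j - n"]) (simp add: translate_def)
    then show "port (conj_shift n w) (i + n) x = \<one>" using m x translate_nodes p by simp
  qed
qed

lemma orderable_shifted_tower: "orderable shifted_tower"
  unfolding shifted_tower_def
proof (rule T.orderable_semidirect)
  let ?R = "{w \<in> tower_set UNIV. w = id \<or> (\<exists>i v. positive i v w)}"
  note inv = tower_inv[of _ UNIV]
  show "cone (tower UNIV) ?R" unfolding cone_def
  proof (intro conjI ballI impI)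
    show "?R \<subseteq> carrier (tower UNIV)" by (auto simp: tower_def)
  next
    fix u w assume u: "u \<in> ?R" and w: "w \<in> ?R"
    have c: "u \<circ> w \<in> tower_set UNIV" using u w tower_comp by blast
    have "u \<circ> w = id \<or> (\<exists>i v. positive i v (u \<circ> w))"
    proof (cases "u = id \<or> w = id")
      case True
      then show ?thesis using u w by auto
    next
      case False
      then show ?thesis using u w positive_comp by blast
    qed
    then show "u \<otimes>\<^bsub>tower UNIV\<^esub> w \<in> ?R" using c by (simp add: tower_def)
  next
    fix w assume "w \<in> carrier (tower UNIV)"
    then have w: "w \<in> tower_set UNIV" by (simp add: tower_def)
    show "w \<in> ?R \<or> inv\<^bsub>tower UNIV\<^esub> w \<in> ?R"
      using positive_total[OF w _ inv(1)[OF w] inv(3)[OF w]] w inv(1)[OF w] by blast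
  next
    fix w assume w: "w \<in> ?R" "inv\<^bsub>tower UNIV\<^esub> w \<in> ?R"
    then have wt: "w \<in> tower_set UNIV" by blast
    have "w = id"
    proof (rule ccontr)
      assume ne: "w \<noteq> id"
      then have "inv\<^bsub>tower UNIV\<^esub> w \<noteq> id" using inv(3)[OF wt] by auto
      then obtain i v i' v' where "positive i v w" "positive i' v' (inv\<^bsub>tower UNIV\<^esub> w)" using w ne by blast
      \<comment> \<open>If both \<open>w\<close> and its inverse were positive, their product
        \<open>id\<close> would be positive too.\<close>
      then have "\<exists>k z. positive k z (w \<circ> inv\<^bsub>tower UNIV\<^esub> w)" using positive_comp[OF wt _ inv(1)[OF wt]] by blast
      then show False using not_positive_id inv(3)[OF wt] by simp
    qed
    then show "w = \<one>\<^bsub>tower UNIV\<^esub>" by (simp add: tower_def)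
  qed
  show "conj_invariant (tower UNIV) ?R" unfolding conj_invariant_def
  proof (intro ballI)
    fix u w assume "u \<in> carrier (tower UNIV)" and w: "w \<in> ?R"
    then have u: "u \<in> tower_set UNIV" by (simp add: tower_def)
    let ?u' = "inv\<^bsub>tower UNIV\<^esub> u"
    have c: "u \<circ> w \<circ> ?u' \<in> tower_set UNIV" using tower_comp u w inv(1)[OF u] by blast
    have "u \<circ> w \<circ> ?u' = id \<or> (\<exists>i v. positive i v (u \<circ> w \<circ> ?u'))"
    proof (cases "w = id")
      case True
      then show ?thesis using inv(3)[OF u] by simp
    next
      case False
      then show ?thesis using w positive_conj[OF _ _ u inv(1)[OF u] inv(3)[OF u] inv(2)[OF u]] by blast
    qed
    then show "u \<otimes>\<^bsub>tower UNIV\<^esub> w \<otimes>\<^bsub>tower UNIV\<^esub> inv\<^bsub>tower UNIV\<^esub> u \<in> ?R"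
      using c by (simp add: tower_def)
  qed
  fix n w assume w: "w \<in> ?R"
  have "conj_shift n w \<in> tower_set UNIV" using conj_shift_tower w by blast
  moreover have "conj_shift n w = id \<or> (\<exists>i v. positive i v (conj_shift n w))"
  proof (cases "w = id")
    case True
    show ?thesis
      by (rule disjI1) (simp add: True conj_shift_def translate_translate translate_zero fun_eq_iff)
  next
    case False
    then show ?thesis using w positive_shift by blast
  qed
  ultimately show "conj_shift n w \<in> ?R" by blast
qed

end

subsection \<open>The simple group\<close>

lemma normal_preimage:
  assumes "group G" "group H" "h \<in> hom G H" "N \<lhd> H"
  shows "{x \<in> carrier G. h x \<in> N} \<lhd> G"
proof -
  interpret group_hom G H h by (intro group_homI assms)
  interpret N: normal N H by fact
  show ?thesis unfolding G.normal_inv_iff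
  proof (intro conjI ballI)
    show "subgroup {x \<in> carrier G. h x \<in> N} G"
    proof (rule G.subgroupI)
      have "\<one>\<^bsub>G\<^esub> \<in> {x \<in> carrier G. h x \<in> N}" by simp
      then show "{x \<in> carrier G. h x \<in> N} \<noteq> {}" by blast
    qed auto
  qed (simp add: N.inv_op_closed2)
qed

text \<open>The embedding is composed of the commutator embedding, the inclusion as level 0 and a
  copy to \<open>nat\<close>. Orderability is proved for the tower itself; the other properties
  travel as \<open>countably_has\<close>, because the tower lives on a larger type. Every
  \<open>h1 x\<close> is a commutator of \<open>L\<close>, so \<open>shifted_normal_closure\<close>
  catches the whole image.\<close>

lemma simple_step:
  fixes G :: "nat monoid"
  assumes G: "group G"
  obtains H :: "nat monoid" and h where "group H" "h \<in> mon G H" "infinite (carrier H)"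
    "\<And>p. has_property G p \<Longrightarrow> has_property H p"
    "\<And>N g. N \<lhd> H \<Longrightarrow> g \<in> carrier G \<Longrightarrow> g \<noteq> \<one>\<^bsub>G\<^esub> \<Longrightarrow> h g \<in> N \<Longrightarrow> h ` carrier G \<subseteq> N"
proof -
  obtain L :: "((int \<Rightarrow> nat) \<times> int) monoid" and h1
    where L: "group L" "countable (carrier L)" "h1 \<in> mon G L"
      and Lp: "\<And>p. p \<noteq> Orderable \<Longrightarrow> countably_has p G \<Longrightarrow> countably_has p L"
      and Lo: "orderable G \<Longrightarrow> orderable L"
      and Lc: "\<And>g. g \<in> carrier G \<Longrightarrow> \<exists>a\<in>carrier L. \<exists>b\<in>carrier L. h1 g = a \<otimes>\<^bsub>L\<^esub> b \<otimes>\<^bsub>L\<^esub> inv\<^bsub>L\<^esub> a \<otimes>\<^bsub>L\<^esub> inv\<^bsub>L\<^esub> b"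
    by (rule commutator_embedding[OF G]) auto
  interpret W: wreath_tower L by (intro wreath_tower.intro L)
  let ?K = "W.shifted_tower"
  have K: "group ?K" by (rule W.shifted_tower_group)
  let ?h2 = "\<lambda>g. (W.gen 0 g, 0::int)"
  have "countable (carrier ?K)"
    using W.countable_tower[OF L(2)] by (simp add: W.shifted_tower_def semidirect_def W.tower_def)
  then obtain H :: "nat monoid" and k where H: "group H" and k: "k \<in> iso ?K H" using nat_copy[OF K] by blast
  have km: "k \<in> mon ?K H" using k by (simp add: iso_iff_mon_epi)
  have km': "inv_into (carrier ?K) k \<in> mon H ?K"
    using group.iso_set_sym[OF K k] by (simp add: iso_iff_mon_epi)
  show thesis
  proof (rule that[OF H])
    show "k \<circ> (?h2 \<circ> h1) \<in> mon G H" by (intro mon_compose[OF mon_compose[OF L(3) W.gen_mon] km])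
    \<comment> \<open>The integers that act by the shift make the group infinite, even for trivial
      \<open>G\<close>.\<close>
    have "infinite (carrier ?K)"
    proof -
      have "range (\<lambda>n. (id, n)) \<subseteq> carrier ?K"
        using W.tower_set_id by (auto simp: W.shifted_tower_def semidirect_def W.tower_def)
      moreover have "infinite (range (\<lambda>n::int. (id :: (int \<Rightarrow> (int \<Rightarrow> nat) \<times> int) \<Rightarrow> _, n)))"
      proof
        assume "finite (range (\<lambda>n::int. (id :: (int \<Rightarrow> (int \<Rightarrow> nat) \<times> int) \<Rightarrow> _, n)))"
        then have "finite (UNIV :: int set)" by (rule finite_imageD) (simp add: inj_on_def)
        then show False using infinite_UNIV_int by blast
      qed
      ultimately show ?thesis using finite_subset by blast
    qed
    then show "infinite (carrier H)" using k bij_betw_finite by (auto simp: iso_def)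
    show "has_property H p" if p: "has_property G p" for p
    proof (cases "p = Orderable")
      case True
      then have "orderable L" using p Lo by simp
      then obtain P where "cone L P" "conj_invariant L P" using orderable_iff[OF L(1)] by blast
      then interpret O: ordered_tower L P by unfold_locales
      have "has_property ?K p" using True O.orderable_shifted_tower by simp
      then show ?thesis by (rule has_property_mon[OF H K km'])
    next
      case False
      have "countably_has p L" using Lp[OF False countably_hasI[OF G p]] .
      then have "countably_has p (W.tower UNIV)" using W.countably_has_tower[OF L(2)] False by blast
      then have "countably_has p ?K" unfolding W.shifted_tower_def using W.T.countably_has_semidirect False by blast
      then show ?thesis using km' H unfolding countably_has_def by blast
    qed
    fix N g assume N: "N \<lhd> H" and g: "g \<in> carrier G" "g \<noteq> \<one>\<^bsub>G\<^esub>" "(k \<circ> (?h2 \<circ> h1)) g \<in> N"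
    have h1c: "h1 x \<in> carrier L" if "x \<in> carrier G" for x using L(3) that by (auto simp: mon_def hom_def)
    have N': "{x \<in> carrier ?K. k x \<in> N} \<lhd> ?K" using km by (intro normal_preimage[OF K H _ N]) (simp add: mon_def)
    have n1: "h1 g \<noteq> \<one>\<^bsub>L\<^esub>" using mon_eq_one_iff[OF L(3) G L(1) g(1)] g(2) by simp
    have gN: "?h2 (h1 g) \<in> {x \<in> carrier ?K. k x \<in> N}"
      using g(3) W.gen_mem_shifted[OF h1c[OF g(1)]] by simp
    show "(k \<circ> (?h2 \<circ> h1)) ` carrier G \<subseteq> N"
    proof clarify
      fix x assume "x \<in> carrier G"
      then obtain a b where ab: "a \<in> carrier L" "b \<in> carrier L"
        "h1 x = a \<otimes>\<^bsub>L\<^esub> b \<otimes>\<^bsub>L\<^esub> inv\<^bsub>L\<^esub> a \<otimes>\<^bsub>L\<^esub> inv\<^bsub>L\<^esub> b" using Lc by blast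
      have "?h2 (h1 x) \<in> {x \<in> carrier ?K. k x \<in> N}"
        unfolding ab(3) by (rule W.shifted_normal_closure[OF N' h1c[OF g(1)] n1 gN ab(1,2)])
      then show "(k \<circ> (?h2 \<circ> h1)) x \<in> N" by simp
    qed
  qed
qed

section \<open>The ascending chain on \<open>nat\<close> and its union\<close>

definition extends :: "nat monoid \<Rightarrow> nat monoid \<Rightarrow> bool" where
  "extends M M' \<longleftrightarrow> carrier M \<subseteq> carrier M' \<and>
     (\<forall>x\<in>carrier M. \<forall>y\<in>carrier M. x \<otimes>\<^bsub>M'\<^esub> y = x \<otimes>\<^bsub>M\<^esub> y)"

text \<open>Room for new elements: a group inside \<open>stage n\<close> leaves all numbers
  \<open>prod_encode (Suc n, y)\<close> free for the next one.\<close>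

definition stage :: "nat \<Rightarrow> nat set" where
  "stage n = {x. fst (prod_decode x) \<le> n}"

text \<open>The embedding is turned into an inclusion so that the limit of the chain is a plain
  union of sets. Elements of the image get their old names back, the others get fresh names from the
  next stage.\<close>

lemma simple_step_extends:
  assumes M: "group M" "carrier M \<subseteq> stage n"
  obtains M' where "group M'" "carrier M' \<subseteq> stage (Suc n)" "extends M M'" "infinite (carrier M')"
    "\<And>p. has_property M p \<Longrightarrow> has_property M' p"
    "\<And>N g. N \<lhd> M' \<Longrightarrow> g \<in> carrier M \<Longrightarrow> g \<noteq> \<one>\<^bsub>M\<^esub> \<Longrightarrow> g \<in> N \<Longrightarrow> carrier M \<subseteq> N"
proof -
  obtain H :: "nat monoid" and h where H: "group H" "h \<in> mon M H" "infinite (carrier H)"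
    and Hp: "\<And>p. has_property M p \<Longrightarrow> has_property H p"
    and Hn: "\<And>N g. N \<lhd> H \<Longrightarrow> g \<in> carrier M \<Longrightarrow> g \<noteq> \<one>\<^bsub>M\<^esub> \<Longrightarrow> h g \<in> N \<Longrightarrow> h ` carrier M \<subseteq> N"
    by (rule simple_step[OF M(1)]) auto
  have hinj: "inj_on h (carrier M)" and hc: "\<And>x. x \<in> carrier M \<Longrightarrow> h x \<in> carrier H"
    and hm: "\<And>x y. x \<in> carrier M \<Longrightarrow> y \<in> carrier M \<Longrightarrow> h (x \<otimes>\<^bsub>M\<^esub> y) = h x \<otimes>\<^bsub>H\<^esub> h y"
    using H(2) by (auto simp: mon_def hom_def)
  define \<phi> where "\<phi> y = (if y \<in> h ` carrier M then inv_into (carrier M) h y else prod_encode (Suc n, y))" for y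
  have \<phi>h: "\<phi> (h x) = x" if "x \<in> carrier M" for x
    using that inv_into_f_f[OF hinj that] by (simp add: \<phi>_def)
  have new: "prod_encode (Suc n, y) \<notin> carrier M" for y
    using M(2) by (auto simp: stage_def)
  have inj: "inj_on \<phi> (carrier H)"
  proof (rule inj_onI)
    fix y z assume e: "\<phi> y = \<phi> z"
    have i: "\<phi> y \<in> carrier M \<longleftrightarrow> y \<in> h ` carrier M" for y
    proof
      assume "\<phi> y \<in> carrier M"
      then show "y \<in> h ` carrier M" using new[of y] unfolding \<phi>_def by presburger
    qed (use \<phi>h in auto)
    show "y = z"
    proof (cases "y \<in> h ` carrier M")
      case True
      then have "z \<in> h ` carrier M" using i e by metis
      then show ?thesis using True e \<phi>h by auto
    next
      case False
      then have "z \<notin> h ` carrier M" using i e by metis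
      then show ?thesis using False e by (simp add: \<phi>_def)
    qed
  qed
  let ?M = "transport \<phi> H"
  note iso = transport_iso(1)[OF H(1) inj] and Mg = transport_iso(2)[OF H(1) inj]
  have \<phi>m: "\<phi> (x \<otimes>\<^bsub>H\<^esub> y) = \<phi> x \<otimes>\<^bsub>?M\<^esub> \<phi> y" if "x \<in> carrier H" "y \<in> carrier H" for x y
    using iso that by (auto simp: iso_def hom_def)
  have \<phi>c: "\<phi> x \<in> carrier ?M" if "x \<in> carrier H" for x
    using iso that by (auto simp: iso_def hom_def)
  show thesis
  proof (rule that[OF Mg])
    show "carrier ?M \<subseteq> stage (Suc n)"
    proof
      fix z assume "z \<in> carrier ?M"
      then obtain y where y: "y \<in> carrier H" "z = \<phi> y" by (auto simp: transport_def)
      show "z \<in> stage (Suc n)"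
      proof (cases "y \<in> h ` carrier M")
        case True
        then have "z \<in> carrier M" using y \<phi>h by auto
        then show ?thesis using M(2) by (auto simp: stage_def)
      qed (simp add: y \<phi>_def stage_def)
    qed
    show "extends M ?M" unfolding extends_def
    proof (intro conjI ballI subsetI)
      show "x \<in> carrier ?M" if "x \<in> carrier M" for x using \<phi>c[OF hc[OF that]] \<phi>h[OF that] by simp
      fix x y assume x: "x \<in> carrier M" and y: "y \<in> carrier M"
      have "x \<otimes>\<^bsub>M\<^esub> y \<in> carrier M" using M(1) x y by (simp add: group.is_monoid monoid.m_closed)
      then have "\<phi> (h x \<otimes>\<^bsub>H\<^esub> h y) = x \<otimes>\<^bsub>M\<^esub> y" using hm[OF x y] \<phi>h by metis
      then show "x \<otimes>\<^bsub>?M\<^esub> y = x \<otimes>\<^bsub>M\<^esub> y" using \<phi>m[OF hc[OF x] hc[OF y]] \<phi>h[OF x] \<phi>h[OF y] by simp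
    qed
    show "infinite (carrier ?M)" using H(3) finite_image_iff[OF inj] by (simp add: transport_def)
    show "has_property ?M p" if "has_property M p" for p
    proof -
      have "inv_into (carrier H) \<phi> \<in> mon ?M H"
        using group.iso_set_sym[OF H(1) iso] by (simp add: iso_iff_mon_epi)
      then show ?thesis using has_property_mon[OF Mg H(1)] Hp[OF that] by blast
    qed
    fix N g assume N: "N \<lhd> ?M" and g: "g \<in> carrier M" "g \<noteq> \<one>\<^bsub>M\<^esub>" "g \<in> N"
    have "{x \<in> carrier H. \<phi> x \<in> N} \<lhd> H" by (rule normal_preimage[OF H(1) Mg _ N]) (use iso in \<open>simp add: iso_def\<close>)
    moreover have "h g \<in> {x \<in> carrier H. \<phi> x \<in> N}" using g hc \<phi>h by simp
    ultimately have "h ` carrier M \<subseteq> {x \<in> carrier H. \<phi> x \<in> N}" using Hn g by blast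
    then show "carrier M \<subseteq> N" using \<phi>h by (auto simp: image_subset_iff)
  qed
qed

text \<open>Along a chain, any index at which both factors are present gives the same product;
  \<open>LEAST\<close> merely makes a choice.\<close>

definition union_group :: "(nat \<Rightarrow> nat monoid) \<Rightarrow> nat monoid" where
  "union_group M = \<lparr>carrier = (\<Union>n. carrier (M n)),
     monoid.mult = (\<lambda>x y. x \<otimes>\<^bsub>M (LEAST n. x \<in> carrier (M n) \<and> y \<in> carrier (M n))\<^esub> y), one = \<one>\<^bsub>M 0\<^esub>\<rparr>"

context
  fixes M :: "nat \<Rightarrow> nat monoid"
  assumes grp: "\<And>n. group (M n)" and ext: "\<And>n. extends (M n) (M (Suc n))"
begin

lemma chain_extends: "m \<le> n \<Longrightarrow> extends (M m) (M n)"
proof (induction n rule: dec_induct)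
  case base
  show ?case by (simp add: extends_def)
next
  case (step n)
  then show ?case using ext[of n] by (auto simp: extends_def subset_iff)
qed

lemma union_mult:
  assumes "x \<in> carrier (M n)" "y \<in> carrier (M n)"
  shows "x \<otimes>\<^bsub>union_group M\<^esub> y = x \<otimes>\<^bsub>M n\<^esub> y"
proof -
  let ?l = "LEAST n. x \<in> carrier (M n) \<and> y \<in> carrier (M n)"
  have "x \<in> carrier (M ?l) \<and> y \<in> carrier (M ?l)" by (rule LeastI[of _ n]) (use assms in simp)
  moreover have "?l \<le> n" by (rule Least_le) (use assms in simp)
  ultimately show ?thesis using chain_extends[of ?l n] by (simp add: union_group_def extends_def)
qed

lemma union_one: "\<one>\<^bsub>union_group M\<^esub> = \<one>\<^bsub>M n\<^esub>"
proof -
  interpret n: group "M n" by (rule grp)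
  interpret z: group "M 0" by (rule grp)
  have e: "extends (M 0) (M n)" by (rule chain_extends) simp
  then have c: "\<one>\<^bsub>M 0\<^esub> \<in> carrier (M n)" using z.one_closed by (auto simp: extends_def)
  \<comment> \<open>\<open>extends\<close> says nothing about units, but the unit of
    \<open>M 0\<close> is idempotent in \<open>M n\<close>, and a group has only one
    idempotent.\<close>
  have "\<one>\<^bsub>M 0\<^esub> \<otimes>\<^bsub>M n\<^esub> \<one>\<^bsub>M 0\<^esub> = \<one>\<^bsub>M 0\<^esub>" using e by (simp add: extends_def)
  then have "\<one>\<^bsub>M 0\<^esub> = \<one>\<^bsub>M n\<^esub>" using c by (metis n.l_cancel_one)
  then show ?thesis by (simp add: union_group_def)
qed

lemma union_common:
  assumes "finite F" "F \<subseteq> carrier (union_group M)"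
  obtains n where "F \<subseteq> carrier (M n)"
  using finite_subset_chain[of "\<lambda>n. carrier (M n)", OF _ assms(1)] assms(2) ext
  by (auto simp: union_group_def extends_def)

lemma union_group_group: "group (union_group M)"
proof (rule groupI)
  fix x y assume "x \<in> carrier (union_group M)" "y \<in> carrier (union_group M)"
  then obtain n where n: "{x, y} \<subseteq> carrier (M n)" using union_common[of "{x, y}"] by auto
  interpret n: group "M n" by (rule grp)
  have "x \<otimes>\<^bsub>union_group M\<^esub> y \<in> carrier (M n)" using n by (simp add: union_mult[of _ n])
  then show "x \<otimes>\<^bsub>union_group M\<^esub> y \<in> carrier (union_group M)"
    unfolding union_group_def by auto
next
  show "\<one>\<^bsub>union_group M\<^esub> \<in> carrier (union_group M)"
    using grp[of 0] by (auto simp: union_group_def intro!: exI[of _ 0] monoid.one_closed group.is_monoid)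
next
  fix x y z assume "x \<in> carrier (union_group M)" "y \<in> carrier (union_group M)" "z \<in> carrier (union_group M)"
  then obtain n where n: "{x, y, z} \<subseteq> carrier (M n)" using union_common[of "{x, y, z}"] by auto
  interpret n: group "M n" by (rule grp)
  show "x \<otimes>\<^bsub>union_group M\<^esub> y \<otimes>\<^bsub>union_group M\<^esub> z = x \<otimes>\<^bsub>union_group M\<^esub> (y \<otimes>\<^bsub>union_group M\<^esub> z)"
    using n by (simp add: union_mult[of _ n] n.m_assoc)
next
  fix x assume "x \<in> carrier (union_group M)"
  then obtain n where n: "x \<in> carrier (M n)" by (auto simp: union_group_def)
  interpret n: group "M n" by (rule grp)
  show "\<one>\<^bsub>union_group M\<^esub> \<otimes>\<^bsub>union_group M\<^esub> x = x"
    using n by (simp add: union_one[of n] union_mult[of _ n])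
  have "inv\<^bsub>M n\<^esub> x \<otimes>\<^bsub>union_group M\<^esub> x = \<one>\<^bsub>union_group M\<^esub>"
    using n by (simp add: union_one[of n] union_mult[of _ n])
  moreover have "inv\<^bsub>M n\<^esub> x \<in> carrier (union_group M)" using n by (auto simp: union_group_def)
  ultimately show "\<exists>y\<in>carrier (union_group M). y \<otimes>\<^bsub>union_group M\<^esub> x = \<one>\<^bsub>union_group M\<^esub>" by blast
qed

lemma union_incl: "(\<lambda>x. x) \<in> mon (M n) (union_group M)"
  using union_mult by (auto simp: mon_def hom_def) (auto simp: union_group_def)

lemma union_subgroup: "subgroup (carrier (M n)) (union_group M)"
proof -
  have "group_hom (M n) (union_group M) (\<lambda>x. x)"
    using union_incl by (intro group_homI grp union_group_group) (simp add: mon_def)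
  from group_hom.img_is_subgroup[OF this] show ?thesis by simp
qed

lemma has_property_union:
  assumes "\<And>n. has_property (M n) p"
  shows "has_property (union_group M) p"
proof (rule has_property_Un[OF union_group_group union_subgroup])
  show "carrier (M n) \<subseteq> carrier (M (Suc n))" for n using ext by (simp add: extends_def)
  show "(\<Union>n. carrier (M n)) = carrier (union_group M)" by (simp add: union_group_def)
  fix n
  have "(\<lambda>x. x) \<in> mon (union_group M\<lparr>carrier := carrier (M n)\<rparr>) (M n)"
    using union_mult by (auto simp: mon_def hom_def)
  then show "has_property (union_group M\<lparr>carrier := carrier (M n)\<rparr>) p"
    by (rule has_property_mon[OF group.subgroup_imp_group[OF union_group_group union_subgroup] grp _ assms])
qed

text \<open>A non-trivial \<open>g\<close> in \<open>N\<close> and an arbitrary \<open>x\<close> lie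
  in a common \<open>M n\<close>. The intersection of \<open>N\<close> with \<open>M (Suc n)\<close>
  is normal there and contains \<open>g\<close>, hence all of \<open>M n\<close>, hence
  \<open>x\<close>.\<close>

lemma union_simple:
  assumes nc: "\<And>n N g. N \<lhd> M (Suc n) \<Longrightarrow> g \<in> carrier (M n) \<Longrightarrow> g \<noteq> \<one>\<^bsub>M n\<^esub> \<Longrightarrow> g \<in> N \<Longrightarrow> carrier (M n) \<subseteq> N"
    and nontriv: "carrier (union_group M) \<noteq> {\<one>\<^bsub>union_group M\<^esub>}"
  shows "is_simple (union_group M)"
  unfolding is_simple_def
proof (intro conjI allI impI union_group_group nontriv)
  fix N assume N: "N \<lhd> union_group M"
  have Ns: "subgroup N (union_group M)" using N by (rule normal_imp_subgroup)
  show "N = {\<one>\<^bsub>union_group M\<^esub>} \<or> N = carrier (union_group M)"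
  proof (cases "N \<subseteq> {\<one>\<^bsub>union_group M\<^esub>}")
    case True
    then show ?thesis using subgroup.one_closed[OF Ns] by blast
  next
    case False
    then obtain g where g: "g \<in> N" "g \<noteq> \<one>\<^bsub>union_group M\<^esub>" by blast
    have gc: "g \<in> carrier (union_group M)" by (rule subgroup.mem_carrier[OF Ns g(1)])
    have "x \<in> N" if x: "x \<in> carrier (union_group M)" for x
    proof -
      obtain n where n: "{x, g} \<subseteq> carrier (M n)" using union_common[of "{x, g}"] x gc by auto
      have n': "{x, g} \<subseteq> carrier (M (Suc n))" using n ext[of n] by (auto simp: extends_def)
      have "{y \<in> carrier (M (Suc n)). y \<in> N} \<lhd> M (Suc n)"
        by (rule normal_preimage[OF grp union_group_group _ N]) (use union_incl in \<open>simp add: mon_def\<close>)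
      then have "carrier (M n) \<subseteq> {y \<in> carrier (M (Suc n)). y \<in> N}"
        using nc[of _ n g] g n n' union_one[of n] by simp
      then show ?thesis using n by blast
    qed
    then show ?thesis using subgroup.subset[OF Ns] by blast
  qed
qed

end

theorem theorem3p4:
  fixes G :: "'a monoid" and D :: "group_property set"
  assumes "group G" and "countable (carrier G)"
    and "\<forall>P\<in>D. has_property G P"
  shows "\<exists>(S :: nat monoid) h.
           is_simple S \<and> countable (carrier S) \<and> infinite (carrier S) \<and>
           (\<forall>P\<in>D. has_property S P) \<and> h \<in> mon G S"
proof -
  \<comment> \<open>The first component 0 places the copy of \<open>G\<close> in
    \<open>stage 0\<close>.\<close>
  let ?f = "\<lambda>x. prod_encode (0, to_nat_on (carrier G) x)"
  have inj: "inj_on ?f (carrier G)"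
    using inj_on_to_nat_on[OF assms(2)] by (simp add: inj_on_def)
  let ?G = "transport ?f G"
  note iso = transport_iso(1)[OF assms(1) inj] and grp0 = transport_iso(2)[OF assms(1) inj]
  have im: "?f \<in> mon G ?G" using iso by (simp add: iso_iff_mon_epi)
  have "inv_into (carrier G) ?f \<in> mon ?G G"
    using group.iso_set_sym[OF assms(1) iso] by (simp add: iso_iff_mon_epi)
  then have prop0: "has_property ?G p" if "p \<in> D" for p
    using has_property_mon[OF grp0 assms(1)] assms(3) that by blast
  \<comment> \<open>The last conjunct pins the start of the chosen sequence, so that the embedding
    of \<open>G\<close> ends in \<open>M 0\<close>.\<close>
  let ?P = "\<lambda>n M. group M \<and> carrier M \<subseteq> stage n \<and> (\<forall>p\<in>D. has_property M p) \<and> (n = 0 \<longrightarrow> M = ?G)"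
  let ?Q = "\<lambda>M M'. extends M M' \<and> infinite (carrier M') \<and>
    (\<forall>N g. N \<lhd> M' \<longrightarrow> g \<in> carrier M \<longrightarrow> g \<noteq> \<one>\<^bsub>M\<^esub> \<longrightarrow> g \<in> N \<longrightarrow> carrier M \<subseteq> N)"
  have "\<exists>M. \<forall>n. ?P n (M n) \<and> ?Q (M n) (M (Suc n))"
  proof (rule dependent_nat_choice)
    have "carrier ?G \<subseteq> stage 0" by (auto simp: transport_def stage_def)
    then show "\<exists>M. ?P 0 M" using grp0 prop0 by blast
    fix M n assume M: "?P n M"
    then have g: "group M" "carrier M \<subseteq> stage n" by blast+
    obtain M' where M': "group M'" "carrier M' \<subseteq> stage (Suc n)" "extends M M'" "infinite (carrier M')"
      "\<And>p. has_property M p \<Longrightarrow> has_property M' p"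
      "\<And>N g. N \<lhd> M' \<Longrightarrow> g \<in> carrier M \<Longrightarrow> g \<noteq> \<one>\<^bsub>M\<^esub> \<Longrightarrow> g \<in> N \<Longrightarrow> carrier M \<subseteq> N"
      by (rule simple_step_extends[OF g]) auto
    have a: "\<forall>p\<in>D. has_property M' p" using M M'(5) by blast
    have b: "\<forall>N g. N \<lhd> M' \<longrightarrow> g \<in> carrier M \<longrightarrow> g \<noteq> \<one>\<^bsub>M\<^esub> \<longrightarrow> g \<in> N \<longrightarrow> carrier M \<subseteq> N"
      using M'(6) by blast
    have "?P (Suc n) M'"
    proof (intro conjI)
      show "Suc n = 0 \<longrightarrow> M' = ?G" by simp
    qed (rule M'(1,2) a)+
    moreover have "?Q M M'"
    proof (intro conjI)
      show "extends M M'" "infinite (carrier M')" by (rule M'(3,4))+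
    qed (rule b)
    ultimately show "\<exists>M'. ?P (Suc n) M' \<and> ?Q M M'" by (intro exI[of _ M'] conjI[of "?P (Suc n) M'"])
  qed
  then obtain M where MQ: "\<forall>n. ?P n (M n) \<and> ?Q (M n) (M (Suc n))" ..
  have M: "?P n (M n)" and Q: "?Q (M n) (M (Suc n))" for n
    by (rule spec[OF MQ, THEN conjunct1], rule spec[OF MQ, THEN conjunct2])
  have grp: "group (M n)" and ext: "extends (M n) (M (Suc n))" for n using M Q by blast+
  let ?S = "union_group M"
  have "carrier (M 1) \<subseteq> carrier ?S" by (auto simp: union_group_def)
  \<comment> \<open>\<open>M 0\<close> may be finite, but the first step already makes the group
    infinite.\<close>
  moreover have "infinite (carrier (M 1))" using Q[of 0] by simp
  ultimately have inf: "infinite (carrier ?S)" using finite_subset by blast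
  have "carrier ?S \<noteq> {\<one>\<^bsub>?S\<^esub>}" using inf by (metis finite.emptyI finite_insert)
  then have "is_simple ?S" using Q by (intro union_simple[of M, OF grp ext]) blast+
  moreover have "has_property ?S p" if "p \<in> D" for p
    by (rule has_property_union[of M, OF grp ext]) (use M that in blast)
  moreover have "(\<lambda>x. x) \<circ> ?f \<in> mon G ?S"
  proof (rule mon_compose)
    have "M 0 = ?G" using M by blast
    then show "?f \<in> mon G (M 0)" using im by simp
    show "(\<lambda>x. x) \<in> mon (M 0) ?S" by (rule union_incl[of M, OF grp ext])
  qed
  ultimately show ?thesis using inf by (intro exI[of _ ?S]) auto
qed

end
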